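(* Let $n\geq3$, $p\in(n,\infty)$ and let $q$ be the conjugate exponent of $p$. (1) If $u=\mathcal{P}_{\mathbb{B}^{n}}[\phi]$ with $\phi\in L^{p}(\mathbb{S}^{n-1},\mathbb{R})$, then for any $x\in\mathbb{B}^{n}$ the following sharp inequality holds: $$|\nabla u(x)|\leq 2(n-1)\left(\frac{\Gamma(\frac{n}{2})\Gamma(\frac{q+1}{2})(1+|x|^{2})^{(n-1)(q-1)}}{\sqrt{\pi}\,\Gamma(\frac{q+n}{2})(1-|x|^2)^{n(q-1)+1}}\right)^{\frac1q}\left({}_{2}F_{1}\Big(\tfrac{(n-1)(1-q)}{2},\tfrac{1-(n-1)(q-1)}{2};\tfrac{q+n}{2};\tfrac{4|x|^{2}}{(1+|x|^{2})^{2}}\Big)\right)^{\frac1q}\|\phi\|_{L^{p}(\mathbb{S}^{n-1},\mathbb{R})}.$$ (2) If $u=\mathcal{P}_{\mathbb{H}^{n}}[\phi]$ with $\phi\in L^{p}(\mathbb{R}^{n-1},\mathbb{R})$, then for any $x\in\mathbb{H}^{n}$ the following sharp inequality holds: $$|\nabla u(x)|\leq\frac{(n-1)\Gamma(\frac{n}{2})}{2^{\frac{q-1}{q}}\pi^{\frac{nq-n+1}{2q}}x_{n}^{\frac{n(q-1)+1}{q}}}\left(\frac{\Gamma(\frac{q+1}{2})}{\Gamma(\frac{q+n}{2})}\;{}_{2}F_{1}\Big(\tfrac{(n-1)(1-q)}{2},\tfrac{1-(n-1)(q-1)}{2};\tfrac{q+n}{2};1\Big)\right)^{\frac1q}\|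\phi\|_{L^{p}(\mathbb{R}^{n-1},\mathbb{R})}.$$
   Context: $|\cdot|$ is the Euclidean norm on $\mathbb{R}^n$; $\mathbb{B}^n=\{|x|<1\}$, $\mathbb{S}^{n-1}=\{|x|=1\}$, $\mathbb{H}^n=\{x=(x',x_n): x'\in\mathbb{R}^{n-1},\,x_n>0\}$. $\Gamma$ is the Gamma function. $\sigma$ is the surface measure on $\mathbb{S}^{n-1}$ normalized so that $\sigma(\mathbb{S}^{n-1})=1$, and $V_{n-1}$ is Lebesgue measure on $\mathbb{R}^{n-1}$. $L^p(\mathbb{S}^{n-1},\mathbb{R})$ and $L^p(\mathbb{R}^{n-1},\mathbb{R})$ are taken with respect to $\sigma$ and $V_{n-1}$ respectively. Conjugate exponent: $1/p+1/q=1$. Poisson–Szegő integrals (for the hyperbolic Laplacian): $$\mathcal{P}_{\mathbb{B}^n}[\phi](x)=\int_{\mathbb{S}^{n-1}}\Big(\frac{1-|x|^2}{|x-\zeta|^2}\Big)^{n-1}\phi(\zeta)\,d\sigma(\zeta),\quad x\in\mathbb{B}^n,$$ $$\mathcal{P}_{\mathbb{H}^n}[\phi](x)=c_n\int_{\mathbb{R}^{n-1}}\Big(\frac{x_n}{|x'-y'|^2+x_n^2}\Big)^{n-1}\phi(y')\,dV_{n-1}(y'),\quad x\in\mathbb{H}^n,\qquad c_n=\frac{2^{n-2}\Gamma(n/2)}{\pi^{n/2}}.$$ "Sharp" means that, for each fixed $x$, the coefficient multiplying $\|\phi\|_{L^p}$ is the smallest constant for which the inequality holds for all $\phi\in L^p$.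 The hypergeometric series is ${}_2F_1(a,b;c;t)=\sum_{k=0}^\infty\frac{(a)_k(b)_k}{k!\,(c)_k}t^k$, where $(a)_0=1$, $(a)_k=a(a+1)\cdots(a+k-1)$ (with $t=1$ meaning the sum of the series at $1$). *)

theory Defs
  imports "HOL-Analysis.Analysis"
begin

text \<open>
  The normalized surface measure, as a measure whose space is the unit sphere: the image of the
  uniform distribution on the unit ball under radial projection, so that \<open>A\<close> has measure equal to
  the proportion of the ball filled by the cone over \<open>A\<close>. (The centre of the ball, where the
  projection is undefined, is a null set.) The Borel measure is completed, as for
  \<^term>\<open>lebesgue\<close>.
\<close>

definition sphere_measure :: "'a::euclidean_space measure" where
  "sphere_measure =
     completion (restrict_space
       (distr (uniform_measure lborel (ball 0 1)) borel (\<lambda>x. x /\<^sub>R norm x)) (sphere 0 1))"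

lemma emeasure_sphere_measure:
  fixes A :: "'a::euclidean_space set"
  assumes A: "A \<in> sets borel" "A \<subseteq> sphere 0 1"
  shows "emeasure sphere_measure A =
    emeasure lborel {t *\<^sub>R \<zeta> | t \<zeta>. 0 < t \<and> t < 1 \<and> \<zeta> \<in> A} / emeasure lborel (ball (0::'a) 1)"
proof -
  define D :: "'a measure" where
    "D = distr (uniform_measure lborel (ball 0 1)) borel (\<lambda>x. x /\<^sub>R norm x)"
  have S: "sphere 0 1 \<inter> space D \<in> sets D"
    by (auto simp: D_def)
  have m: "(\<lambda>x::'a. x /\<^sub>R norm x) \<in> measurable borel borel"
    by measurable
  have cone: "ball 0 1 \<inter> (\<lambda>x::'a. x /\<^sub>R norm x) -` A = {t *\<^sub>R \<zeta> | t \<zeta>. 0 < t \<and> t < 1 \<and> \<zeta> \<in> A}"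
  proof (intro set_eqI iffI)
    fix x assume x: "x \<in> ball 0 1 \<inter> (\<lambda>x::'a. x /\<^sub>R norm x) -` A"
    then have "x \<noteq> 0" using A by force
    then have "x = norm x *\<^sub>R (x /\<^sub>R norm x)" "0 < norm x" "norm x < 1" using x by auto
    then show "x \<in> {t *\<^sub>R \<zeta> | t \<zeta>. 0 < t \<and> t < 1 \<and> \<zeta> \<in> A}" using x by blast
  next
    fix x assume "x \<in> {t *\<^sub>R \<zeta> | t \<zeta>. 0 < t \<and> t < 1 \<and> \<zeta> \<in> A}"
    then obtain t \<zeta> where "x = t *\<^sub>R \<zeta>" "0 < t" "t < 1" "\<zeta> \<in> A" by blast
    moreover from this have "norm \<zeta> = 1" using A by auto
    ultimately show "x \<in> ball 0 1 \<inter> (\<lambda>x::'a. x /\<^sub>R norm x) -` A" by auto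
  qed
  have AS: "A \<in> sets (restrict_space D (sphere 0 1))"
    using A by (subst sets_restrict_space_iff[OF S]) (auto simp: D_def)
  have "emeasure sphere_measure A = emeasure D A"
    unfolding sphere_measure_def D_def[symmetric]
    using AS A S by (simp add: emeasure_restrict_space)
  also have "\<dots> = emeasure (uniform_measure lborel (ball 0 1)) ((\<lambda>x::'a. x /\<^sub>R norm x) -` A)"
    unfolding D_def using A m by (subst emeasure_distr) auto
  also have "\<dots> = emeasure lborel (ball 0 1 \<inter> (\<lambda>x::'a. x /\<^sub>R norm x) -` A) / emeasure lborel (ball (0::'a) 1)"
    using measurable_sets[OF m A(1)] by (subst emeasure_uniform_measure) auto
  finally show ?thesis by (simp only: cone)
qed

lemma emeasure_sphere_measure_sphere: "emeasure sphere_measure (sphere (0::'a::euclidean_space) 1) = 1"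
proof -
  have cone: "{t *\<^sub>R \<zeta> | t \<zeta>. 0 < t \<and> t < 1 \<and> \<zeta> \<in> sphere (0::'a) 1} = ball 0 1 - {0}"
  proof (intro set_eqI iffI)
    fix x :: 'a assume x: "x \<in> ball 0 1 - {0}"
    then have "x = norm x *\<^sub>R (x /\<^sub>R norm x)" "0 < norm x" "norm x < 1" "x /\<^sub>R norm x \<in> sphere 0 1"
      by auto
    then show "x \<in> {t *\<^sub>R \<zeta> | t \<zeta>. 0 < t \<and> t < 1 \<and> \<zeta> \<in> sphere (0::'a) 1}" by blast
  qed auto
  have 1: "emeasure lborel (ball (0::'a) 1) \<noteq> 0" "emeasure lborel (ball (0::'a) 1) \<noteq> \<infinity>"
    using emeasure_lborel_ball_finite[of "0::'a" 1] open_not_negligible[of "ball (0::'a) 1"]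
    by (auto simp: negligible_iff_null_sets null_sets_completion_iff null_sets_def)
  have "emeasure lborel (ball (0::'a) 1 - {0}) = emeasure lborel (ball (0::'a) 1)"
    by (intro emeasure_Diff_null_set) auto
  moreover have "emeasure lborel (ball (0::'a) 1) / emeasure lborel (ball (0::'a) 1) = 1"
    using 1 by (intro ennreal_divide_self) (auto simp: less_top)
  moreover have "sphere (0::'a) 1 \<in> sets borel" by simp
  ultimately show ?thesis
    by (simp only: emeasure_sphere_measure[OF _ order_refl] cone)
qed

definition Lp_space :: "real \<Rightarrow> 'a measure \<Rightarrow> ('a \<Rightarrow> real) set" where
  "Lp_space p M = {\<phi> \<in> borel_measurable M. integrable M (\<lambda>x. \<bar>\<phi> x\<bar> powr p)}"

definition Lp_norm :: "real \<Rightarrow> 'a measure \<Rightarrow> ('a \<Rightarrow> real) \<Rightarrow> real" where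
  "Lp_norm p M \<phi> = (LINT x|M. \<bar>\<phi> x\<bar> powr p) powr (1 / p)"

definition poisson_ball :: "('a::euclidean_space \<Rightarrow> real) \<Rightarrow> 'a \<Rightarrow> real" where
  "poisson_ball \<phi> x =
     (LINT \<zeta>|sphere_measure. ((1 - (norm x)\<^sup>2) / (norm (x - \<zeta>))\<^sup>2) ^ (DIM('a) - 1) * \<phi> \<zeta>)"

text \<open>
  Points of \<open>\<real>\<^sup>n\<close> are written as pairs \<open>(x', x\<^sub>n)\<close> in the product \<open>'b \<times> real\<close> with
  \<open>DIM('b) = n - 1\<close>, whose norm and inner product are the Euclidean ones.
\<close>

definition half_space :: "('b::euclidean_space \<times> real) set" where
  "half_space = {x. 0 < snd x}"

definition poisson_half_space ::
  "('b::euclidean_space \<Rightarrow> real) \<Rightarrow> 'b \<times> real \<Rightarrow> real" where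
  "poisson_half_space \<phi> x =
     (let n = DIM('b) + 1 in
      2 ^ (n - 2) * Gamma (real n / 2) / pi powr (real n / 2) *
      (LINT y|lebesgue. (snd x / ((norm (fst x - y))\<^sup>2 + (snd x)\<^sup>2)) ^ (n - 1) * \<phi> y))"

definition hypergeo_2F1 :: "real \<Rightarrow> real \<Rightarrow> real \<Rightarrow> real \<Rightarrow> real" where
  "hypergeo_2F1 a b c t =
     (\<Sum>k. pochhammer a k * pochhammer b k / (fact k * pochhammer c k) * t ^ k)"

definition gradient :: "('a::real_inner \<Rightarrow> real) \<Rightarrow> 'a \<Rightarrow> 'a" where
  "gradient u x = (THE D. GDERIV u x :> D)"

text \<open>
  For an integral operator \<open>P\<close> on \<open>L\<^sup>p(M)\<close>, the gradient estimate at the point \<open>x\<close> holds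
  with the constant \<open>C\<close>, and \<open>C\<close> is the smallest constant for which it holds. Differentiability
  at \<open>x\<close> makes the gradient meaningful.
\<close>

definition sharp_gradient_estimate ::
  "(('b \<Rightarrow> real) \<Rightarrow> 'a::real_inner \<Rightarrow> real) \<Rightarrow> real \<Rightarrow> 'b measure \<Rightarrow> 'a \<Rightarrow> real \<Rightarrow> bool" where
  "sharp_gradient_estimate P p M x C \<longleftrightarrow>
     (\<forall>\<phi>\<in>Lp_space p M. P \<phi> differentiable (at x) \<and>
        norm (gradient (P \<phi>) x) \<le> C * Lp_norm p M \<phi>) \<and>
     (\<forall>C'. (\<forall>\<phi>\<in>Lp_space p M. norm (gradient (P \<phi>) x) \<le> C' * Lp_norm p M \<phi>) \<longrightarrow> C \<le> C')"

end

theory Submission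
  imports Defs
begin

text \<open>
  The logarithmic gradient of the Poisson kernel has constant hyperbolic length, so
  \<open>\<nabla>P\<^sup>n\<^sup>-\<^sup>1 = (n - 1) P\<^sup>n\<^sup>-\<^sup>1 \<rho>(x) \<omega>\<close> with \<open>\<rho>\<close> the conformal factor of the hyperbolic metric and a unit
  vector \<open>\<omega>\<close> depending on the boundary point. By duality the best constant is the maximum over
  directions \<open>l\<close> of the \<open>L\<^sup>q\<close> norm of the \<open>l\<close>-component. The map from the boundary point to \<open>\<omega>\<close>
  is a Moebius map of the sphere (for the ball) or a stereographic projection (for the half-space)
  with Jacobian \<open>P\<^sup>n\<^sup>-\<^sup>1\<close>, and taking \<open>\<omega>\<close> as the variable of integration leads in both cases to
  \<open>\<integral> (1 + t (\<omega> \<bullet> e))\<^sup>s \<bar>\<omega> \<bullet> l\<bar>\<^sup>q d\<sigma>(\<omega>)\<close> with \<open>s = (n - 1)(q - 1)\<close>, where \<open>t = 1\<close> for the half-space.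
  The hypothesis \<open>p > n\<close> says \<open>s < 1\<close>; then the even part of \<open>(1 + u)\<^sup>s\<close> decreases in \<open>\<bar>u\<bar>\<close>, a
  reflection shows that directions \<open>l\<close> orthogonal to \<open>e\<close> are extremal, and for those the binomial
  series integrates termwise to the hypergeometric series.
\<close>

subsection \<open>Lebesgue measure, the sphere and polar coordinates\<close>

text \<open>Apart from its power, the kernel is the exponential of a Busemann function of hyperbolic
  space, whose gradient has hyperbolic length one; hence only the direction \<omega> depends on the
  boundary point. The \<open>q\<close>-th power of the gradient contains the kernel base to the
  power \<open>(n - 1) q\<close>, the Jacobian uses up \<open>n - 1\<close> of it, and
  \<open>s\<close> is what remains. In the variable \<omega> that base is an affine function, which
  produces \<open>1 + t (\<omega> \<bullet> e)\<close>; for the ball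
  \<open>t = 2 |x| / (1 + |x|^2)\<close>, whose square is the argument of the hypergeometric series.
  The sphere measure is defined through cones in the ball. Each identity for it is therefore found
  by evaluating one Lebesgue integral in two ways: Gaussians give the moments, the light cone gives
  stereographic projection, and through the latter Moebius maps become dilations. For
  \<open>t = 1\<close> the binomial series is needed up to the edge of its interval of convergence.
  The signs of its even coefficients bound all partial sums by 1, so dominated convergence applies
  directly, without a limit in \<open>t\<close>.\<close>

lemma ball_sphere_borel[measurable]:
  "ball (c::'a::euclidean_space) r \<in> sets borel" "sphere (c::'a::euclidean_space) r \<in> sets borel"
  by auto

lemma nn_integral_lborel_affine:
  fixes f :: "'a::euclidean_space \<Rightarrow> ennreal"
  assumes [measurable]: "f \<in> borel_measurable borel" and c: "c \<noteq> 0"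
  shows "(\<integral>\<^sup>+x. f x \<partial>lborel) = ennreal (\<bar>c\<bar> ^ DIM('a)) * (\<integral>\<^sup>+x. f (t + c *\<^sub>R x) \<partial>lborel)"
proof -
  have "(\<integral>\<^sup>+x. f x \<partial>lborel)
      = (\<integral>\<^sup>+x. f x \<partial>density (distr lborel borel (\<lambda>x. t + c *\<^sub>R x)) (\<lambda>_. ennreal (\<bar>c\<bar> ^ DIM('a))))"
    by (subst lborel_affine[OF c, of t]) simp
  also have "\<dots> = ennreal (\<bar>c\<bar> ^ DIM('a)) * (\<integral>\<^sup>+x. f (t + c *\<^sub>R x) \<partial>lborel)"
    by (subst nn_integral_density) (auto simp: nn_integral_distr nn_integral_cmult)
  finally show ?thesis .
qed

lemma nn_integral_lborel_translate:
  fixes f :: "'a::euclidean_space \<Rightarrow> ennreal"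
  assumes "f \<in> borel_measurable borel"
  shows "(\<integral>\<^sup>+x. f (x - t) \<partial>lborel) = (\<integral>\<^sup>+x. f x \<partial>lborel)"
  using nn_integral_lborel_affine[OF assms, of 1 "-t"] by simp

lemma emeasure_unit_ball_lborel:
  "emeasure lborel (ball (0::'a::euclidean_space) 1) = ennreal (unit_ball_vol (real DIM('a)))"
  by (subst emeasure_ball) auto

lemma linear_borel_measurable:
  fixes f :: "'a::euclidean_space \<Rightarrow> 'b::euclidean_space"
  assumes "linear f"
  shows "f \<in> borel_measurable borel"
  by (intro borel_measurable_continuous_onI linear_continuous_on linear_linear[THEN iffD1] assms)
    (use assms linear_conv_bounded_linear in blast)

text \<open>Uniqueness of Haar measure in disguise: integrating \<open>g (\<Phi> x) * B (y - \<Phi> x)\<close> over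
  \<open>x\<close> and \<open>y\<close> in either order, with \<open>B\<close> the indicator of the unit ball, shows that
  the two integrals are proportional, and the two unit balls have the same volume.\<close>

lemma nn_integral_lborel_isometry:
  fixes \<Phi> :: "'a::euclidean_space \<Rightarrow> 'b::euclidean_space"
  assumes lin: "linear \<Phi>" and nrm: "\<And>x. norm (\<Phi> x) = norm x" and surj: "surj \<Phi>"
    and dim: "DIM('a) = DIM('b)"
    and g[measurable]: "g \<in> borel_measurable borel"
  shows "(\<integral>\<^sup>+x. g (\<Phi> x) \<partial>lborel) = (\<integral>\<^sup>+y. g y \<partial>lborel)"
proof -
  have [measurable]: "\<Phi> \<in> borel_measurable borel"
    using lin by (rule linear_borel_measurable)
  define B :: "'b \<Rightarrow> ennreal" where "B = indicator (ball 0 1)"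
  have [measurable]: "B \<in> borel_measurable borel" by (simp add: B_def)
  have \<Phi>_diff: "\<Phi> (x - y) = \<Phi> x - \<Phi> y" for x y
    using lin by (rule linear_diff)
  have B1: "(\<integral>\<^sup>+y. B y \<partial>lborel) = ennreal (unit_ball_vol (real DIM('b)))"
    by (simp add: B_def emeasure_unit_ball_lborel)
  have "B (\<Phi> x) = indicator (ball 0 1) x" for x
    by (simp add: B_def nrm indicator_def)
  then have B2: "(\<integral>\<^sup>+x. B (\<Phi> x) \<partial>lborel) = ennreal (unit_ball_vol (real DIM('b)))"
    by (simp add: emeasure_unit_ball_lborel dim)
  have "(\<integral>\<^sup>+x. g (\<Phi> x) \<partial>lborel) * (\<integral>\<^sup>+y. B y \<partial>lborel)
      = (\<integral>\<^sup>+x. g (\<Phi> x) * (\<integral>\<^sup>+y. B y \<partial>lborel) \<partial>lborel)"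
    by (simp add: nn_integral_multc)
  also have "\<dots> = (\<integral>\<^sup>+x. g (\<Phi> x) * (\<integral>\<^sup>+y. B (y - \<Phi> x) \<partial>lborel) \<partial>lborel)"
    by (simp add: nn_integral_lborel_translate)
  also have "\<dots> = (\<integral>\<^sup>+x. \<integral>\<^sup>+y. g (\<Phi> x) * B (y - \<Phi> x) \<partial>lborel \<partial>lborel)"
    by (simp add: nn_integral_cmult)
  also have "\<dots> = (\<integral>\<^sup>+y. \<integral>\<^sup>+x. g (\<Phi> x) * B (y - \<Phi> x) \<partial>lborel \<partial>lborel)"
    by (rule lborel_pair.Fubini'[symmetric]) measurable
  also have "\<dots> = (\<integral>\<^sup>+y. \<integral>\<^sup>+x. g (y - \<Phi> x) * B (\<Phi> x) \<partial>lborel \<partial>lborel)"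
  proof (rule nn_integral_cong)
    fix y :: 'b
    \<comment> \<open>As \<Phi> is onto, \<open>y\<close> is some \<open>\<Phi> t\<close>, and the
      substitution \<open>x -> t - x\<close> exchanges the arguments of \<open>g\<close> and
      \<open>B\<close>.\<close>
    obtain t where t: "\<Phi> t = y" using surj by (metis surjD)
    show "(\<integral>\<^sup>+x. g (\<Phi> x) * B (y - \<Phi> x) \<partial>lborel) = (\<integral>\<^sup>+x. g (y - \<Phi> x) * B (\<Phi> x) \<partial>lborel)"
      by (subst nn_integral_lborel_affine[where c="-1" and t=t]) (auto simp: \<Phi>_diff t)
  qed
  also have "\<dots> = (\<integral>\<^sup>+x. \<integral>\<^sup>+y. g (y - \<Phi> x) * B (\<Phi> x) \<partial>lborel \<partial>lborel)"
    by (rule lborel_pair.Fubini') measurable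
  also have "\<dots> = (\<integral>\<^sup>+x. (\<integral>\<^sup>+y. g (y - \<Phi> x) \<partial>lborel) * B (\<Phi> x) \<partial>lborel)"
    by (simp add: nn_integral_multc)
  also have "\<dots> = (\<integral>\<^sup>+x. (\<integral>\<^sup>+y. g y \<partial>lborel) * B (\<Phi> x) \<partial>lborel)"
    by (simp add: nn_integral_lborel_translate)
  also have "\<dots> = (\<integral>\<^sup>+y. g y \<partial>lborel) * (\<integral>\<^sup>+x. B (\<Phi> x) \<partial>lborel)"
    by (simp add: nn_integral_cmult)
  finally have "(\<integral>\<^sup>+x. g (\<Phi> x) \<partial>lborel) * ennreal (unit_ball_vol (real DIM('b))) =
      (\<integral>\<^sup>+y. g y \<partial>lborel) * ennreal (unit_ball_vol (real DIM('b)))"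
    unfolding B1 B2 .
  then show ?thesis
    using mult_divide_eq_ennreal[of "ennreal (unit_ball_vol (real DIM('b)))"]
    by (metis ennreal_eq_0_iff ennreal_neq_top not_le unit_ball_vol_pos of_nat_0_le_iff)
qed

section \<open>The sphere measure as a radial image of Lebesgue measure\<close>

lemma space_sphere_measure: "space (sphere_measure :: 'a::euclidean_space measure) = sphere 0 1"
  by (simp add: sphere_measure_def space_restrict_space)

lemma borel_measurable_sphere_measure:
  assumes "f \<in> borel_measurable borel"
  shows "f \<in> borel_measurable sphere_measure"
  unfolding sphere_measure_def
  by (intro measurable_completion measurable_restrict_space1) (use assms in simp)

lemma AE_lborel_nonzero: "AE y in lborel. y \<noteq> (0::'a::euclidean_space)"
  by (rule AE_lborel_singleton)

lemma nn_integral_sphere_measure: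
  fixes f :: "'a::euclidean_space \<Rightarrow> ennreal"
  assumes [measurable]: "f \<in> borel_measurable borel"
  shows "(\<integral>\<^sup>+\<omega>. f \<omega> \<partial>sphere_measure) =
    (\<integral>\<^sup>+y. f (y /\<^sub>R norm y) * indicator (ball 0 1) y \<partial>lborel) / ennreal (unit_ball_vol (real DIM('a)))"
proof -
  let ?D = "distr (uniform_measure lborel (ball (0::'a) 1)) borel (\<lambda>x. x /\<^sub>R norm x)"
  have "(\<integral>\<^sup>+\<omega>. f \<omega> \<partial>sphere_measure) = (\<integral>\<^sup>+\<omega>. f \<omega> * indicator (sphere 0 1) \<omega> \<partial>?D)"
    unfolding sphere_measure_def nn_integral_completion
    by (subst nn_integral_restrict_space) auto
  also have "\<dots> = (\<integral>\<^sup>+y. f (y /\<^sub>R norm y) * indicator (sphere 0 1) (y /\<^sub>R norm y)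
      \<partial>uniform_measure lborel (ball (0::'a) 1))"
    by (subst nn_integral_distr) (unfold measurable_cong_sets[OF sets_uniform_measure refl], measurable)
  also have "\<dots> = (\<integral>\<^sup>+y. f (y /\<^sub>R norm y) * indicator (sphere 0 1) (y /\<^sub>R norm y)
      * indicator (ball 0 1) y \<partial>lborel) / emeasure lborel (ball (0::'a) 1)"
    by (subst nn_integral_uniform_measure) auto
  also have "(\<integral>\<^sup>+y. f (y /\<^sub>R norm y) * indicator (sphere 0 1) (y /\<^sub>R norm y)
      * indicator (ball 0 1) y \<partial>lborel) = (\<integral>\<^sup>+y. f (y /\<^sub>R norm y) * indicator (ball 0 1) y \<partial>lborel)"
    by (intro nn_integral_cong_AE) (use AE_lborel_nonzero in eventually_elim, auto)
  finally show ?thesis by (simp add: emeasure_unit_ball_lborel)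
qed

lemma AE_sphere_measure:
  assumes "AE y in lborel. P (y /\<^sub>R norm y)" and [measurable]: "Measurable.pred borel P"
  shows "AE \<omega> in sphere_measure. P (\<omega>::'a::euclidean_space)"
proof -
  have "{\<omega>. \<not> P \<omega>} \<in> sets borel" by measurable
  moreover have "(\<integral>\<^sup>+\<omega>. indicator {\<omega>. \<not> P \<omega>} \<omega> \<partial>(sphere_measure :: 'a measure)) = 0"
  proof (subst nn_integral_sphere_measure)
    have "(\<integral>\<^sup>+y. indicator {\<omega>. \<not> P \<omega>} (y /\<^sub>R norm y) * indicator (ball 0 1) y \<partial>lborel)
        = (\<integral>\<^sup>+y. 0 \<partial>(lborel :: 'a measure))"
      by (rule nn_integral_cong_AE) (use assms(1) in eventually_elim, simp)
    then show "(\<integral>\<^sup>+y. indicator {\<omega>. \<not> P \<omega>} (y /\<^sub>R norm y) * indicator (ball 0 1) y \<partial>lborel)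
      / ennreal (unit_ball_vol (real DIM('a))) = 0" by simp
  qed measurable
  moreover have "(\<lambda>\<omega>. indicator {\<omega>. \<not> P \<omega>} \<omega> :: ennreal) \<in> borel_measurable sphere_measure"
    by (intro borel_measurable_sphere_measure) measurable
  ultimately have "AE \<omega> in sphere_measure. (indicator {\<omega>. \<not> P \<omega>} \<omega> :: ennreal) = 0"
    by (subst (asm) nn_integral_0_iff_AE) auto
  then show ?thesis by eventually_elim (auto simp: indicator_def split: if_splits)
qed

lemma emeasure_space_sphere_measure:
  "emeasure (sphere_measure :: 'a::euclidean_space measure) (space sphere_measure) = 1"
  using emeasure_sphere_measure_sphere[where 'a='a] by (simp add: space_sphere_measure)

lemma finite_measure_sphere_measure: "finite_measure (sphere_measure :: 'a::euclidean_space measure)"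
  by (rule finite_measureI) (simp add: emeasure_space_sphere_measure)

lemma nn_integral_sphere_isometry:
  fixes \<Phi> :: "'a::euclidean_space \<Rightarrow> 'b::euclidean_space"
  assumes lin: "linear \<Phi>" and nrm: "\<And>x. norm (\<Phi> x) = norm x" and surj: "surj \<Phi>"
    and dim: "DIM('a) = DIM('b)"
    and g[measurable]: "g \<in> borel_measurable borel"
  shows "(\<integral>\<^sup>+\<omega>. g (\<Phi> \<omega>) \<partial>sphere_measure) = (\<integral>\<^sup>+\<omega>. g \<omega> \<partial>sphere_measure)"
proof -
  have [measurable]: "\<Phi> \<in> borel_measurable borel"
    using lin by (rule linear_borel_measurable)
  have "(\<integral>\<^sup>+y. g (\<Phi> (y /\<^sub>R norm y)) * indicator (ball 0 1) y \<partial>lborel)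
      = (\<integral>\<^sup>+y. g (\<Phi> y /\<^sub>R norm (\<Phi> y)) * indicator (ball 0 1) (\<Phi> y) \<partial>lborel)"
    using lin by (intro nn_integral_cong) (auto simp: nrm linear_scale indicator_def)
  also have "\<dots> = (\<integral>\<^sup>+y. g (y /\<^sub>R norm y) * indicator (ball 0 1) y \<partial>lborel)"
    by (rule nn_integral_lborel_isometry[OF lin nrm surj dim, of "\<lambda>y. g (y /\<^sub>R norm y) * indicator (ball 0 1) y"]) measurable
  finally show ?thesis
    by (simp add: nn_integral_sphere_measure dim)
qed

lemma nn_integral_powr_from_0:
  fixes a u :: real
  assumes "a > 0" "u \<ge> 0"
  shows "(\<integral>\<^sup>+t. ennreal (a * t powr (a - 1)) * indicator {0<..<u} t \<partial>lborel) = ennreal (u powr a)"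
proof -
  have "((\<lambda>t. a * t powr (a - 1)) has_integral (a * (u powr (a - 1 + 1) / (a - 1 + 1)))) {0..u}"
    using assms by (intro has_integral_mult_right has_integral_powr_from_0) auto
  then have "((\<lambda>t. a * t powr (a - 1)) has_integral (u powr a)) {0..u}"
    using assms by simp
  then have "((\<lambda>t. a * t powr (a - 1)) has_integral (u powr a)) {0<..<u}"
    by (subst has_integral_open_interval[where 'a=real, simplified]) 
  from nn_integral_has_integral_lebesgue'[OF _ this] show ?thesis
    using assms by auto
qed

text \<open>The weighted measure is pushed to the half-line by \<open>norm y powr k\<close>. The set
  \<open>{..<u}\<close> pulls back to a ball of radius \<open>u powr (1 / k)\<close>, whose weighted
  mass scales like \<open>u powr d\<close>, and these masses determine the image measure because
  \<open>fin\<close> makes them finite. The exponent \<open>k\<close> is free so that Gaussians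
  (\<open>k = 2\<close>) and the light-cone integral (\<open>k = 1\<close>) both turn into Gamma
  integrals in \<open>u\<close>.\<close>

lemma nn_integral_polar:
  fixes f :: "'a::euclidean_space \<Rightarrow> ennreal" and g :: "real \<Rightarrow> ennreal"
  assumes f[measurable]: "f \<in> borel_measurable borel" and g[measurable]: "g \<in> borel_measurable borel"
    and k: "k > 0" and fin: "(\<integral>\<^sup>+\<omega>. f \<omega> \<partial>sphere_measure) < \<infinity>"
  defines "d \<equiv> real DIM('a) / k"
  shows "(\<integral>\<^sup>+y. f (y /\<^sub>R norm y) * g (norm y powr k) \<partial>lborel) =
    ennreal (unit_ball_vol (real DIM('a))) * (\<integral>\<^sup>+\<omega>. f \<omega> \<partial>sphere_measure)
     * (\<integral>\<^sup>+u. g u * ennreal (d * u powr (d - 1)) * indicator {0<..} u \<partial>lborel)"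
proof -
  have d: "d > 0" using k by (simp add: d_def)
  define V where "V = unit_ball_vol (real DIM('a))"
  have V: "V > 0" by (simp add: V_def)
  define c where "c = (\<integral>\<^sup>+y. f (y /\<^sub>R norm y) * indicator (ball 0 1) y \<partial>lborel)"
  have cI: "c = ennreal V * (\<integral>\<^sup>+\<omega>. f \<omega> \<partial>sphere_measure)"
    unfolding nn_integral_sphere_measure[OF f] c_def[symmetric] V_def[symmetric]
    using V by (simp add: ennreal_times_divide[symmetric] mult.commute[of "ennreal V"] ennreal_divide_times mult_divide_eq_ennreal)
  have cfin: "c < \<infinity>" unfolding cI using fin by (auto simp: ennreal_mult_less_top)
  have ball: "(\<integral>\<^sup>+y. f (y /\<^sub>R norm y) * indicator (ball 0 r) y \<partial>lborel) = ennreal (r ^ DIM('a)) * c"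
    if r: "r > 0" for r
  proof -
    have "(\<integral>\<^sup>+y. f (y /\<^sub>R norm y) * indicator (ball 0 r) y \<partial>lborel) = ennreal (r ^ DIM('a)) *
        (\<integral>\<^sup>+y. f ((r *\<^sub>R y) /\<^sub>R norm (r *\<^sub>R y)) * indicator (ball 0 r) (r *\<^sub>R y) \<partial>lborel)"
    proof (subst nn_integral_lborel_affine[where c=r and t=0])
      show "(\<lambda>y. f (y /\<^sub>R norm y) * indicator (ball 0 r) y) \<in> borel_measurable borel" by measurable
    qed (use r in auto)
    also have "(\<lambda>y::'a. f ((r *\<^sub>R y) /\<^sub>R norm (r *\<^sub>R y)) * indicator (ball 0 r) (r *\<^sub>R y)) =
        (\<lambda>y. f (y /\<^sub>R norm y) * indicator (ball 0 1) y)"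
      using r by (auto simp: indicator_def fun_eq_iff field_simps)
    finally show ?thesis by (simp add: c_def)
  qed
  define M where "M = distr (density lborel (\<lambda>y::'a. f (y /\<^sub>R norm y))) borel (\<lambda>y. norm y powr k)"
  define N where "N = density lborel (\<lambda>u. c * ennreal (d * u powr (d - 1)) * indicator {0<..} u)"
  have MN: "emeasure M {..<u} = (if u \<le> 0 then 0 else c * ennreal (u powr d))"
       "emeasure N {..<u} = (if u \<le> 0 then 0 else c * ennreal (u powr d))" for u
  proof -
    have "emeasure M {..<u} = (\<integral>\<^sup>+y. f (y /\<^sub>R norm y) * indicator ((\<lambda>y. norm y powr k) -` {..<u}) y \<partial>lborel)"
    proof -
      have "(\<lambda>y::'a. norm y powr k) \<in> borel_measurable borel" by measurable
      from measurable_sets[OF this, of "{..<u}"]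
      have "(\<lambda>y::'a. norm y powr k) -` {..<u} \<in> sets borel" by simp
      then show ?thesis
        unfolding M_def by (subst emeasure_distr) (auto simp: emeasure_density)
    qed
    also have "\<dots> = (if u \<le> 0 then 0 else c * ennreal (u powr d))"
    proof (cases "u \<le> 0")
      case True
      then have "\<not> norm y powr k < u" for y :: 'a
        using powr_ge_zero[of "norm y" k] by linarith
      then have "(\<lambda>y::'a. norm y powr k) -` {..<u} = {}" by auto
      then show ?thesis using True by simp
    next
      case False
      have "norm y powr k < u \<longleftrightarrow> norm y < u powr (1 / k)" for y :: 'a
      proof -
        have "norm y powr k < u \<longleftrightarrow> norm y powr k < (u powr (1/k)) powr k"
          using False k by (simp add: powr_powr)
        also have "\<dots> \<longleftrightarrow> norm y < u powr (1 / k)"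
          using k powr_less_mono2[of k "norm y" "u powr (1/k)"] powr_mono2[of k "u powr (1/k)" "norm y"]
          by (meson norm_ge_zero not_less powr_ge_zero less_imp_le)
        finally show ?thesis .
      qed
      then have "(\<lambda>y::'a. norm y powr k) -` {..<u} = ball 0 (u powr (1 / k))" by auto
      moreover have "(u powr (1 / k)) ^ DIM('a) = u powr d"
        using False by (simp add: d_def powr_powr powr_realpow[symmetric])
      ultimately show ?thesis using False ball[of "u powr (1/k)"] by (simp add: mult.commute)
    qed
    finally show "emeasure M {..<u} = (if u \<le> 0 then 0 else c * ennreal (u powr d))" .
    have "emeasure N {..<u} = (\<integral>\<^sup>+t. c * (ennreal (d * t powr (d - 1)) * indicator {0<..<u} t) \<partial>lborel)"
      unfolding N_def by (subst emeasure_density) (auto intro!: nn_integral_cong simp: indicator_def)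
    also have "\<dots> = (if u \<le> 0 then 0 else c * ennreal (u powr d))"
    proof (cases "u \<le> 0")
      case True
      then have "{0<..<u} = {}" by auto
      then show ?thesis using True by simp
    next
      case False
      then show ?thesis using nn_integral_powr_from_0[OF d, of u]
        by (subst nn_integral_cmult) auto
    qed
    finally show "emeasure N {..<u} = (if u \<le> 0 then 0 else c * ennreal (u powr d))" .
  qed
  have MNeq: "M = N"
  proof (rule measure_eqI_generator_eq[where E="range lessThan" and \<Omega>=UNIV and A="\<lambda>i. {..<real i}"])
    show "Int_stable (range (lessThan :: real \<Rightarrow> real set))"
    proof (clarsimp simp: Int_stable_def)
      fix a b :: real
      have "{..<a} \<inter> {..<b} = {..<min a b}" by auto
      then show "{..<a} \<inter> {..<b} \<in> range lessThan" by blast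
    qed
    show "sets M = sigma_sets UNIV (range lessThan)" "sets N = sigma_sets UNIV (range lessThan)"
      by (auto simp: M_def N_def borel_Iio)
    show "(\<Union>i. {..<real i}) = UNIV"
      by (auto intro: reals_Archimedean2)
    show "emeasure M {..<real i} \<noteq> \<infinity>" for i
      using cfin by (auto simp: MN ennreal_mult_eq_top_iff)
  qed (auto simp: MN)
  have "(\<integral>\<^sup>+y. f (y /\<^sub>R norm y) * g (norm y powr k) \<partial>lborel) = (\<integral>\<^sup>+u. g u \<partial>M)"
    unfolding M_def by (subst nn_integral_distr) (auto simp: nn_integral_density)
  also have "\<dots> = (\<integral>\<^sup>+u. c * ennreal (d * u powr (d - 1)) * indicator {0<..} u * g u \<partial>lborel)"
    unfolding MNeq N_def by (subst nn_integral_density) auto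
  also have "\<dots> = (\<integral>\<^sup>+u. c * (g u * ennreal (d * u powr (d - 1)) * indicator {0<..} u) \<partial>lborel)"
    by (intro nn_integral_cong) (simp add: ac_simps)
  also have "\<dots> = c * (\<integral>\<^sup>+u. g u * ennreal (d * u powr (d - 1)) * indicator {0<..} u \<partial>lborel)"
    by (subst nn_integral_cmult) auto
  finally show ?thesis unfolding cI V_def .
qed

subsection \<open>Reflections and moments of the sphere measure\<close>

lemma ennreal_eq_divide_if_mult_eq:
  assumes "ennreal a * x = ennreal b" "0 < a"
  shows "x = ennreal (b / a)"
proof (cases x)
  case (real r)
  then show ?thesis
    using assms by (cases "b \<ge> 0") (auto simp: ennreal_mult[symmetric] ennreal_neg field_simps)
next
  case top
  then show ?thesis using assms by (simp add: ennreal_mult_top ennreal_eq_0_iff)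
qed

text \<open>For \<open>v = 0\<close> this is the identity, so that
  \<open>hyperplane_reflection_swap\<close> also covers \<open>a = b\<close>.\<close>

definition hyperplane_reflection :: "'a::euclidean_space \<Rightarrow> 'a \<Rightarrow> 'a" where
  "hyperplane_reflection v y = y - (2 * (y \<bullet> v) / (v \<bullet> v)) *\<^sub>R v"

lemma linear_hyperplane_reflection: "linear (hyperplane_reflection v)"
  by (auto intro!: linearI simp: hyperplane_reflection_def inner_add_left algebra_simps add_divide_distrib)

lemma inner_hyperplane_reflection:
  "hyperplane_reflection v y \<bullet> hyperplane_reflection v z = y \<bullet> z"
proof (cases "v = 0")
  case False
  then have "v \<bullet> v \<noteq> 0" by simp
  then show ?thesis
    by (simp add: hyperplane_reflection_def inner_diff_left inner_diff_right inner_commute field_simps)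
qed (simp add: hyperplane_reflection_def)

lemma norm_hyperplane_reflection: "norm (hyperplane_reflection v y) = norm y"
  by (simp add: norm_eq_sqrt_inner inner_hyperplane_reflection)

lemma hyperplane_reflection_involution: "hyperplane_reflection v (hyperplane_reflection v y) = y"
proof (cases "v = 0")
  case False
  then have "v \<bullet> v \<noteq> 0" by simp
  then show ?thesis
    by (simp add: hyperplane_reflection_def inner_diff_left algebra_simps)
qed (simp add: hyperplane_reflection_def)

lemma hyperplane_reflection_adjoint:
  "hyperplane_reflection v y \<bullet> z = y \<bullet> hyperplane_reflection v z"
  by (metis inner_hyperplane_reflection hyperplane_reflection_involution)

text \<open>Equal norms make twice \<open>a \<bullet> (a - b)\<close> equal to the squared norm of
  \<open>a - b\<close>, so the mirror subtracts exactly \<open>a - b\<close>. These reflections do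
  the work of general rotations below.\<close>

lemma hyperplane_reflection_swap:
  assumes "norm a = norm b"
  shows "hyperplane_reflection (a - b) a = b" "hyperplane_reflection (a - b) b = a"
proof -
  have "a \<bullet> a = b \<bullet> b" using assms by (simp add: norm_eq_sqrt_inner)
  then have "2 * (a \<bullet> (a - b)) = (a - b) \<bullet> (a - b)"
    by (simp add: inner_diff_left inner_diff_right inner_commute)
  then show *: "hyperplane_reflection (a - b) a = b"
    by (cases "a = b") (auto simp: hyperplane_reflection_def)
  then show "hyperplane_reflection (a - b) b = a"
    by (metis hyperplane_reflection_involution)
qed

lemma hyperplane_reflection_orthogonal:
  "y \<bullet> v = 0 \<Longrightarrow> hyperplane_reflection v y = y"
  by (simp add: hyperplane_reflection_def)

lemma nn_integral_sphere_reflection: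
  assumes "g \<in> borel_measurable borel"
  shows "(\<integral>\<^sup>+\<omega>. g (hyperplane_reflection v \<omega>) \<partial>sphere_measure) = (\<integral>\<^sup>+\<omega>. g \<omega> \<partial>sphere_measure)"
  by (intro nn_integral_sphere_isometry linear_hyperplane_reflection norm_hyperplane_reflection assms refl)
    (rule surjI[of _ "hyperplane_reflection v"], rule hyperplane_reflection_involution)

section \<open>Gaussian integrals and spherical moments\<close>

lemma nn_integral_Gamma:
  fixes a :: real
  assumes "a > 0"
  shows "(\<integral>\<^sup>+u. ennreal (u powr (a - 1) * exp (- u)) * indicator {0<..} u \<partial>lborel) = ennreal (Gamma a)"
  unfolding Gamma_conv_nn_integral_real[OF assms]
  by (intro nn_integral_cong_AE) (use AE_lborel_singleton[of 0] in eventually_elim,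
      auto simp: indicator_def exp_minus divide_inverse)

lemma unit_ball_vol_times_half_dim:
  "n > 0 \<Longrightarrow> unit_ball_vol n * (n / 2) = pi powr (n / 2) / Gamma (n / 2)"
  using Gamma_plus1[of "n / 2"] Gamma_real_pos[of "n / 2"]
  by (simp add: unit_ball_vol_def field_simps nonpos_Ints_def)

text \<open>Homogeneity splits \<open>h y\<close> into \<open>norm y powr a\<close> and a value on
  the sphere, so polar coordinates in the squared norm leave a Gamma integral. The Gaussian is also
  a product over coordinates, and comparing the two evaluations gives spherical moments.\<close>

lemma nn_integral_gaussian_homogeneous:
  fixes h :: "'a::euclidean_space \<Rightarrow> real"
  assumes h[measurable]: "h \<in> borel_measurable borel" and nonneg: "\<And>y. 0 \<le> h y"
    and hom: "\<And>c y. c > 0 \<Longrightarrow> h (c *\<^sub>R y) = c powr a * h y"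
    and a: "a \<ge> 0" and fin: "(\<integral>\<^sup>+\<omega>. h \<omega> \<partial>sphere_measure) < \<infinity>"
  shows "(\<integral>\<^sup>+y. ennreal (h y * exp (- (norm y)\<^sup>2)) \<partial>lborel) =
    ennreal (pi powr (real DIM('a) / 2) * Gamma ((a + real DIM('a)) / 2) / Gamma (real DIM('a) / 2))
     * (\<integral>\<^sup>+\<omega>. h \<omega> \<partial>sphere_measure)"
proof -
  define n where "n = real DIM('a)"
  have n: "n > 0" by (simp add: n_def)
  define g where "g u = ennreal (u powr (a / 2) * exp (- u))" for u :: real
  have [measurable]: "g \<in> borel_measurable borel" unfolding g_def by measurable
  have "(\<integral>\<^sup>+y. ennreal (h y * exp (- (norm y)\<^sup>2)) \<partial>lborel) =
      (\<integral>\<^sup>+y. ennreal (h (y /\<^sub>R norm y)) * g (norm y powr 2) \<partial>lborel)"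
  proof (intro nn_integral_cong_AE, use AE_lborel_nonzero in eventually_elim)
    case (elim y)
    have "h y = norm y powr a * h (y /\<^sub>R norm y)"
      using hom[of "norm y" "y /\<^sub>R norm y"] elim by simp
    moreover have "(norm y powr 2) powr (a / 2) = norm y powr a" by (simp add: powr_powr del: powr_numeral)
    ultimately show ?case
      using elim nonneg by (simp add: g_def ennreal_mult[symmetric] mult_ac powr_realpow[symmetric] del: powr_numeral)
  qed
  also have "\<dots> = ennreal (unit_ball_vol n) * (\<integral>\<^sup>+\<omega>. h \<omega> \<partial>sphere_measure) *
      (\<integral>\<^sup>+u. g u * ennreal (n / 2 * u powr (n / 2 - 1)) * indicator {0<..} u \<partial>lborel)"
    unfolding n_def using fin by (intro nn_integral_polar) auto
  also have "(\<integral>\<^sup>+u. g u * ennreal (n / 2 * u powr (n / 2 - 1)) * indicator {0<..} u \<partial>lborel) =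
      (\<integral>\<^sup>+u. ennreal (n / 2) * (ennreal (u powr ((a + n) / 2 - 1) * exp (- u)) * indicator {0<..} u) \<partial>lborel)"
  proof (intro nn_integral_cong)
    fix u :: real
    have "u powr ((a + n) / 2 - 1) = u powr (a / 2) * u powr (n / 2 - 1)"
      by (simp add: powr_add[symmetric] add_divide_distrib algebra_simps)
    then show "g u * ennreal (n / 2 * u powr (n / 2 - 1)) * indicator {0<..} u =
      ennreal (n / 2) * (ennreal (u powr ((a + n) / 2 - 1) * exp (- u)) * indicator {0<..} u)"
      using n by (simp add: g_def ennreal_mult[symmetric] mult_ac indicator_def)
  qed
  also have "\<dots> = ennreal (n / 2) * ennreal (Gamma ((a + n) / 2))"
    using n a by (subst nn_integral_cmult) (auto simp: nn_integral_Gamma)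
  also have "ennreal (unit_ball_vol n) * (\<integral>\<^sup>+\<omega>. h \<omega> \<partial>sphere_measure) * (ennreal (n / 2) * ennreal (Gamma ((a + n) / 2)))
     = ennreal (unit_ball_vol n * (n / 2) * Gamma ((a + n) / 2)) * (\<integral>\<^sup>+\<omega>. h \<omega> \<partial>sphere_measure)"
  proof -
    have "ennreal (unit_ball_vol n * (n / 2) * Gamma ((a + n) / 2)) =
        ennreal (unit_ball_vol n) * ennreal (n / 2) * ennreal (Gamma ((a + n) / 2))"
      using n a Gamma_real_pos[of "(a + n) / 2"] by (subst ennreal_mult, simp, simp, subst ennreal_mult, auto)
    then show ?thesis by (simp only: mult_ac)
  qed
  also have "unit_ball_vol n * (n / 2) * Gamma ((a + n) / 2) =
     pi powr (n / 2) * Gamma ((a + n) / 2) / Gamma (n / 2)"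
    unfolding unit_ball_vol_times_half_dim[OF n] by simp
  finally show ?thesis unfolding n_def .
qed

lemma nn_integral_sphere_le:
  assumes "\<And>\<omega>. norm (\<omega>::'a::euclidean_space) = 1 \<Longrightarrow> f \<omega> \<le> c"
  shows "(\<integral>\<^sup>+\<omega>. f \<omega> \<partial>sphere_measure) \<le> c"
proof -
  have "(\<integral>\<^sup>+\<omega>. f \<omega> \<partial>sphere_measure) \<le> (\<integral>\<^sup>+\<omega>. c \<partial>(sphere_measure :: 'a measure))"
    using assms by (intro nn_integral_mono) (simp add: space_sphere_measure)
  then show ?thesis by (simp add: emeasure_space_sphere_measure)
qed

text \<open>The one-dimensional case of \<open>nn_integral_gaussian_homogeneous\<close>: the sphere
  is \<open>{- 1, 1}\<close> and its integral is 1.\<close>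

lemma nn_integral_gaussian_abs_powr:
  fixes a :: real
  assumes "a \<ge> 0"
  shows "(\<integral>\<^sup>+t. ennreal (\<bar>t\<bar> powr a * exp (- t\<^sup>2)) \<partial>lborel) = ennreal (Gamma ((a + 1) / 2))"
proof -
  have "(\<integral>\<^sup>+\<omega>. \<bar>\<omega>\<bar> powr a \<partial>(sphere_measure :: real measure)) = (\<integral>\<^sup>+\<omega>. 1 \<partial>(sphere_measure :: real measure))"
    by (intro nn_integral_cong) (auto simp: space_sphere_measure)
  then have 1: "(\<integral>\<^sup>+\<omega>. \<bar>\<omega>\<bar> powr a \<partial>(sphere_measure :: real measure)) = 1"
    by (simp add: emeasure_space_sphere_measure)
  have "(\<integral>\<^sup>+t. ennreal (\<bar>t\<bar> powr a * exp (- (norm t)\<^sup>2)) \<partial>lborel) =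
    ennreal (pi powr (real DIM(real) / 2) * Gamma ((a + real DIM(real)) / 2) / Gamma (real DIM(real) / 2))
     * (\<integral>\<^sup>+\<omega>. \<bar>\<omega>\<bar> powr a \<partial>(sphere_measure :: real measure))"
    using assms 1 by (intro nn_integral_gaussian_homogeneous) (auto simp: abs_mult powr_mult)
  then show ?thesis
    unfolding 1 by (simp add: Gamma_one_half_real powr_half_sqrt)
qed

text \<open>A Gaussian integral is evaluated twice: radially, as a Gamma factor times the wanted
  moment, and as a product of one-dimensional integrals.\<close>

lemma nn_integral_sphere_moment_Basis:
  fixes b1 b2 :: "'a::euclidean_space"
  assumes b: "b1 \<in> Basis" "b2 \<in> Basis" "b1 \<noteq> b2" and q: "q > 0"
  shows "(\<integral>\<^sup>+\<omega>. ennreal ((\<omega> \<bullet> b1) ^ (2 * j) * \<bar>\<omega> \<bullet> b2\<bar> powr q) \<partial>sphere_measure) =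
    ennreal (Gamma (real DIM('a) / 2) * Gamma (real j + 1 / 2) * Gamma ((q + 1) / 2) /
      (pi * Gamma ((q + real DIM('a)) / 2 + real j)))"
proof -
  define n where "n = real DIM('a)"
  have n: "n > 0" by (simp add: n_def)
  define I where "I = (\<integral>\<^sup>+\<omega>. ennreal ((\<omega> \<bullet> b1) ^ (2 * j) * \<bar>\<omega> \<bullet> b2\<bar> powr q) \<partial>(sphere_measure :: 'a measure))"
  have nonneg: "0 \<le> (y \<bullet> b1) ^ (2 * j) * \<bar>y \<bullet> b2\<bar> powr q" for y
    by simp
  have "I \<le> 1" unfolding I_def
  proof (rule nn_integral_sphere_le)
    fix \<omega> :: 'a assume "norm \<omega> = 1"
    then have "\<bar>\<omega> \<bullet> b1\<bar> \<le> 1" "\<bar>\<omega> \<bullet> b2\<bar> \<le> 1"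
      using b Basis_le_norm by metis+
    then have "\<bar>\<omega> \<bullet> b1\<bar> ^ (2 * j) \<le> 1" "\<bar>\<omega> \<bullet> b2\<bar> powr q \<le> 1"
      using q by (auto intro: power_le_one powr_le1)
    then show "ennreal ((\<omega> \<bullet> b1) ^ (2 * j) * \<bar>\<omega> \<bullet> b2\<bar> powr q) \<le> 1"
      by (auto simp: power_even_abs intro!: mult_le_one)
  qed
  then have I: "I < \<infinity>" by (auto intro: le_less_trans)
  have "(\<integral>\<^sup>+y. ennreal ((y \<bullet> b1) ^ (2 * j) * \<bar>y \<bullet> b2\<bar> powr q * exp (- (norm y)\<^sup>2)) \<partial>lborel) =
    ennreal (pi powr (n / 2) * Gamma (((2 * real j + q) + n) / 2) / Gamma (n / 2)) * I"
    unfolding I_def n_def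
  proof (rule nn_integral_gaussian_homogeneous)
    fix c :: real and y :: 'a assume c: "c > 0"
    have "c powr (2 * real j + q) = c ^ (2 * j) * c powr q"
      using c powr_realpow[of c "2 * j"] by (simp add: powr_add)
    then show "(c *\<^sub>R y \<bullet> b1) ^ (2 * j) * \<bar>c *\<^sub>R y \<bullet> b2\<bar> powr q =
        c powr (2 * real j + q) * ((y \<bullet> b1) ^ (2 * j) * \<bar>y \<bullet> b2\<bar> powr q)"
      using c by (simp add: power_mult_distrib abs_mult powr_mult)
  qed (use q I in \<open>auto simp: I_def\<close>)
  moreover define F where "F b t = (if b = b1 then t ^ (2 * j) * exp (- t\<^sup>2)
      else if b = b2 then \<bar>t\<bar> powr q * exp (- t\<^sup>2) else exp (- t\<^sup>2))" for b :: 'a and t :: real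
  have prod2: "(\<Prod>b\<in>Basis. G b) = G b1 * (G b2 * (\<Prod>b\<in>Basis - {b1} - {b2}. G b))" for G :: "'a \<Rightarrow> 'c::comm_monoid_mult"
    using b prod.remove[of Basis b1 G] prod.remove[of "Basis - {b1}" b2 G] by simp
  have "(y \<bullet> b1) ^ (2 * j) * \<bar>y \<bullet> b2\<bar> powr q * exp (- (norm y)\<^sup>2) = (\<Prod>b\<in>Basis. F b (y \<bullet> b))" for y
  proof -
    have "(norm y)\<^sup>2 = (\<Sum>b\<in>Basis. (y \<bullet> b)\<^sup>2)"
      by (subst power2_norm_eq_inner, subst euclidean_inner) (simp add: power2_eq_square)
    then have "exp (- (norm y)\<^sup>2) = (\<Prod>b\<in>Basis. exp (- (y \<bullet> b)\<^sup>2))"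
      by (simp add: sum_negf[symmetric] exp_sum)
    then show ?thesis
      using b by (simp add: prod2 F_def)
  qed
  then have "(\<integral>\<^sup>+y. ennreal ((y \<bullet> b1) ^ (2 * j) * \<bar>y \<bullet> b2\<bar> powr q * exp (- (norm y)\<^sup>2)) \<partial>lborel) =
      (\<integral>\<^sup>+y. (\<Prod>b\<in>Basis. ennreal (F b (y \<bullet> b))) \<partial>(lborel::'a measure))"
    by (simp add: prod_ennreal F_def)
  also have "\<dots> = (\<Prod>b\<in>(Basis::'a set). \<integral>\<^sup>+t. ennreal (F b t) \<partial>lborel)"
    by (rule nn_integral_lborel_prod[where f="\<lambda>b t. ennreal (F b t)"]) (auto simp: F_def)
  also have "\<dots> = ennreal (Gamma (real j + 1 / 2)) * (ennreal (Gamma ((q + 1) / 2)) *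
      (\<Prod>b\<in>(Basis::'a set) - {b1} - {b2}. ennreal (sqrt pi)))"
    unfolding prod2
  proof (intro arg_cong2[where f="(*)"] prod.cong refl)
    have "(\<integral>\<^sup>+t. ennreal (F b1 t) \<partial>lborel) = (\<integral>\<^sup>+t. ennreal (\<bar>t\<bar> powr (2 * real j) * exp (- t\<^sup>2)) \<partial>lborel)"
    \<comment> \<open>The point 0 is left out because for \<open>j = 0\<close> the power
      \<open>0 ^ 0\<close> is 1 while \<open>0 powr 0\<close> is 0.\<close>
    proof (intro nn_integral_cong_AE, use AE_lborel_singleton[of 0] in eventually_elim)
      case (elim t)
      then show ?case using powr_realpow[of "\<bar>t\<bar>" "2 * j"] by (simp add: F_def power_even_abs)
    qed
    then show "(\<integral>\<^sup>+t. ennreal (F b1 t) \<partial>lborel) = ennreal (Gamma (real j + 1 / 2))"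
      by (simp add: nn_integral_gaussian_abs_powr add_divide_distrib)
    show "(\<integral>\<^sup>+t. ennreal (F b2 t) \<partial>lborel) = ennreal (Gamma ((q + 1) / 2))"
      using b q by (simp add: F_def nn_integral_gaussian_abs_powr)
    fix c assume c: "c \<in> (Basis::'a set) - {b1} - {b2}"
    have "(\<integral>\<^sup>+t. ennreal (F c t) \<partial>lborel) = (\<integral>\<^sup>+t. ennreal (\<bar>t\<bar> powr 0 * exp (- t\<^sup>2)) \<partial>lborel)"
      using c by (intro nn_integral_cong_AE, use AE_lborel_singleton[of 0] in eventually_elim) (auto simp: F_def)
    then show "(\<integral>\<^sup>+t. ennreal (F c t) \<partial>lborel) = ennreal (sqrt pi)"
      by (subst (asm) nn_integral_gaussian_abs_powr) (auto simp: Gamma_one_half_real)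
  qed
  also have "(\<Prod>b\<in>(Basis::'a set) - {b1} - {b2}. ennreal (sqrt pi)) = ennreal (pi powr (n / 2) / pi)"
  proof -
    \<comment> \<open>Every other coordinate contributes \<open>sqrt pi\<close>; the two distinct
      basis vectors show that the truncated difference \<open>DIM('a) - 2\<close> is a true
      one.\<close>
    have card: "card (Basis - {b1} - {b2}) = DIM('a) - 2" using b by simp
    have "card {b1, b2} \<le> DIM('a)" by (rule card_mono) (use b in auto)
    then have 2: "2 \<le> DIM('a)" using b by simp
    have "sqrt pi ^ (DIM('a) - 2) * pi = sqrt pi ^ (DIM('a) - 2) * sqrt pi ^ 2" by simp
    also have "\<dots> = sqrt pi ^ DIM('a)" using 2 by (metis le_add_diff_inverse2 power_add)
    also have "\<dots> = pi powr (n / 2)"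
      by (simp add: n_def powr_half_sqrt[symmetric] powr_power)
    finally have "sqrt pi ^ (DIM('a) - 2) = pi powr (n / 2) / pi" by (simp add: field_simps)
    then show ?thesis by (simp add: card ennreal_power)
  qed
  ultimately have "ennreal (pi powr (n / 2) * Gamma (((2 * real j + q) + n) / 2) / Gamma (n / 2)) * I =
      ennreal (Gamma (real j + 1 / 2)) * (ennreal (Gamma ((q + 1) / 2)) * ennreal (pi powr (n / 2) / pi))"
    by simp
  also have "((2 * real j + q) + n) / 2 = (q + n) / 2 + real j" by (simp add: field_simps)
  also have "ennreal (Gamma (real j + 1 / 2)) * (ennreal (Gamma ((q + 1) / 2)) * ennreal (pi powr (n / 2) / pi))
      = ennreal (Gamma (real j + 1 / 2) * Gamma ((q + 1) / 2) * (pi powr (n / 2) / pi))"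
    using q by (simp add: ennreal_mult[symmetric] less_imp_le Gamma_real_pos mult_ac)
  finally have "I = ennreal (Gamma (real j + 1 / 2) * Gamma ((q + 1) / 2) * (pi powr (n / 2) / pi) /
      (pi powr (n / 2) * Gamma ((q + n) / 2 + real j) / Gamma (n / 2)))"
    using q n by (intro ennreal_eq_divide_if_mult_eq) (auto intro!: divide_pos_pos mult_pos_pos Gamma_real_pos add_pos_nonneg)
  also have "Gamma (real j + 1 / 2) * Gamma ((q + 1) / 2) * (pi powr (n / 2) / pi) /
      (pi powr (n / 2) * Gamma ((q + n) / 2 + real j) / Gamma (n / 2)) =
      Gamma (n / 2) * Gamma (real j + 1 / 2) * Gamma ((q + 1) / 2) / (pi * Gamma ((q + n) / 2 + real j))"
    by simp
  finally show ?thesis unfolding I_def n_def .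
qed

text \<open>One reflection moves \<open>e\<close> to a basis vector \<open>b1\<close>, a second
  moves the image of \<open>l\<close> to another one. The normal of the second mirror is orthogonal
  to \<open>b1\<close>, so \<open>b1\<close> stays in place.\<close>

lemma nn_integral_sphere_moment:
  fixes e l :: "'a::euclidean_space"
  assumes e: "norm e = 1" and l: "norm l = 1" and el: "e \<bullet> l = 0" and q: "q > 0"
  shows "(\<integral>\<^sup>+\<omega>. ennreal ((\<omega> \<bullet> e) ^ (2 * j) * \<bar>\<omega> \<bullet> l\<bar> powr q) \<partial>sphere_measure) =
    ennreal (Gamma (real DIM('a) / 2) * Gamma (real j + 1 / 2) * Gamma ((q + 1) / 2) /
      (pi * Gamma ((q + real DIM('a)) / 2 + real j)))"
proof -
  have "independent {e, l}" 
    using e l el by (intro pairwise_orthogonal_independent) (auto simp: pairwise_def orthogonal_def inner_commute)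
  moreover have "e \<noteq> l" using e el by (auto simp: norm_eq_sqrt_inner)
  ultimately have "2 \<le> DIM('a)"
    using independent_bound[of "{e, l}"] by simp
  then obtain b1 b2 :: 'a where b: "b1 \<in> Basis" "b2 \<in> Basis" "b1 \<noteq> b2"
    using card_le_Suc0_iff_eq[of "Basis :: 'a set"] by (metis finite_Basis not_less_eq_eq numeral_2_eq_2)
  define R where "R = hyperplane_reflection (e - b1)"
  define S where "S = hyperplane_reflection (R l - b2)"
  have nb: "norm b1 = 1" "norm b2 = 1" "b1 \<bullet> b2 = 0" using b by (auto simp: inner_Basis)
  have Re: "R e = b1" unfolding R_def by (rule hyperplane_reflection_swap) (simp add: e nb)
  have "R l \<bullet> b1 = 0" unfolding Re[symmetric] by (simp add: R_def inner_hyperplane_reflection el inner_commute)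
  then have Sb1: "S b1 = b1"
    unfolding S_def using nb by (intro hyperplane_reflection_orthogonal) (simp add: inner_diff_right inner_commute)
  have Sl: "S (R l) = b2"
    unfolding S_def by (rule hyperplane_reflection_swap) (simp add: R_def norm_hyperplane_reflection l nb)
  define g where "g u v \<omega> = ennreal ((\<omega> \<bullet> u) ^ (2 * j) * \<bar>\<omega> \<bullet> v\<bar> powr q)" for u v \<omega> :: 'a
  have [measurable]: "g u v \<in> borel_measurable borel" for u v unfolding g_def by measurable
  have "(\<integral>\<^sup>+\<omega>. g e l \<omega> \<partial>sphere_measure) = (\<integral>\<^sup>+\<omega>. g e l (R \<omega>) \<partial>sphere_measure)"
    unfolding R_def by (rule nn_integral_sphere_reflection[symmetric]) measurable
  also have "(\<lambda>\<omega>. g e l (R \<omega>)) = g b1 (R l)"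
    unfolding g_def Re[symmetric] unfolding R_def hyperplane_reflection_adjoint ..
  also have "(\<integral>\<^sup>+\<omega>. g b1 (R l) \<omega> \<partial>sphere_measure) = (\<integral>\<^sup>+\<omega>. g b1 (R l) (S \<omega>) \<partial>sphere_measure)"
    unfolding S_def by (rule nn_integral_sphere_reflection[symmetric]) measurable
  also have "(\<lambda>\<omega>. g b1 (R l) (S \<omega>)) = g b1 b2"
    using Sb1 Sl unfolding g_def S_def hyperplane_reflection_adjoint by simp
  also have "(\<integral>\<^sup>+\<omega>. g b1 b2 \<omega> \<partial>sphere_measure) = ennreal (Gamma (real DIM('a) / 2) * Gamma (real j + 1 / 2) * Gamma ((q + 1) / 2) /
      (pi * Gamma ((q + real DIM('a)) / 2 + real j)))"
    unfolding g_def using b q by (rule nn_integral_sphere_moment_Basis)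
  finally show ?thesis unfolding g_def .
qed

subsection \<open>Stereographic projection\<close>

text \<open>With \<open>t = r sinh a\<close> the new variable is \<open>u = r exp (- a)\<close>,
  that is \<open>sqrt (t^2 + r^2) - t\<close>: the coordinate \<open>norm y - t\<close> of a point
  \<open>y = (v, t)\<close> with \<open>norm v = r\<close>. The map from \<open>u\<close> to
  \<open>t\<close> is a decreasing bijection, so it suffices to compare masses of intervals.\<close>

lemma nn_integral_hyperbolic_substitution:
  fixes F :: "real \<Rightarrow> ennreal" and r :: real
  assumes F[measurable]: "F \<in> borel_measurable borel" and r: "r > 0"
  shows "(\<integral>\<^sup>+t. F t \<partial>lborel) =
    (\<integral>\<^sup>+u. F ((r\<^sup>2 / u - u) / 2) * ennreal ((r\<^sup>2 / u\<^sup>2 + 1) / 2) * indicator {0<..} u \<partial>lborel)"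
proof -
  define g where "g u = (r\<^sup>2 / u - u) / 2" for u
  define g' where "g' u = (r\<^sup>2 / u\<^sup>2 + 1) / 2" for u
  define h where "h t = sqrt (t\<^sup>2 + r\<^sup>2) - t" for t
  have [measurable]: "g \<in> borel_measurable borel" "g' \<in> borel_measurable borel"
    unfolding g_def g'_def by measurable
  have h_pos: "h t > 0" for t
  proof -
    have "\<bar>t\<bar> < sqrt (t\<^sup>2 + r\<^sup>2)" using r by (intro real_less_rsqrt) auto
    then show ?thesis by (simp add: h_def)
  qed
  have g_h: "g (h t) = t" for t
  proof -
    have "(h t)\<^sup>2 + 2 * t * h t = (h t + t)\<^sup>2 - t\<^sup>2" by (simp add: power2_eq_square algebra_simps)
    also have "\<dots> = r\<^sup>2" by (simp add: h_def)
    finally have "(h t)\<^sup>2 + 2 * t * h t = r\<^sup>2" .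
    moreover have "g (h t) * (2 * h t) = r\<^sup>2 - (h t)\<^sup>2"
      using h_pos[of t] by (simp add: g_def power2_eq_square field_simps)
    ultimately have "h t * g (h t) = h t * t" by algebra
    then show ?thesis using h_pos[of t] by simp
  qed
  have g_mono: "g v < g u" if "0 < u" "u < v" for u v
  proof -
    have "r\<^sup>2 / v \<le> r\<^sup>2 / u" using that r by (intro divide_left_mono) auto
    then show ?thesis unfolding g_def using that by (intro divide_strict_right_mono) auto
  qed
  have g_less: "g u < g v \<longleftrightarrow> v < u" if "0 < u" "0 < v" for u v
    using g_mono[of u v] g_mono[of v u] that by (cases u v rule: linorder_cases) auto
  define M where "M = distr (density lborel (\<lambda>u. ennreal (g' u) * indicator {0<..} u)) borel g"
  have "lborel = M"
  proof (rule lborel_eqI)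
    fix l u :: real
    assume "\<And>b. b \<in> Basis \<Longrightarrow> l \<bullet> b \<le> u \<bullet> b"
    then have lu: "l \<le> u" by simp
    have hul: "h u \<le> h l"
      using g_less[of "h l" "h u"] lu h_pos by (auto simp: g_h)
    have "emeasure M {l<..<u} = (\<integral>\<^sup>+x. ennreal (g' x) * indicator {0<..} x * indicator (g -` {l<..<u}) x \<partial>lborel)"
    proof -
      have "g \<in> borel_measurable borel" by measurable
      from measurable_sets[OF this, of "{l<..<u}"] have "g -` {l<..<u} \<in> sets borel" by simp
      then show ?thesis
        unfolding M_def by (subst emeasure_distr) (auto simp: emeasure_density)
    qed
    also have "\<dots> = (\<integral>\<^sup>+x. ennreal (g' x) * indicator {h u..h l} x \<partial>lborel)"
    proof (intro nn_integral_cong_AE, use AE_lborel_singleton[of "h u"] AE_lborel_singleton[of "h l"] in eventually_elim)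
      case (elim x)
      have "0 < x \<and> l < g x \<and> g x < u \<longleftrightarrow> h u < x \<and> x < h l"
        using g_less[of "h l" x] g_less[of x "h u"] g_less[of x "h l"] h_pos[of u] h_pos[of l]
        by (cases "0 < x") (auto simp: g_h)
      then show ?case using elim by (auto simp: indicator_def)
    qed
    also have "\<dots> = ennreal (- g (h l) - (- g (h u)))"
    proof (rule nn_integral_FTC_Icc)
      fix x assume x: "x \<in> {h u..h l}"
      then have "x > 0" using h_pos[of u] by simp
      then show "((\<lambda>x. - g x) has_real_derivative g' x) (at x)"
        unfolding g_def g'_def by (auto intro!: derivative_eq_intros simp: power2_eq_square field_simps)
      show "0 \<le> g' x" by (simp add: g'_def)
    qed (use hul in auto)
    also have "\<dots> = ennreal (u - l)" by (simp add: g_h)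
    finally show "emeasure M (box l u) = ennreal (\<Prod>b\<in>Basis. (u - l) \<bullet> b)" by simp
  qed (simp add: M_def)
  then have "(\<integral>\<^sup>+t. F t \<partial>lborel) = (\<integral>\<^sup>+t. F t \<partial>M)" by simp
  also have "\<dots> = (\<integral>\<^sup>+u. F (g u) \<partial>density lborel (\<lambda>u. ennreal (g' u) * indicator {0<..} u))"
    unfolding M_def by (subst nn_integral_distr) auto
  also have "\<dots> = (\<integral>\<^sup>+u. F (g u) * ennreal (g' u) * indicator {0<..} u \<partial>lborel)"
    by (subst nn_integral_density) (auto simp: mult_ac)
  finally show ?thesis unfolding g_def g'_def .
qed

text \<open>Inverse stereographic projection from the pole \<open>(0, 1)\<close>. The vector being
  scaled is the point \<open>y = (z, t)\<close> with \<open>norm y - t = 1\<close>, and the scalar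
  is \<open>1 / norm y\<close>; this is the form that the light-cone computation meets.\<close>

definition stereographic :: "'b::euclidean_space \<Rightarrow> 'b \<times> real" where
  "stereographic z = (2 / (1 + (norm z)\<^sup>2)) *\<^sub>R (z, ((norm z)\<^sup>2 - 1) / 2)"

lemma norm_stereographic_numerator:
  "norm (z::'b::euclidean_space, ((norm z)\<^sup>2 - 1) / 2) = (1 + (norm z)\<^sup>2) / 2"
proof -
  have "(norm z)\<^sup>2 + (((norm z)\<^sup>2 - 1) / 2)\<^sup>2 = ((1 + (norm z)\<^sup>2) / 2)\<^sup>2"
    by (simp add: power2_eq_square field_simps)
  then have "norm (z, ((norm z)\<^sup>2 - 1) / 2) = sqrt (((1 + (norm z)\<^sup>2) / 2)\<^sup>2)"
    by (simp only: norm_Pair real_norm_def power2_abs)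
  then show ?thesis by simp
qed

lemma one_plus_norm_square_pos: "0 < 1 + (norm z)\<^sup>2" 
  by (simp add: add_pos_nonneg)

lemma one_plus_norm_square_nonzero: "1 + (norm z)\<^sup>2 \<noteq> 0"
  using one_plus_norm_square_pos[of z] by linarith

lemma norm_stereographic: "norm (stereographic z) = 1"
  using one_plus_norm_square_pos[of z] by (simp add: stereographic_def norm_stereographic_numerator del: scaleR_Pair)

lemma stereographic_borel[measurable]: "stereographic \<in> borel_measurable borel"
  unfolding stereographic_def
  by (intro borel_measurable_continuous_onI continuous_intros) (simp_all add: one_plus_norm_square_nonzero)

text \<open>On the light cone \<open>{(y, norm y)}\<close> the measure \<open>dy / norm y\<close> is Lorentz invariant. Integrating
  \<open>f (y / norm y) * exp (- norm y)\<close> against it in polar coordinates gives the sphere integral of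
  \<open>f\<close>; in the horospherical coordinates \<open>v = \<lambda> z\<close>, \<open>norm y - t = \<lambda>\<close> for \<open>y = (v, t)\<close>
  it gives the stereographic one.\<close>

lemma nn_integral_sphere_stereographic:
  fixes f :: "'b::euclidean_space \<times> real \<Rightarrow> ennreal"
  assumes f[measurable]: "f \<in> borel_measurable borel"
    and fin: "(\<integral>\<^sup>+\<omega>. f \<omega> \<partial>sphere_measure) < \<infinity>"
  defines "n \<equiv> real DIM('b) + 1"
  shows "(\<integral>\<^sup>+\<omega>. f \<omega> \<partial>sphere_measure) = ennreal (2 powr (n - 2) * Gamma (n / 2) / pi powr (n / 2)) *
    (\<integral>\<^sup>+z. f (stereographic z) * ennreal (1 / (1 + (norm z)\<^sup>2) ^ DIM('b)) \<partial>lborel)"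
proof -
  let ?m = "DIM('b)"
  have n: "n > 1" by (simp add: n_def)
  define I where "I = (\<integral>\<^sup>+\<omega>. f \<omega> \<partial>sphere_measure)"
  define J where "J = (\<integral>\<^sup>+z. f (stereographic z) * ennreal (1 / (1 + (norm z)\<^sup>2) ^ ?m) \<partial>lborel)"
  define H where "H y = f (y /\<^sub>R norm y) * ennreal (exp (- norm y) / norm y)" for y :: "'b \<times> real"
  have [measurable]: "H \<in> borel_measurable borel" unfolding H_def by measurable
  have "(\<integral>\<^sup>+y. H y \<partial>lborel) = (\<integral>\<^sup>+y. f (y /\<^sub>R norm y) * ennreal (exp (- (norm y powr 1)) / norm y powr 1) \<partial>lborel)"
    by (simp add: H_def)
  also have "\<dots> = ennreal (unit_ball_vol n) * I *
     (\<integral>\<^sup>+u. ennreal (exp (- u) / u) * ennreal (n / 1 * u powr (n / 1 - 1)) * indicator {0<..} u \<partial>lborel)"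
    using nn_integral_polar[of f "\<lambda>u. ennreal (exp (- u) / u)" 1] fin by (simp add: I_def n_def add.commute)
  also have "(\<integral>\<^sup>+u. ennreal (exp (- u) / u) * ennreal (n / 1 * u powr (n / 1 - 1)) * indicator {0<..} u \<partial>lborel)
      = (\<integral>\<^sup>+u. ennreal n * (ennreal (u powr ((n - 1) - 1) * exp (- u)) * indicator {0<..} u) \<partial>lborel)"
  proof (intro nn_integral_cong)
    fix u :: real
    show "ennreal (exp (- u) / u) * ennreal (n / 1 * u powr (n / 1 - 1)) * indicator {0<..} u
      = ennreal n * (ennreal (u powr ((n - 1) - 1) * exp (- u)) * indicator {0<..} u)"
    proof (cases "u > 0")
      case True
      then have "u powr (n - 1) = u powr ((n - 1) - 1) * u" using powr_mult_base[of u "n - 1 - 1"] by (simp add: mult.commute)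
      then show ?thesis using n True by (simp add: ennreal_mult[symmetric] field_simps)
    qed simp
  qed
  also have "\<dots> = ennreal n * ennreal (Gamma (n - 1))"
    using n nn_integral_Gamma[of "n - 1"] by (subst nn_integral_cmult) auto
  finally have 1: "(\<integral>\<^sup>+y. H y \<partial>lborel) = ennreal (unit_ball_vol n) * I * (ennreal n * ennreal (Gamma (n - 1)))" .

  define K where "K z u = f (stereographic z) * ennreal (exp (- (u * ((1 + (norm z)\<^sup>2) / 2))) * u powr (n - 2)) * indicator {0<..} u"
    for z :: 'b and u :: real
  have [measurable]: "case_prod K \<in> borel_measurable (lborel \<Otimes>\<^sub>M lborel)"
    unfolding K_def by measurable
  have [measurable]: "H \<in> borel_measurable (lborel \<Otimes>\<^sub>M lborel)" by (simp add: lborel_prod)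
  define T where "T u v = H (v, ((norm v)\<^sup>2 / u - u) / 2) * ennreal (((norm v)\<^sup>2 / u\<^sup>2 + 1) / 2)" for u v
  have [measurable]: "case_prod T \<in> borel_measurable (lborel \<Otimes>\<^sub>M lborel)"
    unfolding T_def by measurable
  \<comment> \<open>For \<open>v = u z\<close> the point \<open>y\<close> is \<open>u\<close> times
    the vector \<open>?w\<close> over \<open>z\<close>. The Jacobian \<open>norm ?w\<close> cancels
    the density \<open>1 / norm y\<close> up to \<open>1 / u\<close>, and dilating \<open>v\<close>
    contributes \<open>u ^ ?m\<close>; together they leave \<open>u powr (n - 2)\<close>.\<close>
  have key: "T u (u *\<^sub>R z) * ennreal (u ^ ?m) = K z u"
    if u: "u > 0" for u :: real and z :: 'b
  proof -
    let ?w = "(z, ((norm z)\<^sup>2 - 1) / 2)"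
    have p: "(u *\<^sub>R z, ((norm (u *\<^sub>R z))\<^sup>2 / u - u) / 2) = u *\<^sub>R ?w"
      using u by (simp add: power2_eq_square field_simps)
    have w: "norm ?w = (1 + (norm z)\<^sup>2) / 2" by (rule norm_stereographic_numerator)
    have "(u *\<^sub>R ?w) /\<^sub>R norm (u *\<^sub>R ?w) = ?w /\<^sub>R norm ?w"
      using u by (simp del: scaleR_Pair)
    also have "\<dots> = stereographic z" unfolding w stereographic_def using one_plus_norm_square_pos[of z] by (simp add: field_simps)
    finally have st: "(u *\<^sub>R ?w) /\<^sub>R norm (u *\<^sub>R ?w) = stereographic z" .
    have q: "((norm (u *\<^sub>R z))\<^sup>2 / u\<^sup>2 + 1) / 2 = norm ?w"
      using u unfolding w by (simp add: power2_eq_square field_simps)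
    have "u powr (n - 2) = u ^ ?m / u"
      using u powr_realpow[of u "?m"] powr_diff[of u "real ?m" 1] by (simp add: n_def)
    then have e: "exp (- norm (u *\<^sub>R ?w)) / norm (u *\<^sub>R ?w) * norm ?w * u ^ ?m = exp (- (u * ((1 + (norm z)\<^sup>2) / 2))) * u powr (n - 2)"
    proof -
      have "exp (- (u * a)) / (u * a) * a * u ^ ?m = exp (- (u * a)) * (u ^ ?m / u)" if "a > 0" for a
        using that by simp
      moreover have "norm (u *\<^sub>R ?w) = u * ((1 + (norm z)\<^sup>2) / 2)"
        using u w by (simp del: scaleR_Pair)
      ultimately show ?thesis
        unfolding \<open>u powr (n - 2) = u ^ ?m / u\<close> w using one_plus_norm_square_pos[of z] by simp
    qed
    have "ennreal (exp (- norm (u *\<^sub>R ?w)) / norm (u *\<^sub>R ?w)) * ennreal (norm ?w) * ennreal (u ^ ?m) =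
        ennreal (exp (- (u * ((1 + (norm z)\<^sup>2) / 2))) * u powr (n - 2))"
      unfolding e[symmetric] using u
      by (simp only: ennreal_mult''[symmetric] norm_ge_zero zero_le_power less_imp_le)
    then show ?thesis
      unfolding T_def p q unfolding H_def K_def st using u by (simp only: mult.assoc) simp
  qed
  have "(\<integral>\<^sup>+y. H y \<partial>lborel) = (\<integral>\<^sup>+v. \<integral>\<^sup>+t. H (v, t) \<partial>lborel \<partial>lborel)"
    by (subst lborel_prod[symmetric], subst lborel.nn_integral_fst[symmetric]) auto
  also have "\<dots> = (\<integral>\<^sup>+v. \<integral>\<^sup>+u. T u v * indicator {0<..} u \<partial>lborel \<partial>lborel)"
    \<comment> \<open>The substitution requires \<open>norm v > 0\<close>; the single point
      \<open>v = 0\<close> is a null set.\<close>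
    by (intro nn_integral_cong_AE, use AE_lborel_nonzero in eventually_elim)
      (unfold T_def, rule nn_integral_hyperbolic_substitution, auto)
  also have "\<dots> = (\<integral>\<^sup>+u. \<integral>\<^sup>+v. T u v * indicator {0<..} u \<partial>lborel \<partial>lborel)"
    by (rule lborel_pair.Fubini'[symmetric]) measurable
  also have "\<dots> = (\<integral>\<^sup>+u. \<integral>\<^sup>+z. K z u \<partial>lborel \<partial>lborel)"
  proof (rule nn_integral_cong)
    fix u :: real
    show "(\<integral>\<^sup>+v. T u v * indicator {0<..} u \<partial>lborel) = (\<integral>\<^sup>+z. K z u \<partial>lborel)"
    proof (cases "u > 0")
      case True
      have "(\<integral>\<^sup>+v. T u v \<partial>lborel)
         = ennreal (\<bar>u\<bar> ^ ?m) * (\<integral>\<^sup>+z. T u (0 + u *\<^sub>R z) \<partial>lborel)"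
        using True by (intro nn_integral_lborel_affine) auto
      also have "\<dots> = (\<integral>\<^sup>+z. T u (u *\<^sub>R z) * ennreal (u ^ ?m) \<partial>lborel)"
        using True by (subst nn_integral_cmult[symmetric]) (measurable, simp add: mult_ac)
      also have "\<dots> = (\<integral>\<^sup>+z. K z u \<partial>lborel)" by (simp only: key[OF True])
      finally show ?thesis using True by simp
    qed (simp add: K_def)
  qed
  also have "\<dots> = (\<integral>\<^sup>+z. \<integral>\<^sup>+u. K z u \<partial>lborel \<partial>lborel)"
    by (rule lborel_pair.Fubini') measurable
  also have "\<dots> = (\<integral>\<^sup>+z. ennreal (2 powr (n - 1) * Gamma (n - 1)) * (f (stereographic z) * ennreal (1 / (1 + (norm z)\<^sup>2) ^ ?m)) \<partial>lborel)"
  proof (rule nn_integral_cong)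
    fix z :: 'b
    define a where "a = (1 + (norm z)\<^sup>2) / 2"
    have a: "a > 0" using one_plus_norm_square_pos[of z] by (simp add: a_def)
    \<comment> \<open>Dilation by \<open>1 / a\<close> turns this into a Gamma integral; the factor
      \<open>1 / a powr (n - 1)\<close> supplies both the stereographic density and the power of
      2.\<close>
    have "(\<integral>\<^sup>+u. ennreal (exp (- (u * a)) * u powr (n - 2)) * indicator {0<..} u \<partial>lborel)
        = ennreal (\<bar>1 / a\<bar> ^ DIM(real)) * (\<integral>\<^sup>+u. ennreal (exp (- ((0 + (1 / a) *\<^sub>R u) * a)) * (0 + (1 / a) *\<^sub>R u) powr (n - 2)) * indicator {0<..} (0 + (1 / a) *\<^sub>R u) \<partial>lborel)"
      using a by (intro nn_integral_lborel_affine) auto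
    also have "\<dots> = (\<integral>\<^sup>+u. ennreal (1 / a powr (n - 1)) * (ennreal (u powr ((n - 1) - 1) * exp (- u)) * indicator {0<..} u) \<partial>lborel)"
    proof (subst nn_integral_cmult[symmetric])
      have "a powr (n - 1) = a powr (n - 2) * a" using a powr_mult_base[of a "n - 2"] by (simp add: mult.commute)
      then show "(\<integral>\<^sup>+u. ennreal (\<bar>1 / a\<bar> ^ DIM(real)) * (ennreal (exp (- ((0 + (1 / a) *\<^sub>R u) * a)) * (0 + (1 / a) *\<^sub>R u) powr (n - 2)) * indicator {0<..} (0 + (1 / a) *\<^sub>R u)) \<partial>lborel) =
         (\<integral>\<^sup>+u. ennreal (1 / a powr (n - 1)) * (ennreal (u powr ((n - 1) - 1) * exp (- u)) * indicator {0<..} u) \<partial>lborel)"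
        using a by (intro nn_integral_cong) (auto simp: indicator_def ennreal_mult[symmetric] powr_divide zero_less_divide_iff field_simps)
    qed measurable
    also have "\<dots> = ennreal (1 / a powr (n - 1)) * ennreal (Gamma (n - 1))"
      using n nn_integral_Gamma[of "n - 1"] by (subst nn_integral_cmult) auto
    also have "\<dots> = ennreal (2 powr (n - 1) * Gamma (n - 1)) * ennreal (1 / (1 + (norm z)\<^sup>2) ^ ?m)"
      using n one_plus_norm_square_pos[of z] powr_realpow[of "1 + (norm z)\<^sup>2" ?m]
      by (simp add: a_def powr_divide ennreal_mult[symmetric] less_imp_le Gamma_real_pos n_def)
    finally have *: "(\<integral>\<^sup>+u. ennreal (exp (- (u * a)) * u powr (n - 2)) * indicator {0<..} u \<partial>lborel) =
       ennreal (2 powr (n - 1) * Gamma (n - 1)) * ennreal (1 / (1 + (norm z)\<^sup>2) ^ ?m)" .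
    have "(\<integral>\<^sup>+u. K z u \<partial>lborel) = (\<integral>\<^sup>+u. f (stereographic z) * (ennreal (exp (- (u * a)) * u powr (n - 2)) * indicator {0<..} u) \<partial>lborel)"
      by (simp add: K_def a_def mult.assoc)
    also have "\<dots> = f (stereographic z) * (\<integral>\<^sup>+u. ennreal (exp (- (u * a)) * u powr (n - 2)) * indicator {0<..} u \<partial>lborel)"
      by (subst nn_integral_cmult) auto
    finally show "(\<integral>\<^sup>+u. K z u \<partial>lborel) = ennreal (2 powr (n - 1) * Gamma (n - 1)) * (f (stereographic z) * ennreal (1 / (1 + (norm z)\<^sup>2) ^ ?m))"
      unfolding * by (simp add: mult_ac)
  qed
  also have "\<dots> = ennreal (2 powr (n - 1) * Gamma (n - 1)) * J"
    unfolding J_def by (subst nn_integral_cmult) auto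
  finally have 2: "ennreal (unit_ball_vol n) * I * (ennreal n * ennreal (Gamma (n - 1))) = ennreal (2 powr (n - 1) * Gamma (n - 1)) * J"
    unfolding 1 .
  \<comment> \<open>The area of the sphere times \<open>Gamma (n - 1)\<close>; the Gamma factor also
    stands on the other side and cancels in the final constant.\<close>
  define A where "A = unit_ball_vol n * n * Gamma (n - 1)"
  have A: "A > 0" using n by (simp add: A_def Gamma_real_pos)
  have "ennreal A * I = ennreal (2 powr (n - 1) * Gamma (n - 1)) * J"
    unfolding 2[symmetric] A_def using n by (simp add: ennreal_mult Gamma_real_pos less_imp_le mult_ac)
  then have "ennreal (1 / A) * (ennreal A * I) = ennreal (1 / A) * (ennreal (2 powr (n - 1) * Gamma (n - 1)) * J)" by simp
  moreover have "ennreal (1 / A) * (ennreal A * I) = I"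
    using A by (simp add: mult.assoc[symmetric] ennreal_mult[symmetric])
  moreover have "ennreal (1 / A) * (ennreal (2 powr (n - 1) * Gamma (n - 1)) * J) = ennreal (2 powr (n - 1) * Gamma (n - 1) / A) * J"
    using A n by (simp add: mult.assoc[symmetric] ennreal_mult[symmetric] Gamma_real_pos less_imp_le)
  moreover have "2 powr (n - 1) * Gamma (n - 1) / A = 2 powr (n - 2) * Gamma (n / 2) / pi powr (n / 2)"
  proof -
    have "2 powr (n - 1) = 2 powr (n - 2) * 2" using powr_mult_base[of 2 "n - 2"] by (simp add: mult.commute)
    moreover have "A = 2 * (pi powr (n / 2) / Gamma (n / 2)) * Gamma (n - 1)"
      using n by (simp add: A_def unit_ball_vol_times_half_dim[symmetric])
    moreover have "Gamma (n - 1) > 0" using n by (simp add: Gamma_real_pos)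
    ultimately show ?thesis by (simp add: field_simps)
  qed
  ultimately show ?thesis unfolding I_def J_def by simp
qed

subsection \<open>Moebius invariance of the sphere measure\<close>

text \<open>Stereographic projection lives on \<open>'b \<times> real\<close>; this carries its
  consequences to any space of the same dimension. Equal dimensions give some linear isometry, and a
  reflection then corrects the image of \<open>u\<close>.\<close>

lemma exists_isometry_mapping:
  fixes u :: "'c::euclidean_space" and e :: "'a::euclidean_space"
  assumes dim: "DIM('c) = DIM('a)" and u: "norm u = 1" and e: "norm e = 1"
  obtains \<Phi> :: "'c \<Rightarrow> 'a" where "linear \<Phi>" "\<And>x. norm (\<Phi> x) = norm x" "surj \<Phi>" "\<Phi> u = e"
proof -
  obtain f :: "'c \<Rightarrow> 'a" and g where f: "linear f" "range f = UNIV" "\<And>x. norm (f x) = norm x"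
  proof (rule isometries_subspaces[of "UNIV :: 'c set" "UNIV :: 'a set"])
    show "dim (UNIV :: 'c set) = dim (UNIV :: 'a set)" using dim by (simp add: dim_UNIV)
  qed auto
  define R where "R = hyperplane_reflection (f u - e)"
  show ?thesis
  proof
    show "linear (R \<circ> f)"
      unfolding R_def by (intro linear_compose f linear_hyperplane_reflection)
    show "norm ((R \<circ> f) x) = norm x" for x
      by (simp add: R_def norm_hyperplane_reflection f)
    have "surj R" unfolding R_def
      by (rule surjI[of _ "hyperplane_reflection (f u - e)"], rule hyperplane_reflection_involution)
    then show "surj (R \<circ> f)" using f(2) by (rule comp_surj[rotated])
    show "(R \<circ> f) u = e"
      by (simp add: R_def hyperplane_reflection_swap f u e)
  qed
qed

lemma isometry_inner:
  fixes \<Phi> :: "'c::euclidean_space \<Rightarrow> 'a::euclidean_space"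
  assumes "linear \<Phi>" "\<And>x. norm (\<Phi> x) = norm x"
  shows "\<Phi> x \<bullet> \<Phi> y = x \<bullet> y"
  unfolding dot_norm[of "\<Phi> x"] dot_norm[of x] assms(2) linear_add[OF assms(1), symmetric] ..

text \<open>On the sphere this is the boundary map of the hyperbolic translation of the ball taking \<open>0\<close> to
  \<open>x\<close>; in stereographic coordinates about the axis of \<open>x\<close> it is a dilation.\<close>

definition moebius :: "'a::euclidean_space \<Rightarrow> 'a \<Rightarrow> 'a" where
  "moebius x \<omega> = (1 / (norm (x + \<omega>))\<^sup>2) *\<^sub>R ((1 - (norm x)\<^sup>2) *\<^sub>R \<omega> + (2 * (1 + x \<bullet> \<omega>)) *\<^sub>R x)"

lemma moebius_borel[measurable]: "moebius x \<in> borel_measurable borel"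
  unfolding moebius_def by measurable

lemma norm_add_square_unit:
  "norm \<omega> = 1 \<Longrightarrow> (norm (x + \<omega>))\<^sup>2 = 1 + (norm x)\<^sup>2 + 2 * (x \<bullet> \<omega>)"
  by (simp add: power2_norm_eq_inner inner_add_left inner_add_right inner_commute norm_eq_1)

lemma norm_add_unit_ge:
  assumes "norm x < 1" "norm (\<omega>::'a::euclidean_space) = 1"
  shows "1 - norm x \<le> norm (x + \<omega>)" "0 < norm (x + \<omega>)"
  using norm_triangle_ineq4[of "x + \<omega>" x] assms by auto

lemma norm_moebius:
  assumes x: "norm x < 1" and w: "norm \<omega> = 1"
  shows "norm (moebius x \<omega>) = 1"
proof -
  let ?D = "(norm (x + \<omega>))\<^sup>2" and ?r = "(norm x)\<^sup>2" and ?c = "x \<bullet> \<omega>"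
  have D: "?D = 1 + ?r + 2 * ?c" using w by (rule norm_add_square_unit)
  have ww: "\<omega> \<bullet> \<omega> = 1" using w by (simp add: norm_eq_1)
  have "(norm ((1 - ?r) *\<^sub>R \<omega> + (2 * (1 + ?c)) *\<^sub>R x))\<^sup>2 =
      (1 - ?r)\<^sup>2 + 4 * (1 + ?c) * (1 - ?r) * ?c + 4 * (1 + ?c)\<^sup>2 * ?r"
    unfolding power2_norm_eq_inner[of "_ + _"]
    by (simp add: inner_add_left inner_add_right ww inner_commute[of \<omega> x] power2_norm_eq_inner[of x, symmetric] power2_eq_square algebra_simps)
  also have "\<dots> = ?D\<^sup>2" unfolding D by (simp add: power2_eq_square algebra_simps)
  finally have "norm ((1 - ?r) *\<^sub>R \<omega> + (2 * (1 + ?c)) *\<^sub>R x) = ?D"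
    by (rule power2_eq_imp_eq) auto
  then show ?thesis using norm_add_unit_ge[OF x w] by (simp add: moebius_def)
qed

lemma stereographic_eq:
  "stereographic z = ((2 / (1 + (norm z)\<^sup>2)) *\<^sub>R z, ((norm z)\<^sup>2 - 1) / (1 + (norm z)\<^sup>2))"
proof -
  have "2 / (1 + (norm z)\<^sup>2) * (((norm z)\<^sup>2 - 1) / 2) = ((norm z)\<^sup>2 - 1) / (1 + (norm z)\<^sup>2)"
    by (simp only: times_divide_times_eq mult.commute[of 2] mult_divide_mult_cancel_right)
  then show ?thesis unfolding stereographic_def by (simp only: scaleR_Pair real_scaleR_def)
qed

text \<open>The factor \<open>(1 + r) / (1 - r)\<close> is the exponential of the signed hyperbolic
  distance from the center to the point at height \<open>r\<close> on the axis. The second identity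
  is the conformal factor: the dilation factor, compared with the stereographic densities at both
  ends, is the base of a Poisson kernel.\<close>

lemma moebius_stereographic:
  fixes w :: "'b::euclidean_space"
  assumes r: "norm r < (1::real)"
  shows "stereographic (((1 + r) / (1 - r)) *\<^sub>R w) = moebius (0, r) (stereographic w)"
    and "(1 + r) / (1 - r) / (1 + (norm (((1 + r) / (1 - r)) *\<^sub>R w))\<^sup>2) =
      (1 - r\<^sup>2) / (norm ((0, r) + stereographic w))\<^sup>2 / (1 + (norm w)\<^sup>2)"
proof -
  define N where "N = (norm w)\<^sup>2"
  define k where "k = (1 + r) / (1 - r)"
  \<comment> \<open>The common denominator of both sides; up to the factor \<open>1 + N\<close> it
    is the squared norm of \<open>(0, r) + stereographic w\<close>.\<close>
  define S where "S = (1 - r)\<^sup>2 + (1 + r)\<^sup>2 * N"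
  have N: "N \<ge> 0" "1 + N > 0" by (simp_all add: N_def add_pos_nonneg)
  have r1: "1 - r > 0" "1 + r > 0" using r by auto
  have S: "S > 0" using r1 N by (simp add: S_def add_pos_nonneg)
  have st: "stereographic w = ((2 / (1 + N)) *\<^sub>R w, (N - 1) / (1 + N))"
    unfolding N_def by (rule stereographic_eq)
  have nk: "(norm (k *\<^sub>R w))\<^sup>2 = k\<^sup>2 * N" by (simp add: N_def power_mult_distrib)
  have kN: "1 + k\<^sup>2 * N = S / (1 - r)\<^sup>2" "k\<^sup>2 * N - 1 = ((1 + r)\<^sup>2 * N - (1 - r)\<^sup>2) / (1 - r)\<^sup>2"
    using r1 by (simp_all add: k_def S_def power_divide field_simps)
  have D: "(norm ((0, r) + stereographic w))\<^sup>2 = S / (1 + N)"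
  proof -
    have "(norm ((0, r) + stereographic w))\<^sup>2 = 1 + (norm (0::'b, r))\<^sup>2 + 2 * ((0, r) \<bullet> stereographic w)"
      by (rule norm_add_square_unit) (rule norm_stereographic)
    also have "\<dots> = 1 + r\<^sup>2 + 2 * (r * ((N - 1) / (1 + N)))" by (simp add: st norm_Pair)
    also have "\<dots> = S / (1 + N)" using N by (simp add: S_def power2_eq_square field_simps)
    finally show ?thesis .
  qed
  have "stereographic (k *\<^sub>R w) = ((2 * k / (1 + k\<^sup>2 * N)) *\<^sub>R w, (k\<^sup>2 * N - 1) / (1 + k\<^sup>2 * N))"
    unfolding stereographic_eq nk by simp
  also have "2 * k / (1 + k\<^sup>2 * N) = 2 * (1 - r\<^sup>2) / S"
    using r1 S unfolding kN by (simp add: k_def power2_eq_square field_simps)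
  also have "(k\<^sup>2 * N - 1) / (1 + k\<^sup>2 * N) = ((1 + r)\<^sup>2 * N - (1 - r)\<^sup>2) / S"
    using r1 S unfolding kN by simp
  finally have L: "stereographic (k *\<^sub>R w) = ((2 * (1 - r\<^sup>2) / S) *\<^sub>R w, ((1 + r)\<^sup>2 * N - (1 - r)\<^sup>2) / S)" .
  have "moebius (0, r) (stereographic w) = ((1 + N) / S) *\<^sub>R
      ((1 - r\<^sup>2) *\<^sub>R ((2 / (1 + N)) *\<^sub>R w, (N - 1) / (1 + N)) + (2 * (1 + r * ((N - 1) / (1 + N)))) *\<^sub>R (0, r))"
    unfolding moebius_def D by (simp add: st norm_Pair)
  also have "\<dots> = (((1 + N) / S * ((1 - r\<^sup>2) * (2 / (1 + N)))) *\<^sub>R w,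
      (1 + N) / S * ((1 - r\<^sup>2) * ((N - 1) / (1 + N)) + 2 * (1 + r * ((N - 1) / (1 + N))) * r))"
    by simp
  also have "(1 + N) / S * ((1 - r\<^sup>2) * (2 / (1 + N))) = 2 * (1 - r\<^sup>2) / S" using N by simp
  also have "(1 + N) / S * ((1 - r\<^sup>2) * ((N - 1) / (1 + N)) + 2 * (1 + r * ((N - 1) / (1 + N))) * r)
      = ((1 + r)\<^sup>2 * N - (1 - r)\<^sup>2) / S"
  proof -
    define A where "A = (N - 1) / (1 + N)"
    have "(1 + N) * ((1 - r\<^sup>2) * A + 2 * (1 + r * A) * r)
      = (1 - r\<^sup>2) * ((1 + N) * A) + 2 * ((1 + N) + r * ((1 + N) * A)) * r"
      by (simp add: algebra_simps)
    also have "(1 + N) * A = N - 1" using N by (simp add: A_def)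
    also have "(1 - r\<^sup>2) * (N - 1) + 2 * ((1 + N) + r * (N - 1)) * r = (1 + r)\<^sup>2 * N - (1 - r)\<^sup>2"
      by (simp add: power2_eq_square algebra_simps)
    finally have "(1 + N) * ((1 - r\<^sup>2) * A + 2 * (1 + r * A) * r) = (1 + r)\<^sup>2 * N - (1 - r)\<^sup>2" .
    then show ?thesis by (simp add: A_def)
  qed
  finally show "stereographic (((1 + r) / (1 - r)) *\<^sub>R w) = moebius (0, r) (stereographic w)"
    using L unfolding k_def by simp
  have "k / (1 + k\<^sup>2 * N) = (1 - r\<^sup>2) / S"
    using r1 S unfolding kN by (simp add: k_def power2_eq_square field_simps)
  also have "\<dots> = (1 - r\<^sup>2) / (S / (1 + N)) / (1 + N)" using N by simp
  finally show "(1 + r) / (1 - r) / (1 + (norm (((1 + r) / (1 - r)) *\<^sub>R w))\<^sup>2) =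
      (1 - r\<^sup>2) / (norm ((0, r) + stereographic w))\<^sup>2 / (1 + (norm w)\<^sup>2)"
    unfolding k_def[symmetric] nk D N_def[symmetric] .
qed

text \<open>Stereographic projection carries both sides to Lebesgue measure, where the change of
  variables is a dilation with Jacobian \<open>k ^ DIM('b)\<close>. The bound on \<open>f\<close>
  provides the finite integrals that \<open>nn_integral_sphere_stereographic\<close> asks for on
  either side.\<close>

lemma nn_integral_sphere_moebius_vertical:
  fixes f :: "'b::euclidean_space \<times> real \<Rightarrow> ennreal"
  assumes f[measurable]: "f \<in> borel_measurable borel"
    and bound: "\<And>\<omega>. norm \<omega> = 1 \<Longrightarrow> f \<omega> \<le> ennreal B" and r: "norm r < (1::real)"
  shows "(\<integral>\<^sup>+\<omega>. f \<omega> \<partial>sphere_measure) =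
    (\<integral>\<^sup>+\<omega>. f (moebius (0, r) \<omega>) * ennreal (((1 - r\<^sup>2) / (norm ((0, r) + \<omega>))\<^sup>2) ^ DIM('b)) \<partial>sphere_measure)"
proof -
  let ?m = "DIM('b)"
  define k where "k = (1 + r) / (1 - r)"
  have r1: "1 - r > 0" "1 + r > 0" "norm (0 :: 'b, r) < 1" using r by (auto simp: norm_Pair)
  have r2: "r\<^sup>2 < 1" using r by (simp add: abs_square_less_1)
  have k: "k > 0" using r1 by (simp add: k_def)
  define C where "C = ennreal (2 powr (real ?m + 1 - 2) * Gamma ((real ?m + 1) / 2) / pi powr ((real ?m + 1) / 2))"
  define g where "g \<omega> = f (moebius (0, r) \<omega>) * ennreal (((1 - r\<^sup>2) / (norm ((0, r) + \<omega>))\<^sup>2) ^ ?m)" for \<omega>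
  have [measurable]: "g \<in> borel_measurable borel" unfolding g_def by measurable
  have fin1: "(\<integral>\<^sup>+\<omega>. f \<omega> \<partial>sphere_measure) < \<infinity>"
    using nn_integral_sphere_le[of f "ennreal B"] bound by (auto intro: le_less_trans)
  have "(\<integral>\<^sup>+\<omega>. g \<omega> \<partial>sphere_measure) \<le> ennreal B * ennreal (((1 - r\<^sup>2) / (1 - \<bar>r\<bar>)\<^sup>2) ^ ?m)"
  proof (rule nn_integral_sphere_le)
    fix \<omega> :: "'b \<times> real" assume w: "norm \<omega> = 1"
    have "1 - \<bar>r\<bar> \<le> norm ((0, r) + \<omega>)"
      using norm_add_unit_ge(1)[OF r1(3) w] by (simp add: norm_Pair)
    then have "((1 - r\<^sup>2) / (norm ((0, r) + \<omega>))\<^sup>2) ^ ?m \<le> ((1 - r\<^sup>2) / (1 - \<bar>r\<bar>)\<^sup>2) ^ ?m"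
      using r r2 norm_add_unit_ge(2)[OF r1(3) w]
      by (intro power_mono divide_left_mono mult_pos_pos zero_less_power) (auto intro!: power_mono)
    then show "g \<omega> \<le> ennreal B * ennreal (((1 - r\<^sup>2) / (1 - \<bar>r\<bar>)\<^sup>2) ^ ?m)"
      unfolding g_def by (intro mult_mono bound norm_moebius r1 w ennreal_leI) auto
  qed
  then have fin2: "(\<integral>\<^sup>+\<omega>. g \<omega> \<partial>sphere_measure) < \<infinity>"
    by (auto intro: le_less_trans simp: ennreal_mult_less_top)
  have "(\<integral>\<^sup>+\<omega>. f \<omega> \<partial>sphere_measure) =
      C * (\<integral>\<^sup>+z. f (stereographic z) * ennreal (1 / (1 + (norm z)\<^sup>2) ^ ?m) \<partial>lborel)"
    unfolding C_def by (rule nn_integral_sphere_stereographic[OF f fin1])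
  also have "(\<integral>\<^sup>+z. f (stereographic z) * ennreal (1 / (1 + (norm z)\<^sup>2) ^ ?m) \<partial>lborel) = ennreal (\<bar>k\<bar> ^ ?m) *
      (\<integral>\<^sup>+w. f (stereographic (0 + k *\<^sub>R w)) * ennreal (1 / (1 + (norm (0 + k *\<^sub>R w))\<^sup>2) ^ ?m) \<partial>lborel)"
    using k by (intro nn_integral_lborel_affine) auto
  also have "\<dots> = (\<integral>\<^sup>+w. ennreal (k ^ ?m) * (f (stereographic (k *\<^sub>R w)) * ennreal (1 / (1 + (norm (k *\<^sub>R w))\<^sup>2) ^ ?m)) \<partial>lborel)"
    using k by (subst nn_integral_cmult) auto
  also have "\<dots> = (\<integral>\<^sup>+w. g (stereographic w) * ennreal (1 / (1 + (norm w)\<^sup>2) ^ ?m) \<partial>lborel)"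
  proof (rule nn_integral_cong)
    fix w :: 'b
    have "ennreal (k ^ ?m) * ennreal (1 / (1 + (norm (k *\<^sub>R w))\<^sup>2) ^ ?m) = ennreal ((k / (1 + (norm (k *\<^sub>R w))\<^sup>2)) ^ ?m)"
      using k by (simp add: ennreal_mult[symmetric] power_divide add_nonneg_nonneg)
    also have "k / (1 + (norm (k *\<^sub>R w))\<^sup>2) = (1 - r\<^sup>2) / (norm ((0, r) + stereographic w))\<^sup>2 / (1 + (norm w)\<^sup>2)"
      unfolding k_def by (rule moebius_stereographic[OF r])
    also have "ennreal (((1 - r\<^sup>2) / (norm ((0, r) + stereographic w))\<^sup>2 / (1 + (norm w)\<^sup>2)) ^ ?m) =
        ennreal (((1 - r\<^sup>2) / (norm ((0, r) + stereographic w))\<^sup>2) ^ ?m) * ennreal (1 / (1 + (norm w)\<^sup>2) ^ ?m)"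
      using r2 by (subst ennreal_mult[symmetric]) (auto simp: power_divide power_mult_distrib)
    finally have *: "ennreal (k ^ ?m) * ennreal (1 / (1 + (norm (k *\<^sub>R w))\<^sup>2) ^ ?m) =
        ennreal (((1 - r\<^sup>2) / (norm ((0, r) + stereographic w))\<^sup>2) ^ ?m) * ennreal (1 / (1 + (norm w)\<^sup>2) ^ ?m)" .
    have "stereographic (k *\<^sub>R w) = moebius (0, r) (stereographic w)"
      unfolding k_def by (rule moebius_stereographic[OF r])
    then have "ennreal (k ^ ?m) * (f (stereographic (k *\<^sub>R w)) * ennreal (1 / (1 + (norm (k *\<^sub>R w))\<^sup>2) ^ ?m))
       = f (moebius (0, r) (stereographic w)) * (ennreal (k ^ ?m) * ennreal (1 / (1 + (norm (k *\<^sub>R w))\<^sup>2) ^ ?m))"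
      by (simp only: mult.left_commute)
    then show "ennreal (k ^ ?m) * (f (stereographic (k *\<^sub>R w)) * ennreal (1 / (1 + (norm (k *\<^sub>R w))\<^sup>2) ^ ?m))
       = g (stereographic w) * ennreal (1 / (1 + (norm w)\<^sup>2) ^ ?m)"
      unfolding * g_def by (simp only: mult.assoc)
  qed
  also have "C * \<dots> = (\<integral>\<^sup>+\<omega>. g \<omega> \<partial>sphere_measure)"
    unfolding C_def by (rule nn_integral_sphere_stereographic[OF _ fin2, symmetric]) measurable
  finally show ?thesis unfolding g_def .
qed

lemma exists_unit_direction: "\<exists>e::'a::euclidean_space. norm e = 1 \<and> x = norm x *\<^sub>R e"
proof (cases "x = 0")
  case True
  then show ?thesis by (intro exI[of _ "SOME i. i \<in> Basis"]) (simp add: SOME_Basis)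
next
  case False
  then show ?thesis by (intro exI[of _ "x /\<^sub>R norm x"]) simp
qed

text \<open>\<open>moebius\<close> commutes with linear isometries, so an isometry from the model
  \<open>'b \<times> real\<close> that takes the vertical axis to the direction of \<open>x\<close>
  reduces the claim to the vertical case.\<close>

lemma nn_integral_sphere_moebius:
  fixes f :: "'a::euclidean_space \<Rightarrow> ennreal"
  assumes dim: "DIM('a) = DIM('b::euclidean_space) + 1" and f[measurable]: "f \<in> borel_measurable borel"
    and bound: "\<And>\<omega>. norm \<omega> = 1 \<Longrightarrow> f \<omega> \<le> ennreal B" and x: "norm x < 1"
  shows "(\<integral>\<^sup>+\<omega>. f \<omega> \<partial>sphere_measure) =
    (\<integral>\<^sup>+\<omega>. f (moebius x \<omega>) * ennreal (((1 - (norm x)\<^sup>2) / (norm (x + \<omega>))\<^sup>2) ^ (DIM('a) - 1)) \<partial>sphere_measure)"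
proof -
  obtain e :: 'a where e: "norm e = 1" "x = norm x *\<^sub>R e"
    using exists_unit_direction by metis
  have u: "norm (0::'b, 1::real) = 1" by (simp add: norm_Pair)
  have dim': "DIM('b \<times> real) = DIM('a)" using dim by simp
  obtain \<Phi> :: "'b \<times> real \<Rightarrow> 'a" where P: "linear \<Phi>" "\<And>x. norm (\<Phi> x) = norm x" "surj \<Phi>" "\<Phi> (0, 1) = e"
    using exists_isometry_mapping[OF dim' u e(1)] by blast
  have [measurable]: "\<Phi> \<in> borel_measurable borel" using P(1) by (rule linear_borel_measurable)
  define r where "r = norm x"
  have r: "norm r < 1" using x by (simp add: r_def)
  have "\<Phi> (0, r) = r *\<^sub>R \<Phi> (0, 1)" using P(1) by (simp add: linear_scale[symmetric])
  then have Pr: "\<Phi> (0, r) = x" using e P by (simp add: r_def)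
  have Pm: "\<Phi> (moebius (0, r) \<omega>) = moebius x (\<Phi> \<omega>)" for \<omega>
    unfolding moebius_def Pr[symmetric] isometry_inner[OF P(1,2)]
    by (simp add: linear_add[OF P(1), symmetric] linear_scale[OF P(1), symmetric] P(2) del: scaleR_Pair add_Pair)
  define g where "g \<omega> = f (moebius x \<omega>) * ennreal (((1 - (norm x)\<^sup>2) / (norm (x + \<omega>))\<^sup>2) ^ (DIM('a) - 1))" for \<omega>
  have [measurable]: "g \<in> borel_measurable borel" unfolding g_def by measurable
  have "(\<integral>\<^sup>+\<omega>. f \<omega> \<partial>sphere_measure) = (\<integral>\<^sup>+\<omega>. f (\<Phi> \<omega>) \<partial>sphere_measure)"
    by (rule nn_integral_sphere_isometry[OF P(1-3) dim' f, symmetric])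
  also have "\<dots> = (\<integral>\<^sup>+\<omega>. f (\<Phi> (moebius (0, r) \<omega>)) * ennreal (((1 - r\<^sup>2) / (norm ((0, r) + \<omega>))\<^sup>2) ^ DIM('b)) \<partial>sphere_measure)"
    by (rule nn_integral_sphere_moebius_vertical[where B=B]) (use r in \<open>auto intro: bound simp: P(2)\<close>)
  also have "\<dots> = (\<integral>\<^sup>+\<omega>. g (\<Phi> \<omega>) \<partial>sphere_measure)"
  proof (rule nn_integral_cong)
    fix \<omega>
    have "norm (x + \<Phi> \<omega>) = norm ((0, r) + \<omega>)"
      unfolding Pr[symmetric] linear_add[OF P(1), symmetric] P(2) ..
    then show "f (\<Phi> (moebius (0, r) \<omega>)) * ennreal (((1 - r\<^sup>2) / (norm ((0, r) + \<omega>))\<^sup>2) ^ DIM('b)) = g (\<Phi> \<omega>)"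
      unfolding g_def Pm using dim by (simp add: r_def)
  qed
  also have "\<dots> = (\<integral>\<^sup>+\<omega>. g \<omega> \<partial>sphere_measure)"
    by (rule nn_integral_sphere_isometry[OF P(1-3) dim']) measurable
  finally show ?thesis unfolding g_def .
qed

subsection \<open>The extremal direction\<close>

lemma ennreal_average:
  assumes "0 \<le> x" "0 \<le> y"
  shows "ennreal ((x + y) / 2) = ennreal (1 / 2) * ennreal x + ennreal (1 / 2) * ennreal y"
proof -
  have "ennreal ((x + y) / 2) = ennreal (1 / 2 * x) + ennreal (1 / 2 * y)"
    using assms by (subst ennreal_plus[symmetric]) (auto simp: add_divide_distrib)
  then show ?thesis using assms by (simp only: ennreal_mult zero_le_divide_1_iff zero_le_numeral)
qed

lemma ennreal_half_add_half: "ennreal (1 / 2) * w + ennreal (1 / 2) * w = w"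
proof -
  have "ennreal (1 / 2) * w + ennreal (1 / 2) * w = ennreal (1 / 2 + 1 / 2) * w"
    by (subst ennreal_plus) (simp_all only: distrib_right zero_le_divide_1_iff zero_le_numeral)
  then show ?thesis by simp
qed

section \<open>The even part of the binomial series\<close>

lemma Gamma_add_of_nat:
  fixes z :: real
  assumes "z > 0"
  shows "Gamma (z + real j) = Gamma z * pochhammer z j"
proof -
  have "z \<notin> \<int>\<^sub>\<le>\<^sub>0" using assms by (auto elim!: nonpos_Ints_cases)
  then show ?thesis using pochhammer_Gamma[of z j] Gamma_real_pos[OF assms] by simp
qed

text \<open>Of the \<open>2 j\<close> factors \<open>s\<close>, \<open>s - 1\<close>,
  \<open>s - 2\<close>, ... the first is positive and the remaining odd number of them are
  negative.\<close>

lemma gbinomial_even_nonpos: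
  fixes s :: real
  assumes "0 < s" "s < 1" "j > 0"
  shows "s gchoose (2 * j) \<le> 0"
proof -
  obtain m where m: "2 * j = Suc m" using assms by (cases "2 * j") auto
  have "pochhammer (- s) (2 * j) = - s * pochhammer (1 - s) m"
    unfolding m pochhammer_rec by simp
  moreover have "pochhammer (1 - s) m > 0" using assms by (intro pochhammer_pos) auto
  ultimately have "pochhammer (- s) (2 * j) \<le> 0" using assms by (simp add: mult_le_0_iff)
  then show ?thesis
    by (simp add: gbinomial_pochhammer divide_le_0_iff)
qed

text \<open>Duplication of the Pochhammer symbol and of the factorial; the powers of 4 cancel. The
  two symbols in the numerator become the upper parameters of the hypergeometric series.\<close>

lemma gbinomial_even_pochhammer:
  "(s::real) gchoose (2 * j) =
    pochhammer (- s / 2) j * pochhammer ((1 - s) / 2) j / (fact j * pochhammer (1 / 2) j)"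
proof -
  have "pochhammer (- s) (2 * j) = 2 ^ (2 * j) * pochhammer (- s / 2) j * pochhammer ((1 - s) / 2) j"
    using pochhammer_double[of "- s / 2" j] by (simp add: diff_divide_distrib add.commute)
  then show ?thesis
    by (simp add: gbinomial_pochhammer fact_double)
qed

definition even_powr :: "real \<Rightarrow> real \<Rightarrow> real" where
  "even_powr s u = ((1 + u) powr s + (1 - u) powr s) / 2"

lemma even_powr_abs: "even_powr s \<bar>u\<bar> = even_powr s u"
  by (simp add: even_powr_def abs_if)

lemma even_powr_nonneg: "0 \<le> even_powr s u"
  by (simp add: even_powr_def)

lemma even_powr_borel[measurable]: "even_powr s \<in> borel_measurable borel"
  unfolding even_powr_def by measurable

text \<open>As \<open>s - 1 < 0\<close>, the derivative has the sign of
  \<open>(1 + x) powr (s - 1) - (1 - x) powr (s - 1)\<close>, which is at most 0 for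
  \<open>x > 0\<close>. At 1 the derivative blows up, so only continuity is used at the ends of the
  interval.\<close>

lemma even_powr_antimono:
  assumes s: "0 < s" "s < 1" and uv: "\<bar>u\<bar> \<le> \<bar>v\<bar>" "\<bar>v\<bar> \<le> 1"
  shows "even_powr s v \<le> even_powr s u"
proof -
  have "even_powr s \<bar>v\<bar> \<le> even_powr s \<bar>u\<bar>"
  proof (rule DERIV_nonpos_imp_decreasing_open[OF uv(1)])
    fix x :: real assume x: "\<bar>u\<bar> < x" "x < \<bar>v\<bar>"
    then have x01: "0 < x" "x < 1" using uv by auto
    have "(even_powr s has_real_derivative s * ((1 + x) powr (s - 1) - (1 - x) powr (s - 1)) / 2) (at x)"
      unfolding even_powr_def using x01
      by (auto intro!: derivative_eq_intros simp: field_simps)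
    moreover have "(1 + x) powr (s - 1) \<le> (1 - x) powr (s - 1)"
      using x01 s by (intro powr_mono2') auto
    then have "s * ((1 + x) powr (s - 1) - (1 - x) powr (s - 1)) / 2 \<le> 0"
      using s by (simp add: mult_le_0_iff)
    ultimately show "\<exists>y. (even_powr s has_real_derivative y) (at x) \<and> y \<le> 0" by blast
  next
    show "continuous_on {\<bar>u\<bar>..\<bar>v\<bar>} (even_powr s)"
      unfolding even_powr_def using s uv by (intro continuous_intros continuous_on_powr') auto
  qed
  then show ?thesis by (simp add: even_powr_abs)
qed

lemma even_powr_sums:
  assumes u: "\<bar>u\<bar> < 1"
  shows "(\<lambda>j. (s gchoose (2 * j)) * u ^ (2 * j)) sums even_powr s u"
proof -
  have "(\<lambda>n. ((s gchoose n) * u ^ n + (s gchoose n) * (- u) ^ n) / 2) sums even_powr s u"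
    unfolding even_powr_def using gen_binomial_real[of u s] gen_binomial_real[of "- u" s] u
    by (intro sums_divide sums_add) auto
  moreover have "strict_mono ((*) (2::nat))" by (auto simp: strict_mono_def)
  moreover have "((s gchoose n) * u ^ n + (s gchoose n) * (- u) ^ n) / 2 = 0" if "n \<notin> range ((*) 2)" for n
  proof -
    have "odd n" using that by (auto elim!: evenE)
    then show ?thesis by simp
  qed
  ultimately have "(\<lambda>j. ((s gchoose (2 * j)) * u ^ (2 * j) + (s gchoose (2 * j)) * (- u) ^ (2 * j)) / 2) sums even_powr s u"
    by (subst (asm) sums_mono_reindex[symmetric, where g="(*) 2"]) auto
  then show ?thesis by simp
qed

text \<open>All terms after the initial 1 are nonpositive, so the partial sums decrease from 1 to a
  nonnegative limit. The bound does not degenerate as \<open>u\<close> approaches 1, which makes it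
  a dominating constant even for \<open>t = 1\<close>.\<close>

lemma even_powr_partial_sum_bound:
  fixes s u :: real
  assumes s: "0 < s" "s < 1" and u: "\<bar>u\<bar> < 1"
  shows "\<bar>\<Sum>j<N. (s gchoose (2 * j)) * u ^ (2 * j)\<bar> \<le> 1"
proof (cases N)
  case (Suc M)
  define S where "S M = (\<Sum>j<Suc M. (s gchoose (2 * j)) * u ^ (2 * j))" for M
  have "decseq S"
    unfolding decseq_Suc_iff
  proof
    fix M
    have "(s gchoose (2 * Suc M)) * u ^ (2 * Suc M) \<le> 0"
      using gbinomial_even_nonpos[OF s, of "Suc M"] by (intro mult_nonpos_nonneg zero_le_even_power) auto
    then show "S (Suc M) \<le> S M" by (simp add: S_def)
  qed
  moreover have "S \<longlonglongrightarrow> even_powr s u"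
    using even_powr_sums[OF u, of s] unfolding S_def sums_def by (rule LIMSEQ_Suc)
  ultimately have "even_powr s u \<le> S M" by (rule decseq_ge)
  then have "0 \<le> S M" using even_powr_nonneg[of s u] by linarith
  moreover have "S M \<le> S 0" using \<open>decseq S\<close> by (simp add: decseq_def)
  moreover have "S 0 = 1" by (simp add: S_def)
  ultimately show ?thesis unfolding Suc S_def by simp
qed simp

lemma inner_unit_le:
  assumes "norm a = 1" "norm b = 1"
  shows "\<bar>a \<bullet> b\<bar> \<le> 1"
  using Cauchy_Schwarz_ineq2[of a b] assms by simp

text \<open>Equality in the Cauchy-Schwarz inequality forces \<open>y\<close> onto the line through
  \<open>e\<close>, a null set in dimension at least 2.\<close>

lemma AE_sphere_inner_less_one:
  fixes e :: "'a::euclidean_space"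
  assumes e: "norm e = 1" and dim: "DIM('a) \<ge> 2"
  shows "AE \<omega> in sphere_measure. \<bar>\<omega> \<bullet> e\<bar> < 1"
proof (rule AE_sphere_measure)
  have "dim (span {e}) \<le> 1" using dim_le_card[of "{e}" "{e}"] by (simp add: dim_span)
  then have "negligible (span {e})" using dim by (intro negligible_lowdim) auto
  moreover have "span {e} \<in> sets borel" by (intro borel_closed closed_span)
  ultimately have "span {e} \<in> null_sets lborel"
    by (auto simp: negligible_iff_null_sets null_sets_completion_iff)
  then have "AE y in lborel. y \<notin> span {e}" by (rule AE_not_in)
  then show "AE y in lborel. \<bar>(y /\<^sub>R norm y) \<bullet> e\<bar> < 1" using AE_lborel_nonzero
  proof eventually_elim
    case (elim y)
    have "\<bar>y \<bullet> e\<bar> \<noteq> norm y * norm e"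
    proof
      assume "\<bar>y \<bullet> e\<bar> = norm y * norm e"
      then have "norm y *\<^sub>R e = y \<or> norm y *\<^sub>R e = - y"
        unfolding norm_cauchy_schwarz_abs_eq using e by auto
      then have "y = norm y *\<^sub>R e \<or> y = (- norm y) *\<^sub>R e" by (metis scaleR_minus_left minus_minus)
      then have "y \<in> span {e}" by (metis span_base span_scale singletonI)
      then show False using elim by simp
    qed
    then have "\<bar>y \<bullet> e\<bar> < norm y" using Cauchy_Schwarz_ineq2[of y e] e by simp
    then show ?case using elim by (simp add: abs_mult field_simps)
  qed
  show "Measurable.pred borel (\<lambda>\<omega>. \<bar>\<omega> \<bullet> e\<bar> < 1)" by measurable
qed

section \<open>Integrals depending on a direction\<close>

abbreviation direction_integral :: "real \<Rightarrow> real \<Rightarrow> real \<Rightarrow> 'a::euclidean_space \<Rightarrow> 'a \<Rightarrow> ennreal" where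
  "direction_integral s q t e l \<equiv>
    \<integral>\<^sup>+\<omega>. ennreal ((1 + t * (\<omega> \<bullet> e)) powr s * \<bar>\<omega> \<bullet> l\<bar> powr q) \<partial>sphere_measure"

abbreviation even_direction_integral :: "real \<Rightarrow> real \<Rightarrow> real \<Rightarrow> 'a::euclidean_space \<Rightarrow> 'a \<Rightarrow> ennreal" where
  "even_direction_integral s q t e l \<equiv>
    \<integral>\<^sup>+\<omega>. ennreal (even_powr s (t * (\<omega> \<bullet> e)) * \<bar>\<omega> \<bullet> l\<bar> powr q) \<partial>sphere_measure"

text \<open>Orthogonality of \<open>e\<close> and \<open>l\<close> reduces each term of the binomial
  series to a known moment, and partial sums bounded by 1 justify termwise integration.
  Nonnegativity is recorded because \<open>ennreal\<close> would replace a negative value by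
  0.\<close>

lemma nn_integral_even_powr_transversal:
  fixes e l :: "'a::euclidean_space"
  assumes e: "norm e = 1" and l: "norm l = 1" and el: "e \<bullet> l = 0" and dim: "DIM('a) \<ge> 2"
    and s: "0 < s" "s < 1" and q: "q > 0" and t: "0 \<le> t" "t \<le> 1"
  defines "n \<equiv> real DIM('a)"
  shows "even_direction_integral s q t e l =
    ennreal (Gamma (n / 2) * Gamma ((q + 1) / 2) / (sqrt pi * Gamma ((q + n) / 2)) *
      hypergeo_2F1 (- s / 2) ((1 - s) / 2) ((q + n) / 2) (t\<^sup>2))"
    and "0 \<le> hypergeo_2F1 (- s / 2) ((1 - s) / 2) ((q + n) / 2) (t\<^sup>2)"
proof -
  let ?S = "sphere_measure :: 'a measure"
  interpret finite_measure ?S by (rule finite_measure_sphere_measure)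
  have n: "n \<ge> 2" using dim by (simp add: n_def)
  have bm: "f \<in> borel_measurable ?S" if "f \<in> borel_measurable borel" for f :: "'a \<Rightarrow> real"
    using that by (rule borel_measurable_sphere_measure)
  have le1: "\<bar>\<omega> \<bullet> l\<bar> powr q \<le> 1" if "norm \<omega> = 1" for \<omega>
    using inner_unit_le[OF that l] q by (intro powr_le1) auto
  define K where "K = Gamma (n / 2) * Gamma ((q + 1) / 2) / (sqrt pi * Gamma ((q + n) / 2))"
  define m where "m j = K * (pochhammer (1 / 2) j / pochhammer ((q + n) / 2) j)" for j :: nat
  have G1: "Gamma ((q + n) / 2 + real j) = Gamma ((q + n) / 2) * pochhammer ((q + n) / 2) j" for j
    using q n by (intro Gamma_add_of_nat) auto
  have G2: "Gamma (real j + 1 / 2) = sqrt pi * pochhammer (1 / 2) j" for j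
    using Gamma_add_of_nat[of "1 / 2" j] by (simp add: Gamma_one_half_real add.commute)
  have moment: "has_bochner_integral ?S (\<lambda>\<omega>. (\<omega> \<bullet> e) ^ (2 * j) * \<bar>\<omega> \<bullet> l\<bar> powr q) (m j)" for j
  proof (rule has_bochner_integral_nn_integral)
    have "m j = Gamma (n / 2) * Gamma (real j + 1 / 2) * Gamma ((q + 1) / 2) / (pi * Gamma ((q + n) / 2 + real j))"
    proof -
      have sp: "sqrt pi / pi = 1 / sqrt pi" by (simp add: field_simps)
      have "A * (sqrt pi * P) * C / (pi * (D * F)) = A * C / (sqrt pi * D) * (P / F)" for A P C D F :: real
      proof -
        have "A * (sqrt pi * P) * C / (pi * (D * F)) = sqrt pi / pi * (A * P * C / (D * F))" by simp
        then show ?thesis unfolding sp by (simp add: mult_ac)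
      qed
      then show ?thesis unfolding m_def K_def G1 G2 by (simp only:)
    qed
    then show "(\<integral>\<^sup>+\<omega>. ennreal ((\<omega> \<bullet> e) ^ (2 * j) * \<bar>\<omega> \<bullet> l\<bar> powr q) \<partial>?S) = ennreal (m j)"
      unfolding n_def using nn_integral_sphere_moment[OF e l el q, of j] by simp
    show "0 \<le> m j" unfolding m_def K_def using q n
      by (intro mult_nonneg_nonneg divide_nonneg_nonneg less_imp_le[OF pochhammer_pos] less_imp_le[OF Gamma_real_pos]) auto
  qed (auto intro!: bm)
  define c where "c j = (s gchoose (2 * j)) * t ^ (2 * j)" for j
  define g where "g \<omega> = even_powr s (t * (\<omega> \<bullet> e)) * \<bar>\<omega> \<bullet> l\<bar> powr q" for \<omega>
  define p where "p N \<omega> = (\<Sum>j<N. c j * ((\<omega> \<bullet> e) ^ (2 * j) * \<bar>\<omega> \<bullet> l\<bar> powr q))" for N \<omega>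
  have gm: "g \<in> borel_measurable ?S" unfolding g_def by (intro bm) measurable
  have pm: "p N \<in> borel_measurable ?S" for N unfolding p_def by (intro bm) measurable
  have p_alt: "p N \<omega> = (\<Sum>j<N. (s gchoose (2 * j)) * (t * (\<omega> \<bullet> e)) ^ (2 * j)) * \<bar>\<omega> \<bullet> l\<bar> powr q" for N \<omega>
    unfolding p_def c_def sum_distrib_right by (intro sum.cong refl) (simp add: power_mult_distrib)
  have small: "\<bar>t * (\<omega> \<bullet> e)\<bar> < 1" if "\<bar>\<omega> \<bullet> e\<bar> < 1" for \<omega>
    using that t mult_left_le_one_le[of "\<bar>\<omega> \<bullet> e\<bar>" t] by (simp add: abs_mult) 
  have lim: "AE \<omega> in ?S. (\<lambda>N. p N \<omega>) \<longlonglongrightarrow> g \<omega>"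
    using AE_sphere_inner_less_one[OF e dim]
  proof eventually_elim
    case (elim \<omega>)
    show ?case unfolding p_alt g_def
      by (intro tendsto_mult_right) (use even_powr_sums[OF small[OF elim]] in \<open>simp add: sums_def\<close>)
  qed
  have bound: "AE \<omega> in ?S. norm (p N \<omega>) \<le> 1" for N
    using AE_sphere_inner_less_one[OF e dim] AE_space
  proof eventually_elim
    case (elim \<omega>)
    have "norm (p N \<omega>) \<le> 1 * 1" unfolding p_alt real_norm_def abs_mult
      by (intro mult_mono even_powr_partial_sum_bound s small) (use elim le1 in \<open>auto simp: space_sphere_measure\<close>)
    then show ?case by simp
  qed
  have int_p: "integral\<^sup>L ?S (p N) = (\<Sum>j<N. c j * m j)" for N
    unfolding p_def using moment
    by (subst Bochner_Integration.integral_sum) (auto dest: has_bochner_integral_integral_eq intro: has_bochner_integral.intros simp: has_bochner_integral_iff)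
  have "(\<lambda>N. integral\<^sup>L ?S (p N)) \<longlonglongrightarrow> integral\<^sup>L ?S g" and ig: "integrable ?S g"
    using integral_dominated_convergence[OF gm pm _ lim bound]
      integrable_dominated_convergence[OF gm pm _ lim bound] by auto
  then have sums: "(\<lambda>j. c j * m j) sums integral\<^sup>L ?S g"
    unfolding sums_def int_p by simp
  have K: "K > 0" unfolding K_def using q n by (auto intro!: divide_pos_pos mult_pos_pos Gamma_real_pos)
  \<comment> \<open>The symbol \<open>pochhammer (1 / 2) j\<close> of the moment cancels the one in
    the denominator of the binomial coefficient.\<close>
  have "c j * m j / K = pochhammer (- s / 2) j * pochhammer ((1 - s) / 2) j / (fact j * pochhammer ((q + n) / 2) j) * (t\<^sup>2) ^ j" for j
  proof -
    have "pochhammer (1 / 2 :: real) j > 0" by (rule pochhammer_pos) simp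
    then show ?thesis unfolding c_def m_def gbinomial_even_pochhammer using K
      by (simp add: power_mult)
  qed
  then have hyp: "hypergeo_2F1 (- s / 2) ((1 - s) / 2) ((q + n) / 2) (t\<^sup>2) = integral\<^sup>L ?S g / K"
    unfolding hypergeo_2F1_def using sums_unique[OF sums_divide[OF sums, of K]] by simp
  have "integral\<^sup>L ?S g = K * hypergeo_2F1 (- s / 2) ((1 - s) / 2) ((q + n) / 2) (t\<^sup>2)"
    unfolding hyp using K by simp
  moreover have "(\<integral>\<^sup>+\<omega>. ennreal (g \<omega>) \<partial>?S) = ennreal (integral\<^sup>L ?S g)"
    using ig by (rule nn_integral_eq_integral) (simp add: g_def even_powr_nonneg)
  ultimately show "even_direction_integral s q t e l =
    ennreal (Gamma (n / 2) * Gamma ((q + 1) / 2) / (sqrt pi * Gamma ((q + n) / 2)) *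
      hypergeo_2F1 (- s / 2) ((1 - s) / 2) ((q + n) / 2) (t\<^sup>2))"
    unfolding g_def K_def by simp
  have "0 \<le> integral\<^sup>L ?S g" by (rule integral_nonneg_AE) (simp add: g_def even_powr_nonneg)
  then show "0 \<le> hypergeo_2F1 (- s / 2) ((1 - s) / 2) ((q + n) / 2) (t\<^sup>2)"
    unfolding hyp using K by simp
qed

lemma nn_integral_even_powr_reflect:
  fixes e l v :: "'a::euclidean_space"
  shows "(\<integral>\<^sup>+\<omega>. ennreal (even_powr s (t * (\<omega> \<bullet> hyperplane_reflection v e)) * \<bar>\<omega> \<bullet> hyperplane_reflection v l\<bar> powr q) \<partial>sphere_measure)
    = even_direction_integral s q t e l"
  using nn_integral_sphere_reflection[of "\<lambda>\<omega>. ennreal (even_powr s (t * (\<omega> \<bullet> e)) * \<bar>\<omega> \<bullet> l\<bar> powr q)" v]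
  by (simp add: hyperplane_reflection_adjoint)

text \<open>The reflection exchanging \<open>l\<close> and the transversal direction \<open>e'\<close> exchanges the
  order of \<open>(\<omega> \<bullet> l)\<^sup>2\<close> and \<open>(\<omega> \<bullet> e')\<^sup>2\<close> against that of the corresponding values of
  \<open>(\<omega> \<bullet> e)\<^sup>2\<close>, so the inequality is a pointwise rearrangement.\<close>

lemma nn_integral_even_powr_le_transversal:
  fixes e l :: "'a::euclidean_space"
  assumes e: "norm e = 1" and l: "norm l = 1" and dim: "DIM('a) \<ge> 2"
    and s: "0 < s" "s < 1" and q: "q > 0" and t: "0 \<le> t" "t \<le> 1"
  obtains e' :: 'a where "norm e' = 1" "e \<bullet> e' = 0"
    "even_direction_integral s q t e l \<le>
     even_direction_integral s q t e e'"
proof -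
  define W where "W a b = even_direction_integral s q t a b" for a b :: 'a
  \<comment> \<open>\<open>e'\<close> is the direction of the part of \<open>l\<close> orthogonal to
    \<open>e\<close>; if that part vanishes, any orthogonal direction serves, with
    \<open>b = 0\<close>.\<close>
  obtain e' a b where e': "norm e' = 1" "e \<bullet> e' = 0" and l_eq: "l = a *\<^sub>R e + b *\<^sub>R e'"
  proof (cases "l = (l \<bullet> e) *\<^sub>R e")
    case True
    obtain z :: 'a where z: "z \<noteq> 0" "orthogonal e z"
      using orthogonal_to_vector_exists[OF dim, of e] by metis
    show ?thesis using True z that[of "z /\<^sub>R norm z" "l \<bullet> e" 0] by (simp add: orthogonal_def)
  next
    case False
    define z where "z = l - (l \<bullet> e) *\<^sub>R e"
    have z: "z \<noteq> 0" "e \<bullet> z = 0" using False e by (auto simp: z_def inner_diff_right inner_commute norm_eq_1)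
    show ?thesis using z that[of "z /\<^sub>R norm z" "l \<bullet> e" "norm z"] by (simp add: z_def)
  qed
  have ee: "e \<bullet> e = 1" "e' \<bullet> e' = 1" "e' \<bullet> e = 0" using e e' by (auto simp: norm_eq_1 inner_commute)
  have ab: "a\<^sup>2 + b\<^sup>2 = 1"
    using l unfolding norm_eq_1 l_eq by (simp add: inner_add_left inner_add_right ee e' power2_eq_square)
  have "W e l \<le> W e e'"
  proof (cases "b = 1")
    case True
    then show ?thesis using ab l_eq by simp
  next
    case False
    define R where "R = hyperplane_reflection (l - e')"
    have Rl: "R l = e'" "R e' = l"
      unfolding R_def by (simp_all add: hyperplane_reflection_swap l e')
    \<comment> \<open>The image of \<open>e\<close> under the reflection that exchanges
      \<open>l\<close> and \<open>e'\<close>; being orthogonal to \<open>l\<close>, it completes a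
      second orthonormal basis of the plane.\<close>
    define f where "f = - b *\<^sub>R e + a *\<^sub>R e'"
    have Re: "R e = f"
    proof -
      have v: "l - e' = a *\<^sub>R e + (b - 1) *\<^sub>R e'" by (simp add: l_eq algebra_simps)
      have "(l - e') \<bullet> (l - e') = a\<^sup>2 + (b - 1)\<^sup>2"
        unfolding v by (simp add: inner_add_left inner_add_right ee e' power2_eq_square)
      also have "\<dots> = 2 * (1 - b)" using ab by (simp add: power2_eq_square algebra_simps)
      finally have vv: "(l - e') \<bullet> (l - e') = 2 * (1 - b)" .
      have ev: "e \<bullet> (l - e') = a" unfolding v by (simp add: inner_add_right ee e')
      have "2 * a / (2 * (1 - b)) = a / (1 - b)" by (rule mult_divide_mult_cancel_left) simp
      then have "R e = e - (a / (1 - b)) *\<^sub>R (a *\<^sub>R e + (b - 1) *\<^sub>R e')"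
        unfolding R_def hyperplane_reflection_def vv ev by (simp only: v)
      also have "\<dots> = (1 - a\<^sup>2 / (1 - b)) *\<^sub>R e - (a * (b - 1) / (1 - b)) *\<^sub>R e'"
        unfolding scaleR_left_diff_distrib[of 1 "a\<^sup>2 / (1 - b)" e]
        by (simp only: scaleR_right_distrib scaleR_scaleR power2_eq_square times_divide_eq_left scaleR_one diff_diff_eq)
      also have "a\<^sup>2 / (1 - b) = 1 + b" using ab False by (simp add: field_simps power2_eq_square)
      also have "a * (b - 1) / (1 - b) = - a" using False by (simp add: field_simps)
      finally show ?thesis by (simp add: f_def)
    qed
    have WR: "W (R x) (R y) = W x y" for x y
      unfolding W_def R_def by (rule nn_integral_even_powr_reflect)
    have W1: "W f e' = W e l" using WR[of e l] by (simp add: Re Rl)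
    have W2: "W f l = W e e'" using WR[of e e'] by (simp add: Re Rl)
    define A where "A x y \<omega> = even_powr s (t * (\<omega> \<bullet> x)) * \<bar>\<omega> \<bullet> y\<bar> powr q" for x y \<omega> :: 'a
    have A0: "A x y \<omega> \<ge> 0" for x y \<omega> by (simp add: A_def even_powr_nonneg)
    \<comment> \<open>Each integral equals its reflected copy, and averaging the two makes a
      pointwise comparison possible.\<close>
    have half: "(\<integral>\<^sup>+\<omega>. ennreal ((A x y \<omega> + A x' y' \<omega>) / 2) \<partial>sphere_measure) = W x y" if "W x' y' = W x y" for x y x' y'
    proof -
      have "(\<integral>\<^sup>+\<omega>. ennreal ((A x y \<omega> + A x' y' \<omega>) / 2) \<partial>sphere_measure) =
          (\<integral>\<^sup>+\<omega>. ennreal (1 / 2) * ennreal (A x y \<omega>) + ennreal (1 / 2) * ennreal (A x' y' \<omega>) \<partial>sphere_measure)"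
        using A0 by (simp only: ennreal_average)
      also have "\<dots> = ennreal (1 / 2) * W x y + ennreal (1 / 2) * W x' y'"
        unfolding W_def A_def by (simp add: nn_integral_add nn_integral_cmult borel_measurable_sphere_measure)
      also have "\<dots> = W x y" unfolding that by (rule ennreal_half_add_half)
      finally show ?thesis .
    qed
    have "W e l = (\<integral>\<^sup>+\<omega>. ennreal ((A e l \<omega> + A f e' \<omega>) / 2) \<partial>sphere_measure)"
      using half[OF W1] by simp
    also have "\<dots> \<le> (\<integral>\<^sup>+\<omega>. ennreal ((A e e' \<omega> + A f l \<omega>) / 2) \<partial>sphere_measure)"
    proof (intro nn_integral_mono ennreal_leI divide_right_mono)
      fix \<omega> :: 'a assume "\<omega> \<in> space sphere_measure"
      then have w: "norm \<omega> = 1" by (simp add: space_sphere_measure)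
      define X Y where "X = \<omega> \<bullet> e" and "Y = \<omega> \<bullet> e'"
      have wl: "\<omega> \<bullet> l = a * X + b * Y" and wf: "\<omega> \<bullet> f = - b * X + a * Y"
        by (simp_all add: l_eq f_def X_def Y_def inner_add_right inner_diff_right)
      \<comment> \<open>Both \<open>e, e'\<close> and \<open>l, f\<close> are orthonormal bases of
        one plane, so the squared components of \<omega> have equal sums.\<close>
      have "X\<^sup>2 - (- b * X + a * Y)\<^sup>2 = X\<^sup>2 * (1 - b\<^sup>2) + 2 * a * b * X * Y - a\<^sup>2 * Y\<^sup>2"
        by (simp add: power2_eq_square algebra_simps)
      also have "\<dots> = X\<^sup>2 * a\<^sup>2 + 2 * a * b * X * Y - (1 - b\<^sup>2) * Y\<^sup>2"
      proof -
        have "1 - b\<^sup>2 = a\<^sup>2" using ab by simp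
        then show ?thesis by (simp only:)
      qed
      also have "\<dots> = (a * X + b * Y)\<^sup>2 - Y\<^sup>2" by (simp add: power2_eq_square algebra_simps)
      finally have id: "(\<omega> \<bullet> e)\<^sup>2 - (\<omega> \<bullet> f)\<^sup>2 = (\<omega> \<bullet> l)\<^sup>2 - (\<omega> \<bullet> e')\<^sup>2"
        unfolding wl wf X_def Y_def .
      have f1: "norm f = 1" using e unfolding Re[symmetric] R_def by (simp add: norm_hyperplane_reflection)
      have mono: "even_powr s (t * (\<omega> \<bullet> x)) \<le> even_powr s (t * (\<omega> \<bullet> y))" if "(\<omega> \<bullet> y)\<^sup>2 \<le> (\<omega> \<bullet> x)\<^sup>2" "norm x = 1" for x y
      proof (rule even_powr_antimono[OF s])
        show "\<bar>t * (\<omega> \<bullet> y)\<bar> \<le> \<bar>t * (\<omega> \<bullet> x)\<bar>"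
          using that t by (auto simp: abs_mult abs_le_square_iff intro!: mult_left_mono)
        show "\<bar>t * (\<omega> \<bullet> x)\<bar> \<le> 1"
          using inner_unit_le[OF w that(2)] t by (auto simp: abs_mult intro!: mult_le_one)
      qed
      \<comment> \<open>By the identity of squares and monotonicity the two factors have opposite
        signs; multiplying out gives the comparison of the integrands.\<close>
      have "(even_powr s (t * (\<omega> \<bullet> e)) - even_powr s (t * (\<omega> \<bullet> f))) * (\<bar>\<omega> \<bullet> l\<bar> powr q - \<bar>\<omega> \<bullet> e'\<bar> powr q) \<le> 0"
      proof (cases "(\<omega> \<bullet> e')\<^sup>2 \<le> (\<omega> \<bullet> l)\<^sup>2")
        case True
        then have "\<bar>\<omega> \<bullet> e'\<bar> powr q \<le> \<bar>\<omega> \<bullet> l\<bar> powr q"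
          using q by (intro powr_mono2) (auto simp: abs_le_square_iff)
        moreover have "(\<omega> \<bullet> f)\<^sup>2 \<le> (\<omega> \<bullet> e)\<^sup>2" using True id by linarith
        ultimately show ?thesis using mono[of f e] e by (intro mult_nonpos_nonneg) auto
      next
        case False
        then have "\<bar>\<omega> \<bullet> l\<bar> powr q \<le> \<bar>\<omega> \<bullet> e'\<bar> powr q"
          using q by (intro powr_mono2) (auto simp: abs_le_square_iff)
        moreover have "(\<omega> \<bullet> e)\<^sup>2 \<le> (\<omega> \<bullet> f)\<^sup>2" using False id by linarith
        ultimately show ?thesis using mono[of e f] f1 by (intro mult_nonneg_nonpos) auto
      qed
      then show "A e l \<omega> + A f e' \<omega> \<le> A e e' \<omega> + A f l \<omega>"
        unfolding A_def by (simp add: algebra_simps)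
    qed simp
    also have "\<dots> = W e e'" using half[OF W2] by simp
    finally show ?thesis .
  qed
  then show ?thesis using that[OF e'] by (simp add: W_def)
qed

text \<open>The map \<open>\<omega> -> - \<omega>\<close> preserves the measure and the weight
  \<open>\<bar>\<omega> \<bullet> l\<bar>\<close>, and turns \<open>t\<close> into
  \<open>- t\<close>; averaging the two integrals leaves the even part.\<close>

lemma nn_integral_sphere_symmetrize:
  fixes e l :: "'a::euclidean_space"
  shows "direction_integral s q t e l =
     even_direction_integral s q t e l"
proof -
  define A where "A t \<omega> = ennreal ((1 + t * (\<omega> \<bullet> e)) powr s * \<bar>\<omega> \<bullet> l\<bar> powr q)" for t and \<omega> :: 'a
  have [measurable]: "A t \<in> borel_measurable borel" for t unfolding A_def by measurable
  have "(\<integral>\<^sup>+\<omega>. A t (- \<omega>) \<partial>sphere_measure) = (\<integral>\<^sup>+\<omega>. A t \<omega> \<partial>sphere_measure)"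
    by (rule nn_integral_sphere_isometry) (auto intro!: linearI surjI[of _ uminus])
  moreover have "A t (- \<omega>) = A (- t) \<omega>" for \<omega> by (simp add: A_def)
  ultimately have neg: "(\<integral>\<^sup>+\<omega>. A (- t) \<omega> \<partial>sphere_measure) = (\<integral>\<^sup>+\<omega>. A t \<omega> \<partial>sphere_measure)" by simp
  have "even_direction_integral s q t e l =
     (\<integral>\<^sup>+\<omega>. ennreal (1 / 2) * A t \<omega> + ennreal (1 / 2) * A (- t) \<omega> \<partial>sphere_measure)"
  proof (rule nn_integral_cong)
    fix \<omega> :: 'a
    have "even_powr s (t * (\<omega> \<bullet> e)) * \<bar>\<omega> \<bullet> l\<bar> powr q =
      ((1 + t * (\<omega> \<bullet> e)) powr s * \<bar>\<omega> \<bullet> l\<bar> powr q + (1 + - t * (\<omega> \<bullet> e)) powr s * \<bar>\<omega> \<bullet> l\<bar> powr q) / 2"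
      by (simp add: even_powr_def distrib_right)
    then show "ennreal (even_powr s (t * (\<omega> \<bullet> e)) * \<bar>\<omega> \<bullet> l\<bar> powr q) =
        ennreal (1 / 2) * A t \<omega> + ennreal (1 / 2) * A (- t) \<omega>"
      unfolding A_def by (simp only: ennreal_average mult_nonneg_nonneg powr_ge_zero)
  qed
  also have "\<dots> = ennreal (1 / 2) * (\<integral>\<^sup>+\<omega>. A t \<omega> \<partial>sphere_measure) + ennreal (1 / 2) * (\<integral>\<^sup>+\<omega>. A (- t) \<omega> \<partial>sphere_measure)"
    by (simp add: nn_integral_add nn_integral_cmult borel_measurable_sphere_measure)
  also have "\<dots> = (\<integral>\<^sup>+\<omega>. A t \<omega> \<partial>sphere_measure)"
    unfolding neg by (rule ennreal_half_add_half)
  finally show ?thesis unfolding A_def by simp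
qed

text \<open>The value \<open>V\<close> is the same for every direction orthogonal to
  \<open>e\<close>, so the direction that dominates a given \<open>l\<close> may vary with
  \<open>l\<close> while the bound does not.\<close>

lemma nn_integral_sphere_maximal_direction:
  fixes e :: "'a::euclidean_space"
  assumes e: "norm e = 1" and dim: "DIM('a) \<ge> 2"
    and s: "0 < s" "s < 1" and q: "q > 0" and t: "0 \<le> t" "t \<le> 1"
  defines "V \<equiv> Gamma (real DIM('a) / 2) * Gamma ((q + 1) / 2) / (sqrt pi * Gamma ((q + real DIM('a)) / 2)) *
      hypergeo_2F1 (- s / 2) ((1 - s) / 2) ((q + real DIM('a)) / 2) (t\<^sup>2)"
  shows "norm l = 1 \<Longrightarrow>
      direction_integral s q t e l \<le> ennreal V"
    and "\<exists>l. norm l = 1 \<and>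
      direction_integral s q t e l = ennreal V"
    and "0 \<le> hypergeo_2F1 (- s / 2) ((1 - s) / 2) ((q + real DIM('a)) / 2) (t\<^sup>2)"
proof -
  obtain z where z: "z \<noteq> 0" "orthogonal e z"
    using orthogonal_to_vector_exists[OF dim, of e] by metis
  define l0 where "l0 = z /\<^sub>R norm z"
  have l0: "norm l0 = 1" "e \<bullet> l0 = 0" using z by (auto simp: l0_def orthogonal_def)
  show "\<exists>l. norm l = 1 \<and>
      direction_integral s q t e l = ennreal V"
    using nn_integral_even_powr_transversal(1)[OF e l0 dim s q t] l0
    unfolding V_def nn_integral_sphere_symmetrize by blast
  show "0 \<le> hypergeo_2F1 (- s / 2) ((1 - s) / 2) ((q + real DIM('a)) / 2) (t\<^sup>2)"
    by (rule nn_integral_even_powr_transversal(2)[OF e l0 dim s q t])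
  assume l: "norm l = 1"
  obtain e' where e': "norm e' = 1" "e \<bullet> e' = 0"
    "even_direction_integral s q t e l \<le>
     even_direction_integral s q t e e'"
    by (rule nn_integral_even_powr_le_transversal[OF e l dim s q t])
  then show "direction_integral s q t e l \<le> ennreal V"
    unfolding nn_integral_sphere_symmetrize V_def
    using nn_integral_even_powr_transversal(1)[OF e e'(1,2) dim s q t] by simp
qed

subsection \<open>Sharp gradient estimates for integral operators\<close>

lemma GDERIV_imp_lipschitz:
  fixes f :: "'a::euclidean_space \<Rightarrow> real"
  assumes "\<And>z. z \<in> ball x d \<Longrightarrow> GDERIV f z :> G z" "\<And>z. z \<in> ball x d \<Longrightarrow> norm (G z) \<le> B"
    and z: "z \<in> ball x d"
  shows "\<bar>f z - f x\<bar> \<le> B * norm (z - x)"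
proof -
  have "d > 0" using z by (metis ball_eq_empty empty_iff not_le)
  have "norm (f z - f x) \<le> B * norm (z - x)"
  proof (rule differentiable_bound[where f'="\<lambda>z h. h \<bullet> G z"])
    fix w assume w: "w \<in> ball x d"
    show "(f has_derivative (\<lambda>h. h \<bullet> G w)) (at w within ball x d)"
      using assms(1)[OF w] unfolding gderiv_def by (rule has_derivative_at_withinI)
    show "onorm (\<lambda>h. h \<bullet> G w) \<le> B"
    proof (rule onorm_le)
      fix h
      have "norm (h \<bullet> G w) \<le> norm h * norm (G w)" by (simp add: Cauchy_Schwarz_ineq2)
      also have "\<dots> \<le> norm h * B" by (intro mult_left_mono assms(2) w) simp
      finally show "norm (h \<bullet> G w) \<le> B * norm h" by (simp add: mult.commute)
    qed
  qed (use z \<open>d > 0\<close> in auto)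
  then show ?thesis by simp
qed

text \<open>The bound \<open>B\<close> makes \<open>K z y\<close> Lipschitz in \<open>z\<close>.
  This extends integrability from the point \<open>x\<close> to nearby \<open>z\<close>, and bounds
  the error quotient by \<open>2 * (B y * \<bar>\<phi> y\<bar>)\<close>. Dominated convergence along
  arbitrary sequences then gives a full derivative, not only directional ones.\<close>

lemma has_gradient_integral:
  fixes K :: "'a::euclidean_space \<Rightarrow> 'b \<Rightarrow> real" and G :: "'a \<Rightarrow> 'b \<Rightarrow> 'a"
  assumes d: "d > 0"
    and der: "\<And>z y. z \<in> ball x d \<Longrightarrow> y \<in> space M \<Longrightarrow> GDERIV (\<lambda>z. K z y) z :> G z y"
    and bound: "\<And>z y. z \<in> ball x d \<Longrightarrow> y \<in> space M \<Longrightarrow> norm (G z y) \<le> B y"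
    and K_meas: "\<And>z. K z \<in> borel_measurable M" and G_meas[measurable]: "G x \<in> borel_measurable M"
    and \<phi>_meas[measurable]: "\<phi> \<in> borel_measurable M"
    and int_K: "integrable M (\<lambda>y. K x y * \<phi> y)"
    and int_B: "integrable M (\<lambda>y. B y * \<bar>\<phi> y\<bar>)"
  shows "integrable M (\<lambda>y. \<phi> y *\<^sub>R G x y)"
    and "GDERIV (\<lambda>z. \<integral>y. K z y * \<phi> y \<partial>M) x :> (\<integral>y. \<phi> y *\<^sub>R G x y \<partial>M)"
proof -
  note K_meas[measurable]
  have xb: "x \<in> ball x d" using d by simp
  have B0: "0 \<le> B y" if "y \<in> space M" for y
    using bound[OF xb that] norm_ge_zero order_trans by blast
  have lip: "\<bar>K z y - K x y\<bar> \<le> B y * norm (z - x)" if "z \<in> ball x d" "y \<in> space M" for z y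
    using that by (intro GDERIV_imp_lipschitz[where G="\<lambda>z. G z y"] der bound)
  show int_G: "integrable M (\<lambda>y. \<phi> y *\<^sub>R G x y)"
  proof (rule Bochner_Integration.integrable_bound[OF int_B])
    show "AE y in M. norm (\<phi> y *\<^sub>R G x y) \<le> norm (B y * \<bar>\<phi> y\<bar>)"
    proof (rule AE_I2)
      fix y assume y: "y \<in> space M"
      have "norm (G x y) * \<bar>\<phi> y\<bar> \<le> B y * \<bar>\<phi> y\<bar>" by (intro mult_right_mono bound xb y) simp
      then show "norm (\<phi> y *\<^sub>R G x y) \<le> norm (B y * \<bar>\<phi> y\<bar>)"
        using B0[OF y] by (simp add: abs_mult mult.commute)
    qed
  qed simp
  have int_Kz: "integrable M (\<lambda>y. K z y * \<phi> y)" if z: "z \<in> ball x d" for z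
  proof -
    have "integrable M (\<lambda>y. (K z y - K x y) * \<phi> y)"
    proof (rule Bochner_Integration.integrable_bound[OF integrable_mult_right[OF int_B, of "norm (z - x)"]])
      show "AE y in M. norm ((K z y - K x y) * \<phi> y) \<le> norm (norm (z - x) * (B y * \<bar>\<phi> y\<bar>))"
      proof (rule AE_I2)
        fix y assume y: "y \<in> space M"
        have "norm ((K z y - K x y) * \<phi> y) \<le> (B y * norm (z - x)) * \<bar>\<phi> y\<bar>"
          unfolding real_norm_def abs_mult by (intro mult_right_mono lip z y) simp
        then show "norm ((K z y - K x y) * \<phi> y) \<le> norm (norm (z - x) * (B y * \<bar>\<phi> y\<bar>))"
          using B0[OF y] by (simp add: abs_mult mult_ac)
      qed
    qed simp
    then have "integrable M (\<lambda>y. K x y * \<phi> y + (K z y - K x y) * \<phi> y)"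
      using int_K by (rule Bochner_Integration.integrable_add[rotated])
    then show ?thesis by (simp add: algebra_simps)
  qed
  define u where "u z = (\<integral>y. K z y * \<phi> y \<partial>M)" for z
  define D where "D = (\<integral>y. \<phi> y *\<^sub>R G x y \<partial>M)"
  have hD: "h \<bullet> D = (\<integral>y. \<phi> y * (h \<bullet> G x y) \<partial>M)" for h
    unfolding D_def using integral_inner_right[OF int_G, of h] int_G by simp
  have "((\<lambda>h. norm (u (x + h) - u x - h \<bullet> D) / norm h) \<longlongrightarrow> 0) (at 0)"
    unfolding tendsto_at_iff_sequentially
  proof (intro allI impI)
    fix X :: "nat \<Rightarrow> 'a" assume X: "\<forall>i. X i \<in> UNIV - {0}" "X \<longlonglongrightarrow> 0"
    then obtain N where N: "\<And>i. i \<ge> N \<Longrightarrow> norm (X i) < d"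
      using LIMSEQ_D[OF X(2) d] by auto
    \<comment> \<open>Dropping the first \<open>N\<close> terms keeps \<open>x + Y i\<close> inside
      the ball where the bounds hold.\<close>
    define Y where "Y i = X (i + N)" for i
    have Y0: "Y \<longlonglongrightarrow> 0" unfolding Y_def using X(2) by (rule LIMSEQ_ignore_initial_segment)
    have Y: "Y i \<noteq> 0" "x + Y i \<in> ball x d" for i
      using X(1) N[of "i + N"] by (auto simp: Y_def dist_norm)
    define r where "r i y = (K (x + Y i) y - K x y - Y i \<bullet> G x y) / norm (Y i)" for i y
    have r_meas: "(\<lambda>y. r i y * \<phi> y) \<in> borel_measurable M" for i
      unfolding r_def by measurable
    have lim: "AE y in M. (\<lambda>i. r i y * \<phi> y) \<longlonglongrightarrow> 0"
    proof (rule AE_I2)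
      fix y assume y: "y \<in> space M"
      have "((\<lambda>h. norm (K (x + h) y - K x y - h \<bullet> G x y) / norm h) \<longlongrightarrow> 0) (at 0)"
        using der[OF xb y] unfolding gderiv_def has_derivative_at by simp
      then have "((\<lambda>h. norm (K (x + h) y - K x y - h \<bullet> G x y) / norm h) \<circ> Y) \<longlonglongrightarrow> 0"
        unfolding tendsto_at_iff_sequentially using Y Y0 by blast
      then have "(\<lambda>i. \<bar>r i y\<bar>) \<longlonglongrightarrow> 0" by (simp add: r_def o_def)
      then have "(\<lambda>i. r i y) \<longlonglongrightarrow> 0" by (rule tendsto_rabs_zero_cancel)
      then show "(\<lambda>i. r i y * \<phi> y) \<longlonglongrightarrow> 0" by (rule tendsto_mult_left_zero)
    qed
    have dom: "AE y in M. norm (r i y * \<phi> y) \<le> 2 * (B y * \<bar>\<phi> y\<bar>)" for i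
    proof (rule AE_I2)
      fix y assume y: "y \<in> space M"
      have "\<bar>K (x + Y i) y - K x y - Y i \<bullet> G x y\<bar> \<le> B y * norm (Y i) + norm (Y i) * norm (G x y)"
      proof -
        have "\<bar>K (x + Y i) y - K x y\<bar> \<le> B y * norm (Y i)" using lip[OF Y(2) y, of i] by simp
        then show ?thesis using Cauchy_Schwarz_ineq2[of "Y i" "G x y"] by linarith
      qed
      also have "\<dots> \<le> B y * norm (Y i) + norm (Y i) * B y"
        by (intro add_left_mono mult_left_mono bound xb y) simp
      finally have "\<bar>r i y\<bar> \<le> 2 * B y"
        using Y(1)[of i] by (simp add: r_def field_simps)
      then have "\<bar>r i y\<bar> * \<bar>\<phi> y\<bar> \<le> (2 * B y) * \<bar>\<phi> y\<bar>" by (rule mult_right_mono) simp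
      then show "norm (r i y * \<phi> y) \<le> 2 * (B y * \<bar>\<phi> y\<bar>)" by (simp add: abs_mult)
    qed
    have "(\<lambda>i. \<integral>y. r i y * \<phi> y \<partial>M) \<longlonglongrightarrow> (\<integral>y. 0 \<partial>M)"
      by (rule integral_dominated_convergence[OF _ r_meas _ lim dom]) (use int_B in auto)
    moreover have "(\<integral>y. r i y * \<phi> y \<partial>M) = (u (x + Y i) - u x - Y i \<bullet> D) / norm (Y i)" for i
    proof -
      have i1: "integrable M (\<lambda>y. \<phi> y * (Y i \<bullet> G x y))"
        using integrable_inner_right[OF int_G, of "Y i"] int_G by simp
      have "(\<integral>y. r i y * \<phi> y \<partial>M) = (\<integral>y. (K (x + Y i) y * \<phi> y - K x y * \<phi> y - \<phi> y * (Y i \<bullet> G x y)) / norm (Y i) \<partial>M)"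
        by (intro Bochner_Integration.integral_cong refl) (simp add: r_def field_simps)
      also have "\<dots> = (\<integral>y. (K (x + Y i) y * \<phi> y - K x y * \<phi> y - \<phi> y * (Y i \<bullet> G x y)) \<partial>M) / norm (Y i)"
        by simp
      also have "(\<integral>y. (K (x + Y i) y * \<phi> y - K x y * \<phi> y - \<phi> y * (Y i \<bullet> G x y)) \<partial>M) = u (x + Y i) - u x - Y i \<bullet> D"
        unfolding u_def hD using int_Kz[OF Y(2)] int_K i1 by simp
      finally show ?thesis .
    qed
    ultimately have "(\<lambda>i. (u (x + Y i) - u x - Y i \<bullet> D) / norm (Y i)) \<longlonglongrightarrow> 0" by simp
    then have "(\<lambda>i. norm (u (x + Y i) - u x - Y i \<bullet> D) / norm (Y i)) \<longlonglongrightarrow> 0"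
      using tendsto_rabs_zero by fastforce
    then have "(\<lambda>i. ((\<lambda>h. norm (u (x + h) - u x - h \<bullet> D) / norm h) \<circ> X) (i + N)) \<longlonglongrightarrow> 0"
      by (simp add: o_def Y_def)
    then show "((\<lambda>h. norm (u (x + h) - u x - h \<bullet> D) / norm h) \<circ> X) \<longlonglongrightarrow> 0"
      by (rule LIMSEQ_offset)
  qed
  then have "GDERIV u x :> D"
    unfolding gderiv_def has_derivative_at by (simp add: bounded_linear_inner_left)
  then show "GDERIV (\<lambda>z. \<integral>y. K z y * \<phi> y \<partial>M) x :> (\<integral>y. \<phi> y *\<^sub>R G x y \<partial>M)"
    unfolding u_def D_def .
qed

section \<open>Hoelder's inequality and duality\<close>

lemma Hoelder_inequality:
  fixes f g :: "'a \<Rightarrow> real"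
  assumes p: "p > 1" "q > 1" "1 / p + 1 / q = 1"
    and [measurable]: "f \<in> borel_measurable M" "g \<in> borel_measurable M"
    and f: "integrable M (\<lambda>x. \<bar>f x\<bar> powr p)" and g: "integrable M (\<lambda>x. \<bar>g x\<bar> powr q)"
  shows "integrable M (\<lambda>x. f x * g x)"
    and "\<bar>\<integral>x. f x * g x \<partial>M\<bar> \<le> (\<integral>x. \<bar>f x\<bar> powr p \<partial>M) powr (1 / p) * (\<integral>x. \<bar>g x\<bar> powr q \<partial>M) powr (1 / q)"
proof -
  have young: "\<bar>a * b\<bar> \<le> \<bar>a\<bar> powr p / p + \<bar>b\<bar> powr q / q" for a b :: real
    using Youngs_inequality[of p q "\<bar>a\<bar>" "\<bar>b\<bar>"] p by (simp add: abs_mult)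
  show int: "integrable M (\<lambda>x. f x * g x)"
  proof (rule Bochner_Integration.integrable_bound)
    show "integrable M (\<lambda>x. \<bar>f x\<bar> powr p / p + \<bar>g x\<bar> powr q / q)" using f g by simp
    show "AE x in M. norm (f x * g x) \<le> norm (\<bar>f x\<bar> powr p / p + \<bar>g x\<bar> powr q / q)"
      using young p by (intro AE_I2) (auto intro: order_trans[OF _ abs_ge_self])
  qed simp
  define F where "F = (\<integral>x. \<bar>f x\<bar> powr p \<partial>M)"
  define H where "H = (\<integral>x. \<bar>g x\<bar> powr q \<partial>M)"
  have FH: "F \<ge> 0" "H \<ge> 0" by (auto simp: F_def H_def)
  have zero: "(\<integral>x. f x * g x \<partial>M) = 0" if "F = 0 \<or> H = 0"
  proof -
    have "AE x in M. f x * g x = 0"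
      using that
    proof
      assume "F = 0"
      then have "AE x in M. \<bar>f x\<bar> powr p = 0"
        unfolding F_def using f by (subst (asm) integral_nonneg_eq_0_iff_AE) auto
      then show ?thesis by eventually_elim simp
    next
      assume "H = 0"
      then have "AE x in M. \<bar>g x\<bar> powr q = 0"
        unfolding H_def using g by (subst (asm) integral_nonneg_eq_0_iff_AE) auto
      then show ?thesis by eventually_elim simp
    qed
    then show ?thesis by (rule integral_eq_zero_AE)
  qed
  show "\<bar>\<integral>x. f x * g x \<partial>M\<bar> \<le> (\<integral>x. \<bar>f x\<bar> powr p \<partial>M) powr (1 / p) * (\<integral>x. \<bar>g x\<bar> powr q \<partial>M) powr (1 / q)"
  proof (cases "F = 0 \<or> H = 0")
    case True
    then show ?thesis by (simp add: zero)
  next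
    case False
    then have pos: "F > 0" "H > 0" using FH by auto
    define c where "c = F powr (1 / p) * H powr (1 / q)"
    have c: "c > 0" using pos by (simp add: c_def)
    have "\<bar>f x * g x\<bar> / c \<le> \<bar>f x\<bar> powr p / F / p + \<bar>g x\<bar> powr q / H / q" for x
      using young[of "f x / F powr (1 / p)" "g x / H powr (1 / q)"] pos p
      by (simp add: c_def abs_mult powr_divide powr_powr)
    then have "(\<integral>x. \<bar>f x * g x\<bar> / c \<partial>M) \<le> (\<integral>x. \<bar>f x\<bar> powr p / F / p + \<bar>g x\<bar> powr q / H / q \<partial>M)"
      using int f g by (intro integral_mono) auto
    also have "\<dots> = F / F / p + H / H / q"
      using f g by (simp add: F_def H_def)
    also have "\<dots> = 1" using pos p by simp
    finally have "(\<integral>x. \<bar>f x * g x\<bar> \<partial>M) \<le> c" using c by (simp add: field_simps)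
    with integral_abs_bound[of M "\<lambda>x. f x * g x"] have "\<bar>\<integral>x. f x * g x \<partial>M\<bar> \<le> c" by (rule order_trans)
    then show ?thesis by (simp only: c_def F_def H_def)
  qed
qed

lemma gradient_eqI: "GDERIV f x :> D \<Longrightarrow> gradient f x = D"
  unfolding gradient_def
proof (rule the_equality)
  fix E assume D: "GDERIV f x :> D" and "GDERIV f x :> E"
  then have "(\<lambda>h. h \<bullet> E) = (\<lambda>h. h \<bullet> D)"
    unfolding gderiv_def by (metis has_derivative_unique)
  then have "(E - D) \<bullet> E = (E - D) \<bullet> D" by meson
  then have "(E - D) \<bullet> (E - D) = 0" by (simp only: inner_diff_right)
  then show "E = D" by simp
qed

text \<open>The norm of \<open>\<integral>\<phi> G\<close> is its component in its own direction, so the estimate is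
  Hoelder's inequality for the components of \<open>G\<close>; equality is attained for
  \<open>\<phi> = sgn k * \<bar>k\<bar> powr (q - 1)\<close> with \<open>k = G \<bullet> e\<close>.\<close>

lemma sharp_gradient_estimateI:
  fixes G :: "'b \<Rightarrow> 'a::euclidean_space" and J :: real
  assumes p: "p > 1" "q > 1" "1 / p + 1 / q = 1"
    and G_meas[measurable]: "G \<in> borel_measurable M"
    and int: "\<And>\<phi>. \<phi> \<in> Lp_space p M \<Longrightarrow> integrable M (\<lambda>y. \<phi> y *\<^sub>R G y)"
    and grad: "\<And>\<phi>. \<phi> \<in> Lp_space p M \<Longrightarrow> GDERIV (P \<phi>) x :> (\<integral>y. \<phi> y *\<^sub>R G y \<partial>M)"
    and upper: "\<And>l. norm l = 1 \<Longrightarrow> (\<integral>\<^sup>+y. ennreal (\<bar>G y \<bullet> l\<bar> powr q) \<partial>M) \<le> ennreal J"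
    and attained: "norm e = 1" "(\<integral>\<^sup>+y. ennreal (\<bar>G y \<bullet> e\<bar> powr q) \<partial>M) = ennreal J" and J: "J \<ge> 0"
    and nontrivial: "\<psi> \<in> Lp_space p M" "Lp_norm p M \<psi> > 0"
  shows "sharp_gradient_estimate P p M x (J powr (1 / q))"
proof -
  \<comment> \<open>The relation \<open>p * (q - 1) = q\<close> makes
    \<open>\<bar>\<phi>\<bar> powr p\<close> equal to \<open>\<bar>k\<bar> powr q\<close> for the
    extremal function.\<close>
  have pq: "p * (q - 1) = q" "q - 1 > 0"
    using p by (auto simp: field_simps)
  have comp: "integrable M (\<lambda>y. \<bar>G y \<bullet> l\<bar> powr q)" "(\<integral>y. \<bar>G y \<bullet> l\<bar> powr q \<partial>M) \<le> J" if "norm l = 1" for l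
  proof -
    have fin: "(\<integral>\<^sup>+y. ennreal (\<bar>G y \<bullet> l\<bar> powr q) \<partial>M) < \<infinity>"
      using upper[OF that] by (rule le_less_trans) simp
    then show i: "integrable M (\<lambda>y. \<bar>G y \<bullet> l\<bar> powr q)"
      by (intro integrableI_nonneg) auto
    show "(\<integral>y. \<bar>G y \<bullet> l\<bar> powr q \<partial>M) \<le> J"
      using upper[OF that] J by (subst (asm) nn_integral_eq_integral[OF i]) auto
  qed
  have est: "norm (\<integral>y. \<phi> y *\<^sub>R G y \<partial>M) \<le> J powr (1 / q) * Lp_norm p M \<phi>" if \<phi>: "\<phi> \<in> Lp_space p M" for \<phi>
  proof (cases "(\<integral>y. \<phi> y *\<^sub>R G y \<partial>M) = 0")
    case True
    then show ?thesis by (simp add: Lp_norm_def)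
  next
    case False
    define D where "D = (\<integral>y. \<phi> y *\<^sub>R G y \<partial>M)"
    define l where "l = D /\<^sub>R norm D"
    have l: "norm l = 1" using False by (simp add: l_def D_def)
    have [measurable]: "\<phi> \<in> borel_measurable M" and \<phi>i: "integrable M (\<lambda>x. \<bar>\<phi> x\<bar> powr p)"
      using \<phi> by (auto simp: Lp_space_def)
    have "norm D = D \<bullet> l"
      using False by (simp add: l_def D_def power2_norm_eq_inner[symmetric] power2_eq_square)
    also have "\<dots> = (\<integral>y. \<phi> y * (G y \<bullet> l) \<partial>M)"
      unfolding D_def using integral_inner_left[OF int[OF \<phi>], of l] int[OF \<phi>] by simp
    also have "\<dots> \<le> Lp_norm p M \<phi> * (\<integral>y. \<bar>G y \<bullet> l\<bar> powr q \<partial>M) powr (1 / q)"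
      unfolding Lp_norm_def
      by (rule order_trans[OF abs_ge_self Hoelder_inequality(2)[OF p _ _ \<phi>i comp(1)[OF l]]]) auto
    also have "\<dots> \<le> Lp_norm p M \<phi> * J powr (1 / q)"
      using comp(2)[OF l] p by (intro mult_left_mono powr_mono2) (auto simp: Lp_norm_def)
    finally show ?thesis by (simp add: D_def mult.commute)
  qed
  have sharp: "J powr (1 / q) \<le> C"
    if C: "\<And>\<phi>. \<phi> \<in> Lp_space p M \<Longrightarrow> norm (\<integral>y. \<phi> y *\<^sub>R G y \<partial>M) \<le> C * Lp_norm p M \<phi>" for C
  proof (cases "J = 0")
    case True
    \<comment> \<open>For \<open>J = 0\<close> the claim is \<open>0 \<le> C\<close>, and any
      function of positive norm detects the sign of \<open>C\<close>.\<close>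
    have "0 \<le> C * Lp_norm p M \<psi>" using C[OF nontrivial(1)] norm_ge_zero order_trans by blast
    then have "0 \<le> C" using nontrivial(2) by (simp add: zero_le_mult_iff)
    then show ?thesis using True by simp
  next
    case False
    then have J0: "J > 0" using J by simp
    define k where "k y = G y \<bullet> e" for y
    define \<phi> where "\<phi> y = sgn (k y) * \<bar>k y\<bar> powr (q - 1)" for y
    have [measurable]: "k \<in> borel_measurable M" "\<phi> \<in> borel_measurable M"
      unfolding k_def \<phi>_def sgn_real_def by measurable
    have i: "integrable M (\<lambda>y. \<bar>k y\<bar> powr q)" unfolding k_def using comp(1) attained by blast
    have JI: "(\<integral>y. \<bar>k y\<bar> powr q \<partial>M) = J"
      using attained(2) J unfolding k_def[symmetric] by (subst (asm) nn_integral_eq_integral[OF i]) auto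
    have abs_\<phi>: "\<bar>\<phi> y\<bar> powr p = \<bar>k y\<bar> powr q" for y
      by (cases "k y = 0") (auto simp: \<phi>_def abs_mult powr_powr pq mult.commute[of _ p] sgn_real_def)
    have \<phi>k: "\<phi> y * k y = \<bar>k y\<bar> powr q" for y
    proof (cases "k y = 0")
      case False
      have "\<phi> y * k y = \<bar>k y\<bar> powr (q - 1) * \<bar>k y\<bar>" by (simp add: \<phi>_def sgn_real_def)
      also have "\<dots> = \<bar>k y\<bar> powr q" using False powr_mult_base[of "\<bar>k y\<bar>" "q - 1"] by (simp add: mult.commute)
      finally show ?thesis .
    qed simp
    have \<phi>L: "\<phi> \<in> Lp_space p M" using i by (simp add: Lp_space_def abs_\<phi>)
    have N: "Lp_norm p M \<phi> = J powr (1 / p)" by (simp add: Lp_norm_def abs_\<phi> JI)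
    have "J = (\<integral>y. \<phi> y *\<^sub>R G y \<partial>M) \<bullet> e"
      using integral_inner_left[OF int[OF \<phi>L], of e] int[OF \<phi>L] JI \<phi>k by (simp add: k_def)
    also have "\<dots> \<le> norm (\<integral>y. \<phi> y *\<^sub>R G y \<partial>M) * norm e" by (rule norm_cauchy_schwarz)
    also have "\<dots> \<le> C * J powr (1 / p)" using C[OF \<phi>L] attained(1) by (simp add: N)
    finally have "J \<le> C * J powr (1 / p)" .
    moreover have "J = J powr (1 / q) * J powr (1 / p)"
      using J0 p(3) by (simp add: powr_add[symmetric] add.commute)
    ultimately have "J powr (1 / q) * J powr (1 / p) \<le> C * J powr (1 / p)" by simp
    then show ?thesis using J0 by simp
  qed
  show ?thesis
    unfolding sharp_gradient_estimate_def
  proof (intro conjI ballI allI impI)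
    fix \<phi> assume \<phi>: "\<phi> \<in> Lp_space p M"
    show "P \<phi> differentiable at x" using grad[OF \<phi>] unfolding gderiv_def differentiable_def by blast
    show "norm (gradient (P \<phi>) x) \<le> J powr (1 / q) * Lp_norm p M \<phi>"
      using est[OF \<phi>] gradient_eqI[OF grad[OF \<phi>]] by simp
  next
    fix C assume "\<forall>\<phi>\<in>Lp_space p M. norm (gradient (P \<phi>) x) \<le> C * Lp_norm p M \<phi>"
    then show "J powr (1 / q) \<le> C" using gradient_eqI[OF grad] by (intro sharp) auto
  qed
qed

subsection \<open>The ball\<close>

text \<open>Logarithmic differentiation: with the power kept as a factor, the bracket is the
  gradient of the logarithm of \<open>A / B\<close>, the vector that turns out to have constant
  length for both kernels.\<close>

lemma GDERIV_quotient_power: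
  fixes A B :: "'a::real_inner \<Rightarrow> real"
  assumes "GDERIV A z :> a" "GDERIV B z :> b" "A z \<noteq> 0" "B z \<noteq> 0"
  shows "GDERIV (\<lambda>z. (A z / B z) ^ m) z :>
    (real m * (A z / B z) ^ m) *\<^sub>R ((1 / A z) *\<^sub>R a - (1 / B z) *\<^sub>R b)"
proof -
  have 1: "GDERIV (\<lambda>z. A z * inverse (B z)) z :> A z *\<^sub>R (- (inverse (B z))\<^sup>2 *\<^sub>R b) + inverse (B z) *\<^sub>R a"
    using assms by (intro GDERIV_mult GDERIV_inverse)
  have "DERIV (\<lambda>y. y ^ m) (A z * inverse (B z)) :> real m * (A z * inverse (B z)) ^ (m - 1)"
    by (auto intro!: derivative_eq_intros)
  from GDERIV_DERIV_compose[OF 1 this]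
  have "GDERIV (\<lambda>z. (A z / B z) ^ m) z :>
    (real m * (A z / B z) ^ (m - 1)) *\<^sub>R (A z *\<^sub>R (- (inverse (B z))\<^sup>2 *\<^sub>R b) + inverse (B z) *\<^sub>R a)"
    by (simp only: divide_inverse)
  also have "A z *\<^sub>R (- (inverse (B z))\<^sup>2 *\<^sub>R b) + inverse (B z) *\<^sub>R a =
      (A z / B z) *\<^sub>R ((1 / A z) *\<^sub>R a - (1 / B z) *\<^sub>R b)"
    using assms(3,4) by (simp add: scaleR_diff_right power2_eq_square divide_inverse algebra_simps)
  also have "(real m * (A z / B z) ^ (m - 1)) *\<^sub>R ((A z / B z) *\<^sub>R ((1 / A z) *\<^sub>R a - (1 / B z) *\<^sub>R b)) =
      (real m * (A z / B z) ^ (m - 1) * (A z / B z)) *\<^sub>R ((1 / A z) *\<^sub>R a - (1 / B z) *\<^sub>R b)"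
    by (rule scaleR_scaleR)
  \<comment> \<open>For \<open>m = 0\<close> both sides vanish, so the truncated
    \<open>m - 1\<close> does no harm.\<close>
  also have "real m * (A z / B z) ^ (m - 1) * (A z / B z) = real m * (A z / B z) ^ m"
    by (cases m) simp_all
  finally show ?thesis .
qed

lemma GDERIV_inner_self: "GDERIV (\<lambda>z. (z - c) \<bullet> (z - c)) z :> 2 *\<^sub>R (z - c)"
proof -
  have "GDERIV (\<lambda>z. (z - c) \<bullet> (z - c)) z :> (z - c) + (z - c)"
    unfolding gderiv_def
    by (auto intro!: derivative_eq_intros simp: inner_add_right inner_commute)
  then show ?thesis by (simp add: scaleR_2)
qed

text \<open>\<open>1 + \<bar>\<phi> x\<bar> powr p\<close> dominates
  \<open>\<bar>\<phi> x\<bar>\<close> and is integrable over a finite measure.\<close>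

lemma Lp_space_imp_integrable:
  assumes "finite_measure M" "p \<ge> 1" "\<phi> \<in> Lp_space p M"
  shows "integrable M (\<lambda>x. \<bar>\<phi> x\<bar>)"
proof -
  interpret finite_measure M by fact
  have [measurable]: "\<phi> \<in> borel_measurable M" and i: "integrable M (\<lambda>x. \<bar>\<phi> x\<bar> powr p)"
    using assms(3) by (auto simp: Lp_space_def)
  show ?thesis
  proof (rule Bochner_Integration.integrable_bound)
    show "integrable M (\<lambda>x. 1 + \<bar>\<phi> x\<bar> powr p)" using i by simp
    have "\<bar>\<phi> x\<bar> \<le> 1 + \<bar>\<phi> x\<bar> powr p" for x
    proof (cases "\<bar>\<phi> x\<bar> \<le> 1")
      case True
      then show ?thesis using powr_ge_zero[of "\<bar>\<phi> x\<bar>" p] by linarith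
    next
      case False
      then show ?thesis using powr_mono[of 1 p "\<bar>\<phi> x\<bar>"] assms(2) by simp
    qed
    then show "AE x in M. norm \<bar>\<phi> x\<bar> \<le> norm (1 + \<bar>\<phi> x\<bar> powr p)"
      by (intro AE_I2) (simp add: add_nonneg_nonneg)
  qed simp
qed

section \<open>The kernel of the ball and its gradient\<close>

definition ball_kernel :: "'a::euclidean_space \<Rightarrow> 'a \<Rightarrow> real" where
  "ball_kernel x \<zeta> = ((1 - (norm x)\<^sup>2) / (norm (x - \<zeta>))\<^sup>2) ^ (DIM('a) - 1)"

definition ball_kernel_gradient :: "'a::euclidean_space \<Rightarrow> 'a \<Rightarrow> 'a" where
  "ball_kernel_gradient x \<zeta> = (real (DIM('a) - 1) * ball_kernel x \<zeta>) *\<^sub>R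
     ((1 / (1 - (norm x)\<^sup>2)) *\<^sub>R (- (2 *\<^sub>R x)) - (1 / (norm (x - \<zeta>))\<^sup>2) *\<^sub>R (2 *\<^sub>R (x - \<zeta>)))"

lemma ball_kernel_borel[measurable]: "ball_kernel x \<in> borel_measurable borel"
  unfolding ball_kernel_def by measurable

lemma ball_kernel_gradient_borel[measurable]: "ball_kernel_gradient x \<in> borel_measurable borel"
  unfolding ball_kernel_gradient_def by measurable

lemma norm_diff_unit_ge:
  assumes "norm \<zeta> = 1"
  shows "1 - norm x \<le> norm (x - \<zeta>)"
  using norm_triangle_ineq2[of \<zeta> x] assms by (simp add: norm_minus_commute)

lemma GDERIV_ball_kernel:
  assumes "norm z < 1" "norm \<zeta> = 1"
  shows "GDERIV (\<lambda>z. ball_kernel z \<zeta>) z :> ball_kernel_gradient z \<zeta>"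
proof -
  have A: "GDERIV (\<lambda>z. 1 - z \<bullet> z) z :> - (2 *\<^sub>R z)"
    using GDERIV_diff[OF GDERIV_const[of 1 z] GDERIV_inner_self[of 0 z]] by simp
  have "1 - z \<bullet> z \<noteq> 0" using assms by (simp add: power2_norm_eq_inner[symmetric] abs_square_eq_1)
  moreover have "z - \<zeta> \<noteq> 0" using assms by auto
  ultimately show ?thesis
    unfolding ball_kernel_gradient_def ball_kernel_def power2_norm_eq_inner
    by (intro GDERIV_quotient_power A GDERIV_inner_self) auto
qed

text \<open>A crude bound, uniform in \<zeta>. It dominates the differentiation under the integral
  and provides the boundedness required by \<open>nn_integral_sphere_moebius\<close>.\<close>

lemma norm_ball_kernel_gradient_le:
  fixes z :: "'a::euclidean_space"
  assumes z: "norm z \<le> r" and r: "r < 1" and \<zeta>: "norm \<zeta> = 1"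
  shows "norm (ball_kernel_gradient z \<zeta>) \<le>
    real (DIM('a) - 1) * (1 / (1 - r)\<^sup>2) ^ (DIM('a) - 1) * (2 / (1 - r\<^sup>2) + 2 / (1 - r))"
proof -
  have r0: "0 \<le> r" using z norm_ge_zero order_trans by blast
  have zr: "(norm z)\<^sup>2 \<le> r\<^sup>2" using z by (intro power_mono) auto
  have r2: "r\<^sup>2 < 1" using r r0 by (simp add: abs_square_less_1)
  have d: "1 - r \<le> norm (z - \<zeta>)" using norm_diff_unit_ge[OF \<zeta>, of z] z by linarith
  then have d2: "(1 - r)\<^sup>2 \<le> (norm (z - \<zeta>))\<^sup>2" using r by (intro power_mono) auto
  have K: "0 \<le> ball_kernel z \<zeta>" "ball_kernel z \<zeta> \<le> (1 / (1 - r)\<^sup>2) ^ (DIM('a) - 1)"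
    unfolding ball_kernel_def using zr r2 d2 r
    by (auto intro!: zero_le_power divide_nonneg_nonneg power_mono frac_le)
  have "norm ((1 / (1 - (norm z)\<^sup>2)) *\<^sub>R (- (2 *\<^sub>R z)) - (1 / (norm (z - \<zeta>))\<^sup>2) *\<^sub>R (2 *\<^sub>R (z - \<zeta>)))
    \<le> norm ((1 / (1 - (norm z)\<^sup>2)) *\<^sub>R (- (2 *\<^sub>R z))) + norm ((1 / (norm (z - \<zeta>))\<^sup>2) *\<^sub>R (2 *\<^sub>R (z - \<zeta>)))"
    by (rule norm_triangle_ineq4)
  also have "norm ((1 / (1 - (norm z)\<^sup>2)) *\<^sub>R (- (2 *\<^sub>R z))) \<le> 2 / (1 - r\<^sup>2)"
    using zr r2 z r by (auto simp: intro!: frac_le)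
  also have "norm ((1 / (norm (z - \<zeta>))\<^sup>2) *\<^sub>R (2 *\<^sub>R (z - \<zeta>))) = 2 / norm (z - \<zeta>)"
    using d r by (simp add: power2_eq_square)
  also have "\<dots> \<le> 2 / (1 - r)" using d r by (intro frac_le) auto
  finally have v: "norm ((1 / (1 - (norm z)\<^sup>2)) *\<^sub>R (- (2 *\<^sub>R z)) - (1 / (norm (z - \<zeta>))\<^sup>2) *\<^sub>R (2 *\<^sub>R (z - \<zeta>)))
    \<le> 2 / (1 - r\<^sup>2) + 2 / (1 - r)" by simp
  show ?thesis
    unfolding ball_kernel_gradient_def norm_scaleR
    using K v r r2 by (intro mult_mono) (auto simp: abs_mult intro!: mult_mono mult_left_mono)
qed

text \<open>For \<open>\<zeta> = moebius x \<omega>\<close> the vector \<open>x - \<zeta>\<close> is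
  \<open>- A / D\<close> times \<open>x + \<omega>\<close>. Hence the kernel base equals
  \<open>D / A\<close>, and in the logarithmic gradient the multiples of \<open>x\<close> cancel,
  leaving \<open>2 / A\<close> times \<omega>.\<close>

lemma ball_kernel_gradient_moebius:
  fixes x :: "'a::euclidean_space"
  assumes x: "norm x < 1" and w: "norm \<omega> = 1"
  shows "ball_kernel_gradient x (moebius x \<omega>) =
    (real (DIM('a) - 1) * ((norm (x + \<omega>))\<^sup>2 / (1 - (norm x)\<^sup>2)) ^ (DIM('a) - 1) * (2 / (1 - (norm x)\<^sup>2))) *\<^sub>R \<omega>"
proof -
  define D A c where "D = (norm (x + \<omega>))\<^sup>2" and "A = 1 - (norm x)\<^sup>2" and "c = x \<bullet> \<omega>"
  define \<zeta> where "\<zeta> = moebius x \<omega>"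
  have A: "A > 0" using x by (simp add: A_def abs_square_less_1)
  have Dpos: "D > 0" using norm_add_unit_ge[OF x w] by (simp add: D_def)
  have D: "D = 1 + (norm x)\<^sup>2 + 2 * c" using w unfolding D_def c_def by (rule norm_add_square_unit)
  have z1: "norm \<zeta> = 1" unfolding \<zeta>_def using x w by (rule norm_moebius)
  have D\<zeta>: "D *\<^sub>R \<zeta> = A *\<^sub>R \<omega> + (2 * (1 + c)) *\<^sub>R x"
    using Dpos unfolding \<zeta>_def moebius_def D_def[symmetric] A_def c_def by simp
  have "D *\<^sub>R (x - \<zeta>) = D *\<^sub>R x - (A *\<^sub>R \<omega> + (2 * (1 + c)) *\<^sub>R x)" by (simp only: scaleR_diff_right D\<zeta>)
  also have "\<dots> = (D - 2 * (1 + c)) *\<^sub>R x - A *\<^sub>R \<omega>" by (simp add: scaleR_diff_left)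
  also have "D - 2 * (1 + c) = - A" unfolding D A_def by simp
  finally have Dx: "D *\<^sub>R (x - \<zeta>) = - A *\<^sub>R (x + \<omega>)" by (simp add: scaleR_add_right)
  have "D * norm (x - \<zeta>) = norm (D *\<^sub>R (x - \<zeta>))" using Dpos by simp
  also have "\<dots> = A * norm (x + \<omega>)" unfolding Dx using A by simp
  finally have "(D * norm (x - \<zeta>))\<^sup>2 = A\<^sup>2 * D" by (simp add: power_mult_distrib D_def)
  then have n: "(norm (x - \<zeta>))\<^sup>2 = A\<^sup>2 / D"
    using Dpos by (simp add: power_mult_distrib field_simps power2_eq_square)
  have "x - \<zeta> = (1 / D) *\<^sub>R (D *\<^sub>R (x - \<zeta>))" using Dpos by simp
  then have xz: "x - \<zeta> = (- A / D) *\<^sub>R (x + \<omega>)" unfolding Dx by simp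
  have k: "A / (norm (x - \<zeta>))\<^sup>2 = D / A" unfolding n using A Dpos by (simp add: power2_eq_square)
  have "(1 / A) *\<^sub>R (- (2 *\<^sub>R x)) - (1 / (norm (x - \<zeta>))\<^sup>2) *\<^sub>R (2 *\<^sub>R (x - \<zeta>)) =
      (- 2 / A) *\<^sub>R x - (1 / (A\<^sup>2 / D) * (2 * (- A / D))) *\<^sub>R (x + \<omega>)"
    unfolding n unfolding xz by simp
  also have "1 / (A\<^sup>2 / D) * (2 * (- A / D)) = - 2 / A"
    using A Dpos by (simp add: power2_eq_square)
  also have "(- 2 / A) *\<^sub>R x - (- 2 / A) *\<^sub>R (x + \<omega>) = (2 / A) *\<^sub>R \<omega>"
    by (simp add: scaleR_add_right)
  finally show ?thesis
    unfolding \<zeta>_def[symmetric] ball_kernel_gradient_def ball_kernel_def A_def[symmetric] D_def[symmetric] k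
    by (simp add: mult.assoc)
qed

text \<open>The gradient contributes \<open>D / A\<close> to the power \<open>m q\<close>, the
  Jacobian removes \<open>m\<close>, and \<open>m q - m = s\<close>. Expanding \<open>D\<close> as
  \<open>(1 + r^2) (1 + t (\<omega> \<bullet> e))\<close> produces the parameter
  \<open>t\<close>.\<close>

lemma nn_integral_ball_kernel_gradient:
  fixes x e :: "'a::euclidean_space"
  assumes dim: "DIM('a) = DIM('b::euclidean_space) + 1"
    and x: "norm x < 1" and e: "x = norm x *\<^sub>R e" "norm e = 1" and q: "q > 0" and l: "norm l = 1"
  defines "s \<equiv> real (DIM('a) - 1) * (q - 1)"
  shows "(\<integral>\<^sup>+\<zeta>. ennreal (\<bar>ball_kernel_gradient x \<zeta> \<bullet> l\<bar> powr q) \<partial>sphere_measure) =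
    ennreal ((2 * real (DIM('a) - 1) / (1 - (norm x)\<^sup>2)) powr q * ((1 + (norm x)\<^sup>2) / (1 - (norm x)\<^sup>2)) powr s) *
    direction_integral s q (2 * norm x / (1 + (norm x)\<^sup>2)) e l"
proof -
  define m where "m = DIM('a) - 1"
  define r where "r = norm x"
  define A where "A = 1 - r\<^sup>2"
  have r: "0 \<le> r" "r < 1" using x by (auto simp: r_def)
  have A: "A > 0" using r by (simp add: A_def abs_square_less_1)
  define f where "f \<zeta> = ennreal (\<bar>ball_kernel_gradient x \<zeta> \<bullet> l\<bar> powr q)" for \<zeta>
  have fm: "f \<in> borel_measurable borel" unfolding f_def by measurable
  define B where "B = (real m * (1 / (1 - r)\<^sup>2) ^ m * (2 / (1 - r\<^sup>2) + 2 / (1 - r))) powr q"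
  have bound: "f \<zeta> \<le> ennreal B" if "norm \<zeta> = 1" for \<zeta>
  proof -
    have "\<bar>ball_kernel_gradient x \<zeta> \<bullet> l\<bar> \<le> norm (ball_kernel_gradient x \<zeta>)"
      using Cauchy_Schwarz_ineq2[of "ball_kernel_gradient x \<zeta>" l] l by simp
    also have "\<dots> \<le> real m * (1 / (1 - r)\<^sup>2) ^ m * (2 / (1 - r\<^sup>2) + 2 / (1 - r))"
      unfolding m_def using r by (intro norm_ball_kernel_gradient_le that) (auto simp: r_def)
    finally show ?thesis unfolding f_def B_def using q by (intro ennreal_leI powr_mono2) auto
  qed
  define C where "C = (2 * real m / A) powr q * ((1 + r\<^sup>2) / A) powr s"
  define t where "t = 2 * r / (1 + r\<^sup>2)"
  have r1: "1 + r\<^sup>2 > 0" by (simp add: add_pos_nonneg)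
  have "(\<integral>\<^sup>+\<zeta>. f \<zeta> \<partial>sphere_measure) =
    (\<integral>\<^sup>+\<omega>. f (moebius x \<omega>) * ennreal (((1 - (norm x)\<^sup>2) / (norm (x + \<omega>))\<^sup>2) ^ (DIM('a) - 1)) \<partial>sphere_measure)"
    by (rule nn_integral_sphere_moebius[OF dim fm bound x])
  also have "\<dots> = (\<integral>\<^sup>+\<omega>. ennreal C * ennreal ((1 + t * (\<omega> \<bullet> e)) powr s * \<bar>\<omega> \<bullet> l\<bar> powr q) \<partial>sphere_measure)"
  proof (rule nn_integral_cong)
    fix \<omega> :: 'a assume "\<omega> \<in> space sphere_measure"
    then have w: "norm \<omega> = 1" by (simp add: space_sphere_measure)
    define D where "D = (norm (x + \<omega>))\<^sup>2"
    have D: "D > 0" using norm_add_unit_ge[OF x w] by (simp add: D_def)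
    have "D = 1 + r\<^sup>2 + 2 * (x \<bullet> \<omega>)" unfolding D_def r_def by (rule norm_add_square_unit[OF w])
    also have "x \<bullet> \<omega> = r * (\<omega> \<bullet> e)" unfolding r_def by (subst e(1)) (simp add: inner_commute)
    also have "1 + r\<^sup>2 + 2 * (r * (\<omega> \<bullet> e)) = (1 + r\<^sup>2) * (1 + t * (\<omega> \<bullet> e))"
    proof -
      have "(1 + r\<^sup>2) * t = 2 * r" using r1 by (simp add: t_def)
      then have "(1 + r\<^sup>2) * t * (\<omega> \<bullet> e) = 2 * r * (\<omega> \<bullet> e)" by (simp only:)
      then show ?thesis by (simp only: distrib_left mult_1_right mult.assoc)
    qed
    finally have D_eq: "D = (1 + r\<^sup>2) * (1 + t * (\<omega> \<bullet> e))" .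
    then have t0: "1 + t * (\<omega> \<bullet> e) > 0" using D r1 by (simp add: zero_less_mult_iff)
    have "f (moebius x \<omega>) = ennreal (\<bar>real m * (D / A) ^ m * (2 / A) * (\<omega> \<bullet> l)\<bar> powr q)"
      unfolding f_def ball_kernel_gradient_moebius[OF x w] by (simp add: m_def A_def D_def r_def)
    moreover have "\<bar>real m * (D / A) ^ m * (2 / A) * (\<omega> \<bullet> l)\<bar> powr q * (A / D) ^ m
        = C * ((1 + t * (\<omega> \<bullet> e)) powr s * \<bar>\<omega> \<bullet> l\<bar> powr q)"
    proof -
      have DA: "D / A > 0" using D A by simp
      have "\<bar>real m * (D / A) ^ m * (2 / A) * (\<omega> \<bullet> l)\<bar> = (2 * real m / A) * (D / A) ^ m * \<bar>\<omega> \<bullet> l\<bar>"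
        using D A by (simp add: abs_mult)
      also have "\<dots> powr q = (2 * real m / A) powr q * ((D / A) ^ m) powr q * \<bar>\<omega> \<bullet> l\<bar> powr q"
        by (simp only: powr_mult)
      also have "((D / A) ^ m) powr q = (D / A) powr (real m * q)"
        using DA by (simp add: powr_realpow[symmetric] powr_powr)
      also have "(D / A) powr (real m * q) = (D / A) powr s * (D / A) ^ m"
      proof -
        have "real m * q = s + real m" by (simp only: s_def m_def right_diff_distrib mult_1_right)
        then show ?thesis using DA by (simp only: powr_add powr_realpow)
      qed
      also have "(D / A) powr s = ((1 + r\<^sup>2) / A * (1 + t * (\<omega> \<bullet> e))) powr s"
        by (simp add: D_eq)
      also have "\<dots> = ((1 + r\<^sup>2) / A) powr s * (1 + t * (\<omega> \<bullet> e)) powr s"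
        by (rule powr_mult)
      finally have "\<bar>real m * (D / A) ^ m * (2 / A) * (\<omega> \<bullet> l)\<bar> powr q * (A / D) ^ m =
        C * ((1 + t * (\<omega> \<bullet> e)) powr s * \<bar>\<omega> \<bullet> l\<bar> powr q) * ((D / A) ^ m * (A / D) ^ m)"
        by (simp add: C_def)
      also have "(D / A) ^ m * (A / D) ^ m = 1" using D A by (simp add: power_mult_distrib[symmetric])
      finally show ?thesis by simp
    qed
    moreover have "0 \<le> C" by (simp add: C_def)
    ultimately show "f (moebius x \<omega>) * ennreal (((1 - (norm x)\<^sup>2) / (norm (x + \<omega>))\<^sup>2) ^ (DIM('a) - 1)) =
        ennreal C * ennreal ((1 + t * (\<omega> \<bullet> e)) powr s * \<bar>\<omega> \<bullet> l\<bar> powr q)"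
      unfolding A_def[symmetric] r_def[symmetric] D_def[symmetric] m_def[symmetric]
      using A D by (simp add: ennreal_mult[symmetric])
  qed
  also have "\<dots> = ennreal C * direction_integral s q t e l"
    by (intro nn_integral_cmult borel_measurable_sphere_measure) measurable
  finally show ?thesis unfolding f_def C_def t_def r_def A_def m_def .
qed

lemma sharp_gradient_estimate_poisson_ball:
  fixes x :: "'a::euclidean_space"
  assumes dim: "DIM('a) = DIM('b::euclidean_space) + 1"
    and p: "p > 1" "q > 1" "1 / p + 1 / q = 1" and s1: "real (DIM('a) - 1) * (q - 1) < 1"
    and x: "norm x < 1"
  defines "n \<equiv> real DIM('a)"
  shows "sharp_gradient_estimate poisson_ball p sphere_measure x
          (2 * (n - 1) *
           (Gamma (n / 2) * Gamma ((q + 1) / 2) *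
              (1 + (norm x)\<^sup>2) powr ((n - 1) * (q - 1)) /
            (sqrt pi * Gamma ((q + n) / 2) *
              (1 - (norm x)\<^sup>2) powr (n * (q - 1) + 1))) powr (1 / q) *
           (hypergeo_2F1 ((n - 1) * (1 - q) / 2) ((1 - (n - 1) * (q - 1)) / 2)
              ((q + n) / 2) (4 * (norm x)\<^sup>2 / (1 + (norm x)\<^sup>2)\<^sup>2)) powr (1 / q))"
proof -
  define m where "m = DIM('a) - 1"
  have m: "real m = n - 1" "m \<ge> 1" using dim by (auto simp: m_def n_def)
  have n: "n \<ge> 2" using m by simp
  define s where "s = (n - 1) * (q - 1)"
  have s: "0 < s" "s < 1"
    using p n s1 unfolding s_def m(1)[symmetric] by (simp_all only: m_def[symmetric]) (simp add: m(1))
  define r where "r = norm x"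
  have r: "0 \<le> r" "r < 1" using x by (auto simp: r_def)
  obtain e :: 'a where e: "x = norm x *\<^sub>R e" "norm e = 1"
    using exists_unit_direction by metis
  define t where "t = 2 * r / (1 + r\<^sup>2)"
  have r1: "1 + r\<^sup>2 > 0" by (simp add: add_pos_nonneg)
  have "2 * r \<le> 1 + r\<^sup>2" using sum_squares_ge_zero[of "1 - r" 0] by (simp add: power2_eq_square algebra_simps)
  then have t: "0 \<le> t" "t \<le> 1" using r r1 by (auto simp: t_def)
  have t2: "t\<^sup>2 = 4 * r\<^sup>2 / (1 + r\<^sup>2)\<^sup>2" by (simp add: t_def power_divide power_mult_distrib)
  define A where "A = 1 - r\<^sup>2"
  have A: "A > 0" using r by (simp add: A_def abs_square_less_1)
  define F where "F = hypergeo_2F1 (- s / 2) ((1 - s) / 2) ((q + n) / 2) (t\<^sup>2)"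
  define K where "K = Gamma (n / 2) * Gamma ((q + 1) / 2) / (sqrt pi * Gamma ((q + n) / 2))"
  define C where "C = (2 * real m / A) powr q * ((1 + r\<^sup>2) / A) powr s"
  have q0: "q > 0" and dim2: "DIM('a) \<ge> 2" using p n by (auto simp: n_def)
  note maxi = nn_integral_sphere_maximal_direction[OF e(2) dim2 s q0 t, folded n_def, folded F_def K_def]
  have F: "F \<ge> 0" by (rule maxi(3))
  have K: "K > 0" unfolding K_def using q0 n by (auto intro!: divide_pos_pos mult_pos_pos Gamma_real_pos)
  have C: "C \<ge> 0" by (simp add: C_def)
  let ?G = "ball_kernel_gradient x"
  have I: "(\<integral>\<^sup>+\<zeta>. ennreal (\<bar>?G \<zeta> \<bullet> l\<bar> powr q) \<partial>sphere_measure) =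
    ennreal C * direction_integral s q t e l"
    if "norm l = 1" for l
    unfolding C_def t_def r_def A_def s_def m(1)[symmetric] unfolding m_def
    by (rule nn_integral_ball_kernel_gradient[OF dim x e q0 that])
  obtain l0 where l0: "norm l0 = 1"
    "direction_integral s q t e l0 = ennreal (K * F)"
    using maxi(2) by blast
  have fin: "finite_measure (sphere_measure :: 'a measure)" by (rule finite_measure_sphere_measure)
  interpret finite_measure "sphere_measure :: 'a measure" by (rule fin)
  \<comment> \<open>Halfway to the boundary: the ball of radius \<open>d\<close> about
    \<open>x\<close> stays within norm \<rho>, where the kernel gradient is uniformly
    bounded.\<close>
  define \<rho> where "\<rho> = (1 + r) / 2"
  define B where "B = real m * (1 / (1 - \<rho>)\<^sup>2) ^ m * (2 / (1 - \<rho>\<^sup>2) + 2 / (1 - \<rho>))"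
  define d where "d = (1 - r) / 2"
  have d: "d > 0" using r by (simp add: d_def)
  have zb: "norm z \<le> \<rho>" if "z \<in> ball x d" for z
    using that norm_triangle_ineq2[of z x] by (auto simp: dist_norm norm_minus_commute d_def \<rho>_def r_def field_simps)
  have \<rho>: "\<rho> < 1" using r by (simp add: \<rho>_def)
  have gi: "integrable sphere_measure (\<lambda>\<zeta>. \<phi> \<zeta> *\<^sub>R ?G \<zeta>)"
    "GDERIV (poisson_ball \<phi>) x :> (\<integral>\<zeta>. \<phi> \<zeta> *\<^sub>R ?G \<zeta> \<partial>sphere_measure)"
    if \<phi>: "\<phi> \<in> Lp_space p sphere_measure" for \<phi>
  proof -
    have \<phi>m[measurable]: "\<phi> \<in> borel_measurable sphere_measure" using \<phi> by (auto simp: Lp_space_def)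
    have i1: "integrable sphere_measure (\<lambda>x. \<bar>\<phi> x\<bar>)"
      using p \<phi> by (intro Lp_space_imp_integrable[OF fin, of p]) auto
    have Km: "ball_kernel z \<in> borel_measurable sphere_measure" for z :: 'a
      by (intro borel_measurable_sphere_measure) measurable
    have Gm: "?G \<in> borel_measurable sphere_measure"
      unfolding sphere_measure_def
      by (intro measurable_completion measurable_restrict_space1) simp
    have iK: "integrable sphere_measure (\<lambda>y. ball_kernel x y * \<phi> y)"
    proof (rule Bochner_Integration.integrable_bound[OF integrable_mult_right[OF i1, of "(A / (1 - r)\<^sup>2) ^ m"]])
      show "AE y in sphere_measure. norm (ball_kernel x y * \<phi> y) \<le> norm ((A / (1 - r)\<^sup>2) ^ m * \<bar>\<phi> y\<bar>)"
      proof (rule AE_I2)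
        fix y :: 'a assume "y \<in> space sphere_measure"
        then have y: "norm y = 1" by (simp add: space_sphere_measure)
        have "(1 - r)\<^sup>2 \<le> (norm (x - y))\<^sup>2"
          using norm_diff_unit_ge[OF y, of x] r by (intro power_mono) (auto simp: r_def)
        then have "0 \<le> ball_kernel x y" "ball_kernel x y \<le> (A / (1 - r)\<^sup>2) ^ m"
          unfolding ball_kernel_def r_def[symmetric] A_def[symmetric] m_def[symmetric] using A r
          by (auto intro!: power_mono frac_le)
        then show "norm (ball_kernel x y * \<phi> y) \<le> norm ((A / (1 - r)\<^sup>2) ^ m * \<bar>\<phi> y\<bar>)"
          by (auto simp: abs_mult intro!: mult_right_mono)
      qed
    qed (use Km in measurable)
    have iB: "integrable sphere_measure (\<lambda>y. B * \<bar>\<phi> y\<bar>)" using i1 by simp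
    have der: "GDERIV (\<lambda>z. ball_kernel z y) z :> ball_kernel_gradient z y"
      if "z \<in> ball x d" "y \<in> space sphere_measure" for z y
      using that zb[OF that(1)] \<rho> by (intro GDERIV_ball_kernel) (auto simp: space_sphere_measure)
    have bd: "norm (ball_kernel_gradient z y) \<le> B"
      if "z \<in> ball x d" "y \<in> space sphere_measure" for z y
      unfolding B_def m_def using that
      by (intro norm_ball_kernel_gradient_le zb \<rho>) (auto simp: space_sphere_measure)
    have P: "poisson_ball \<phi> = (\<lambda>z. \<integral>y. ball_kernel z y * \<phi> y \<partial>sphere_measure)"
      by (simp add: poisson_ball_def ball_kernel_def fun_eq_iff)
    show "integrable sphere_measure (\<lambda>\<zeta>. \<phi> \<zeta> *\<^sub>R ?G \<zeta>)"
      by (rule has_gradient_integral(1)[OF d der bd Km Gm \<phi>m iK iB])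
    show "GDERIV (poisson_ball \<phi>) x :> (\<integral>\<zeta>. \<phi> \<zeta> *\<^sub>R ?G \<zeta> \<partial>sphere_measure)"
      unfolding P by (rule has_gradient_integral(2)[OF d der bd Km Gm \<phi>m iK iB])
  qed
  have "sharp_gradient_estimate poisson_ball p sphere_measure x ((C * (K * F)) powr (1 / q))"
  proof (rule sharp_gradient_estimateI[OF p _ gi])
    show "?G \<in> borel_measurable sphere_measure"
      unfolding sphere_measure_def by (intro measurable_completion measurable_restrict_space1) simp
    show "(\<integral>\<^sup>+y. ennreal (\<bar>?G y \<bullet> l\<bar> powr q) \<partial>sphere_measure) \<le> ennreal (C * (K * F))" if "norm l = 1" for l
      unfolding I[OF that] using maxi(1)[OF that] C K F by (auto simp: ennreal_mult intro!: mult_left_mono)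
    show "norm l0 = 1" by (rule l0)
    show "(\<integral>\<^sup>+y. ennreal (\<bar>?G y \<bullet> l0\<bar> powr q) \<partial>sphere_measure) = ennreal (C * (K * F))"
      unfolding I[OF l0(1)] l0(2) using C K F by (simp add: ennreal_mult)
    show "0 \<le> C * (K * F)" using C K F by simp
    have "measure sphere_measure (space (sphere_measure :: 'a measure)) = 1"
      by (simp add: measure_def emeasure_space_sphere_measure)
    then show "(\<lambda>_. 1) \<in> Lp_space p (sphere_measure :: 'a measure)" "Lp_norm p (sphere_measure :: 'a measure) (\<lambda>_. 1) > 0"
      by (auto simp: Lp_space_def Lp_norm_def)
  qed
  also have "(C * (K * F)) powr (1 / q) =
      2 * (n - 1) * (K * (1 + r\<^sup>2) powr s / A powr (n * (q - 1) + 1)) powr (1 / q) * F powr (1 / q)"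
  proof -
    \<comment> \<open>The exponents add up as
      \<open>q + (n - 1) (q - 1) = n (q - 1) + 1\<close>.\<close>
    have "A powr q * A powr s = A powr (n * (q - 1) + 1)"
      by (simp add: powr_add[symmetric] s_def algebra_simps)
    then have C_eq: "C = (2 * (n - 1)) powr q * ((1 + r\<^sup>2) powr s / A powr (n * (q - 1) + 1))"
      unfolding C_def using A r1 n by (simp add: m powr_divide)
    have "C * (K * F) = (2 * (n - 1)) powr q * (K * (1 + r\<^sup>2) powr s / A powr (n * (q - 1) + 1)) * F"
      unfolding C_eq by simp
    then have "(C * (K * F)) powr (1 / q) = ((2 * (n - 1)) powr q) powr (1 / q) *
        (K * (1 + r\<^sup>2) powr s / A powr (n * (q - 1) + 1)) powr (1 / q) * F powr (1 / q)"
      by (simp only: powr_mult)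
    then show ?thesis using n q0 by (simp add: powr_powr)
  qed
  also have "K * (1 + r\<^sup>2) powr s / A powr (n * (q - 1) + 1) =
      Gamma (n / 2) * Gamma ((q + 1) / 2) * (1 + r\<^sup>2) powr s / (sqrt pi * Gamma ((q + n) / 2) * A powr (n * (q - 1) + 1))"
    by (simp add: K_def)
  also have "F = hypergeo_2F1 ((n - 1) * (1 - q) / 2) ((1 - (n - 1) * (q - 1)) / 2) ((q + n) / 2) (4 * r\<^sup>2 / (1 + r\<^sup>2)\<^sup>2)"
  proof -
    have "- s = (n - 1) * (1 - q)" by (simp add: s_def algebra_simps)
    then show ?thesis unfolding F_def t2 by (simp add: s_def)
  qed
  finally show ?thesis unfolding s_def A_def r_def .
qed

subsection \<open>The half-space\<close>

definition half_space_kernel :: "'b::euclidean_space \<times> real \<Rightarrow> 'b \<Rightarrow> real" where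
  "half_space_kernel x y = (snd x / ((norm (fst x - y))\<^sup>2 + (snd x)\<^sup>2)) ^ DIM('b)"

definition half_space_kernel_gradient :: "'b::euclidean_space \<times> real \<Rightarrow> 'b \<Rightarrow> 'b \<times> real" where
  "half_space_kernel_gradient x y = (real DIM('b) * half_space_kernel x y) *\<^sub>R
     ((1 / snd x) *\<^sub>R (0, 1) - (1 / (norm (x - (y, 0)))\<^sup>2) *\<^sub>R (2 *\<^sub>R (x - (y, 0))))"

lemma half_space_kernel_borel[measurable]: "half_space_kernel x \<in> borel_measurable borel"
  unfolding half_space_kernel_def by measurable

lemma half_space_kernel_gradient_borel[measurable]:
  "half_space_kernel_gradient x \<in> borel_measurable borel"
  unfolding half_space_kernel_gradient_def by measurable

text \<open>Written with the squared distance to the boundary point \<open>(y, 0)\<close>, the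
  kernel has the quotient form handled by \<open>GDERIV_quotient_power\<close>.\<close>

lemma half_space_kernel_eq:
  fixes y :: "'b::euclidean_space"
  shows "half_space_kernel x y = (snd x / (norm (x - (y, 0)))\<^sup>2) ^ DIM('b)"
  by (cases x) (simp add: half_space_kernel_def norm_Pair)

lemma GDERIV_half_space_kernel:
  assumes "snd z > 0"
  shows "GDERIV (\<lambda>z. half_space_kernel z y) z :> half_space_kernel_gradient z y"
proof -
  have A: "GDERIV snd z :> (0, 1)"
  proof -
    have "(\<lambda>h. h \<bullet> (0, 1)) = (snd :: 'a \<times> real \<Rightarrow> real)" by (auto simp: inner_prod_def fun_eq_iff)
    then show ?thesis unfolding gderiv_def
      by (simp add: bounded_linear_imp_has_derivative bounded_linear_snd)
  qed
  have "z - (y, 0) \<noteq> 0" using assms by (cases z) (auto simp: zero_prod_def)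
  then show ?thesis
    unfolding half_space_kernel_gradient_def half_space_kernel_eq power2_norm_eq_inner using assms
    by (intro GDERIV_quotient_power A GDERIV_inner_self) auto
qed

text \<open>In the centered and rescaled variable \<open>z\<close>, the logarithmic gradient is
  \<open>1 / snd x\<close> times the mirror image of \<open>(0, 1)\<close> in the hyperplane
  orthogonal to \<open>(- z, 1)\<close>, and that image is \<open>stereographic z\<close>.\<close>

lemma half_space_kernel_gradient_stereographic:
  fixes z :: "'b::euclidean_space"
  assumes x: "snd x > 0"
  shows "half_space_kernel_gradient x (fst x + snd x *\<^sub>R z) =
    (real DIM('b) * (1 / (snd x * (1 + (norm z)\<^sup>2))) ^ DIM('b) * (1 / snd x)) *\<^sub>R stereographic z"
    and "half_space_kernel x (fst x + snd x *\<^sub>R z) = (1 / (snd x * (1 + (norm z)\<^sup>2))) ^ DIM('b)"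
proof -
  define a where "a = snd x"
  define N where "N = (norm z)\<^sup>2"
  have a: "a > 0" using x by (simp add: a_def)
  have N: "1 + N > 0" unfolding N_def by (rule one_plus_norm_square_pos)
  have d: "x - (fst x + a *\<^sub>R z, 0) = (- a) *\<^sub>R (z, - 1)"
    by (simp add: prod_eq_iff a_def)
  have n: "(norm (x - (fst x + a *\<^sub>R z, 0)))\<^sup>2 = a\<^sup>2 * (1 + N)"
    unfolding d norm_scaleR power_mult_distrib by (simp add: norm_Pair N_def)
  have k: "a / (a\<^sup>2 * (1 + N)) = 1 / (a * (1 + N))" using a by (simp add: power2_eq_square)
  show "half_space_kernel x (fst x + snd x *\<^sub>R z) = (1 / (snd x * (1 + (norm z)\<^sup>2))) ^ DIM('b)"
    unfolding half_space_kernel_eq a_def[symmetric] n k unfolding N_def ..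
  have "(1 / (a\<^sup>2 * (1 + N))) *\<^sub>R (2 *\<^sub>R ((- a) *\<^sub>R (z, - 1 :: real))) = (- (2 / (a * (1 + N)))) *\<^sub>R (z, - 1)"
  proof -
    have "1 / (a\<^sup>2 * (1 + N)) * (2 * (- a)) = - (2 / (a * (1 + N)))"
      using a N by (simp add: power2_eq_square)
    then show ?thesis by (simp only: scaleR_scaleR mult.assoc)
  qed
  then have "(1 / a) *\<^sub>R (0, 1) - (1 / (a\<^sup>2 * (1 + N))) *\<^sub>R (2 *\<^sub>R ((- a) *\<^sub>R (z, - 1 :: real))) =
    (1 / a) *\<^sub>R (0, 1) - (- (2 / (a * (1 + N)))) *\<^sub>R (z, - 1)" by (simp only:)
  also have "\<dots> = ((2 / (a * (1 + N))) *\<^sub>R z, 1 / a - 2 / (a * (1 + N)))" by simp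
  also have "1 / a - 2 / (a * (1 + N)) = (1 / a) * ((N - 1) / (1 + N))"
  proof -
    have "(N - 1) / (1 + N) = 1 - 2 / (1 + N)" using N by (simp add: field_simps)
    then show ?thesis by (simp add: right_diff_distrib)
  qed
  also have "((2 / (a * (1 + N))) *\<^sub>R z, (1 / a) * ((N - 1) / (1 + N))) = (1 / a) *\<^sub>R stereographic z"
    unfolding stereographic_eq N_def by simp
  finally show "half_space_kernel_gradient x (fst x + snd x *\<^sub>R z) =
    (real DIM('b) * (1 / (snd x * (1 + (norm z)\<^sup>2))) ^ DIM('b) * (1 / snd x)) *\<^sub>R stereographic z"
    unfolding half_space_kernel_gradient_def half_space_kernel_eq a_def[symmetric] n k
    unfolding d N_def[symmetric] by simp
qed

lemma half_space_kernel_nonneg: "snd x > 0 \<Longrightarrow> 0 \<le> half_space_kernel x y"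
  by (simp add: half_space_kernel_def add_nonneg_nonneg)

text \<open>A Harnack inequality: on the ball of radius \<open>snd x / 2\<close> about \<open>x\<close> the kernel is
  comparable to its value at \<open>x\<close>, uniformly in \<open>y\<close>.\<close>

lemma norm_half_space_kernel_gradient_le:
  fixes x z :: "'b::euclidean_space \<times> real"
  assumes x: "snd x > 0" and z: "z \<in> ball x (snd x / 2)"
  shows "snd z > 0"
    and "norm (half_space_kernel_gradient z y) \<le>
      (real DIM('b) * 6 ^ DIM('b) * (6 / snd x)) * half_space_kernel x y"
proof -
  define a where "a = snd x"
  have zx: "norm (z - x) < a / 2" using z by (simp add: dist_norm norm_minus_commute a_def)
  have snd_le: "\<bar>snd v\<bar> \<le> norm v" for v :: "'b \<times> real"
    using norm_snd_le[of "snd v" "fst v"] by simp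
  have "\<bar>snd z - a\<bar> < a / 2" using snd_le[of "z - x"] zx by (simp add: a_def)
  then have sz: "a / 2 < snd z" "snd z < 3 * a / 2" by linarith+
  then show "snd z > 0" using x by (simp add: a_def)
  have a: "a > 0" using x by (simp add: a_def)
  define wx wz where "wx = norm (x - (y, 0))" and "wz = norm (z - (y, 0))"
  have wx: "a \<le> wx" using snd_le[of "x - (y, 0)"] a by (simp add: wx_def a_def)
  have "wx \<le> wz + norm (z - x)"
  proof -
    have "x - (y, 0) = (z - (y, 0)) - (z - x)" by simp
    then show ?thesis unfolding wx_def wz_def using norm_triangle_ineq4 by metis
  qed
  then have wz: "wx / 2 \<le> wz" using zx wx by linarith
  have wz2: "a / 2 \<le> wz" using wz wx by linarith
  \<comment> \<open>The height of \<open>z\<close> is below \<open>3 a / 2\<close> and its distance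
    to \<open>(y, 0)\<close> is at least half that of \<open>x\<close>, so the base grows by at most
    \<open>3 / 2\<close> times 4.\<close>
  have K: "half_space_kernel z y \<le> 6 ^ DIM('b) * half_space_kernel x y"
  proof -
    have "wx\<^sup>2 / 4 = (wx / 2)\<^sup>2" by (simp add: power_divide)
    also have "\<dots> \<le> wz\<^sup>2" using wz wx a by (intro power_mono) auto
    finally have "snd z / wz\<^sup>2 \<le> (3 * a / 2) / (wx\<^sup>2 / 4)"
      using sz a wx by (intro frac_le) auto
    also have "\<dots> = 6 * (a / wx\<^sup>2)" by simp
    finally have "(snd z / wz\<^sup>2) ^ DIM('b) \<le> (6 * (a / wx\<^sup>2)) ^ DIM('b)"
      using sz a by (intro power_mono) auto
    then show ?thesis
      unfolding half_space_kernel_eq wx_def[symmetric] wz_def[symmetric] a_def[symmetric] by (simp only: power_mult_distrib)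
  qed
  define v where "v = (1 / snd z) *\<^sub>R (0, 1) - (1 / wz\<^sup>2) *\<^sub>R (2 *\<^sub>R (z - (y, 0)))"
  have v: "norm v \<le> 6 / a"
  proof -
    have "norm v \<le>
      norm ((1 / snd z) *\<^sub>R (0::'b, 1::real)) + norm ((1 / wz\<^sup>2) *\<^sub>R (2 *\<^sub>R (z - (y, 0))))"
      unfolding v_def by (rule norm_triangle_ineq4)
    also have "norm ((1 / snd z) *\<^sub>R (0::'b, 1::real)) = 1 / snd z"
      using sz a unfolding norm_scaleR by (simp add: norm_Pair)
    also have "norm ((1 / wz\<^sup>2) *\<^sub>R (2 *\<^sub>R (z - (y, 0)))) = 2 / wz"
      using wz2 a unfolding norm_scaleR wz_def[symmetric] by (simp add: power2_eq_square)
    also have "1 / snd z + 2 / wz \<le> 1 / (a / 2) + 2 / (a / 2)"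
      using sz a wz2 by (intro add_mono frac_le) auto
    also have "\<dots> = 6 / a" by simp
    finally show ?thesis .
  qed
  have Kz: "0 \<le> half_space_kernel z y" using sz a by (intro half_space_kernel_nonneg) auto
  have "norm (half_space_kernel_gradient z y) \<le> (real DIM('b) * half_space_kernel z y) * (6 / a)"
    unfolding half_space_kernel_gradient_def norm_scaleR wz_def[symmetric] v_def[symmetric]
  proof -
    have "0 \<le> real DIM('b) * half_space_kernel z y" using Kz by simp
    then show "\<bar>real DIM('b) * half_space_kernel z y\<bar> * norm v \<le>
        real DIM('b) * half_space_kernel z y * (6 / a)"
      using v by (simp only: abs_of_nonneg mult_left_mono)
  qed
  also have "\<dots> \<le> (real DIM('b) * (6 ^ DIM('b) * half_space_kernel x y)) * (6 / a)"
    using K a by (intro mult_right_mono mult_left_mono) auto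
  finally show "norm (half_space_kernel_gradient z y) \<le>
      (real DIM('b) * 6 ^ DIM('b) * (6 / snd x)) * half_space_kernel x y"
    by (simp add: a_def mult_ac)
qed

text \<open>The constant in front of the half-space integral for \<open>n = DIM('b) + 1\<close>, and
  also the constant of \<open>nn_integral_sphere_stereographic\<close>.\<close>

definition half_space_const :: "'b::euclidean_space itself \<Rightarrow> real" where
  "half_space_const _ = 2 powr (real DIM('b) - 1) * Gamma ((real DIM('b) + 1) / 2) / pi powr ((real DIM('b) + 1) / 2)"

lemma half_space_const_pos: "half_space_const TYPE('b::euclidean_space) > 0"
  unfolding half_space_const_def by (intro divide_pos_pos mult_pos_pos Gamma_real_pos) auto

text \<open>Lebesgue measure is infinite, so pairing the kernel with \<phi> rests on Hoelder's
  inequality. After rescaling, the kernel is a constant times a function with values in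
  \<open>(0, 1]\<close>; its \<open>q\<close>-th power is at most that function, whose integral
  comes from the stereographic formula for the constant 1.\<close>

lemma half_space_kernel_Lq:
  fixes x :: "'b::euclidean_space \<times> real"
  assumes x: "snd x > 0" and q: "q \<ge> 1"
  shows "integrable lebesgue (\<lambda>y. \<bar>half_space_kernel x y\<bar> powr q)"
proof (rule integrableI_nonneg)
  let ?m = "DIM('b)"
  define a where "a = snd x"
  have a: "a > 0" using x by (simp add: a_def)
  define c where "c = half_space_const TYPE('b)"
  have c: "c > 0" unfolding c_def by (rule half_space_const_pos)
  have "(\<integral>\<^sup>+\<omega>. 1 \<partial>(sphere_measure :: ('b \<times> real) measure)) = 1"
    by (simp add: emeasure_space_sphere_measure)
  moreover from this have "(\<integral>\<^sup>+\<omega>. 1 \<partial>(sphere_measure :: ('b \<times> real) measure)) = ennreal c *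
    (\<integral>\<^sup>+z. 1 * ennreal (1 / (1 + (norm (z::'b))\<^sup>2) ^ ?m) \<partial>lborel)"
    using nn_integral_sphere_stereographic[of "\<lambda>_::'b \<times> real. 1"] by (simp add: c_def half_space_const_def)
  ultimately have "ennreal c * (\<integral>\<^sup>+z. ennreal (1 / (1 + (norm (z::'b))\<^sup>2) ^ ?m) \<partial>lborel) = ennreal 1" by simp
  then have fin: "(\<integral>\<^sup>+z. ennreal (1 / (1 + (norm (z::'b))\<^sup>2) ^ ?m) \<partial>lborel) = ennreal (1 / c)"
    using c by (rule ennreal_eq_divide_if_mult_eq)
  have "(\<integral>\<^sup>+y. ennreal (\<bar>half_space_kernel x y\<bar> powr q) \<partial>lebesgue) = (\<integral>\<^sup>+y. ennreal (\<bar>half_space_kernel x y\<bar> powr q) \<partial>lborel)"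
    by (rule nn_integral_completion)
  also have "\<dots> = ennreal (\<bar>a\<bar> ^ ?m) * (\<integral>\<^sup>+z. ennreal (\<bar>half_space_kernel x (fst x + a *\<^sub>R z)\<bar> powr q) \<partial>lborel)"
    using a by (intro nn_integral_lborel_affine) auto
  also have "\<dots> \<le> ennreal (\<bar>a\<bar> ^ ?m) * (\<integral>\<^sup>+z. ennreal (((1 / a) ^ ?m) powr q) * ennreal (1 / (1 + (norm (z::'b))\<^sup>2) ^ ?m) \<partial>lborel)"
  proof (intro mult_left_mono nn_integral_mono)
    fix z :: 'b
    define b where "b = 1 / (1 + (norm z)\<^sup>2) ^ ?m"
    have b: "0 < b" "b \<le> 1" by (auto simp: b_def add_pos_nonneg one_le_power)
    have "half_space_kernel x (fst x + a *\<^sub>R z) = (1 / a) ^ ?m * b"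
      unfolding a_def half_space_kernel_gradient_stereographic(2)[OF x] b_def by (simp add: power_divide power_mult_distrib)
    then have "\<bar>half_space_kernel x (fst x + a *\<^sub>R z)\<bar> powr q = ((1 / a) ^ ?m) powr q * b powr q"
      using a b by (simp add: powr_mult abs_mult)
    also have "b powr q \<le> b powr 1" using b q by (intro powr_mono') auto
    finally have "\<bar>half_space_kernel x (fst x + a *\<^sub>R z)\<bar> powr q \<le> ((1 / a) ^ ?m) powr q * b"
      using b by (simp add: mult_left_mono)
    then show "ennreal (\<bar>half_space_kernel x (fst x + a *\<^sub>R z)\<bar> powr q) \<le> ennreal (((1 / a) ^ ?m) powr q) * ennreal (1 / (1 + (norm z)\<^sup>2) ^ ?m)"
      unfolding b_def[symmetric] using b by (simp add: ennreal_mult[symmetric])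
  qed simp
  also have "\<dots> = ennreal (\<bar>a\<bar> ^ ?m) * (ennreal (((1 / a) ^ ?m) powr q) * ennreal (1 / c))"
    by (subst nn_integral_cmult) (auto simp: fin)
  also have "\<dots> < \<infinity>" by (simp add: ennreal_mult_less_top)
  finally show "(\<integral>\<^sup>+y. ennreal (\<bar>half_space_kernel x y\<bar> powr q) \<partial>lebesgue) < \<infinity>" .
qed (auto intro!: measurable_completion)

text \<open>With \<open>M = 1 + |z|^2\<close>, the power \<open>M powr (- m q)\<close> splits into
  the stereographic density \<open>M powr (- m)\<close> and \<open>M powr (- s)\<close>. The latter
  becomes the weight with \<open>t = 1\<close> and \<open>e = (0, - 1)\<close>, because
  \<open>2 / M\<close> is one minus the last coordinate of \<open>stereographic z\<close>.\<close>

lemma nn_integral_half_space_kernel_gradient: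
  fixes x l :: "'b::euclidean_space \<times> real"
  assumes x: "snd x > 0" and q: "q > 1" and l: "norm l = 1"
  defines "m \<equiv> real DIM('b)"
  defines "s \<equiv> m * (q - 1)"
  shows "ennreal (half_space_const TYPE('b)) *
      (\<integral>\<^sup>+y. ennreal (\<bar>half_space_kernel_gradient x y \<bullet> l\<bar> powr q) \<partial>lebesgue) =
    ennreal (m powr q * snd x powr (m - (m + 1) * q) * 2 powr (- s)) *
    direction_integral s q 1 (0, - 1) l"
proof -
  let ?m = "DIM('b)"
  define a where "a = snd x"
  have a: "a > 0" using x by (simp add: a_def)
  have s: "s > 0" using q by (simp add: s_def m_def)
  define g where "g \<omega> = ennreal ((1 + 1 * (\<omega> \<bullet> (0, - 1))) powr s * \<bar>\<omega> \<bullet> l\<bar> powr q)" for \<omega> :: "'b \<times> real"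
  have gm[measurable]: "g \<in> borel_measurable borel" unfolding g_def by measurable
  have "(\<integral>\<^sup>+\<omega>. g \<omega> \<partial>sphere_measure) \<le> ennreal (2 powr s)"
  proof (rule nn_integral_sphere_le)
    fix \<omega> :: "'b \<times> real" assume w: "norm \<omega> = 1"
    have "\<bar>\<omega> \<bullet> (0, - 1)\<bar> \<le> 1" by (rule inner_unit_le[OF w]) (simp add: norm_Pair)
    then have "(1 + 1 * (\<omega> \<bullet> (0, - 1))) powr s \<le> 2 powr s" using s by (intro powr_mono2) auto
    moreover have "\<bar>\<omega> \<bullet> l\<bar> powr q \<le> 1" using inner_unit_le[OF w l] q by (intro powr_le1) auto
    ultimately have "(1 + 1 * (\<omega> \<bullet> (0, - 1))) powr s * \<bar>\<omega> \<bullet> l\<bar> powr q \<le> 2 powr s * 1"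
      by (intro mult_mono) auto
    then show "g \<omega> \<le> ennreal (2 powr s)" unfolding g_def by (simp add: ennreal_leI)
  qed
  then have fin: "(\<integral>\<^sup>+\<omega>. g \<omega> \<partial>sphere_measure) < \<infinity>" by (rule le_less_trans) simp
  define c where "c = half_space_const TYPE('b)"
  have st: "(\<integral>\<^sup>+\<omega>. g \<omega> \<partial>sphere_measure) = ennreal c *
     (\<integral>\<^sup>+z. g (stereographic z) * ennreal (1 / (1 + (norm z)\<^sup>2) ^ ?m) \<partial>lborel)"
    using nn_integral_sphere_stereographic[OF gm fin] by (simp add: c_def half_space_const_def)
  define f where "f y = ennreal (\<bar>half_space_kernel_gradient x y \<bullet> l\<bar> powr q)" for y
  have [measurable]: "f \<in> borel_measurable borel" unfolding f_def by measurable
  define C where "C = m powr q * a powr (m - (m + 1) * q) * 2 powr (- s)"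
  have "(\<integral>\<^sup>+y. f y \<partial>lebesgue) = (\<integral>\<^sup>+y. f y \<partial>lborel)" by (rule nn_integral_completion)
  also have "\<dots> = ennreal (\<bar>a\<bar> ^ ?m) * (\<integral>\<^sup>+z. f (fst x + a *\<^sub>R z) \<partial>lborel)"
    using a by (intro nn_integral_lborel_affine) auto
  also have "\<dots> = (\<integral>\<^sup>+z. ennreal (a ^ ?m) * f (fst x + a *\<^sub>R z) \<partial>lborel)"
    using a by (subst nn_integral_cmult) auto
  also have "\<dots> = (\<integral>\<^sup>+z. ennreal C * (g (stereographic z) * ennreal (1 / (1 + (norm z)\<^sup>2) ^ ?m)) \<partial>lborel)"
  proof (rule nn_integral_cong)
    fix z :: 'b
    define M where "M = 1 + (norm z)\<^sup>2"
    have M: "M > 0" unfolding M_def by (rule one_plus_norm_square_pos)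
    define \<omega> where "\<omega> = stereographic z"
    have "\<omega> \<bullet> (0, - 1) = - (((norm z)\<^sup>2 - 1) / M)" unfolding \<omega>_def stereographic_eq M_def by simp
    also have "\<dots> = 2 / M - 1" using M by (simp add: M_def field_simps)
    finally have w: "1 + 1 * (\<omega> \<bullet> (0, - 1)) = 2 / M" by simp
    have "a ^ ?m * \<bar>half_space_kernel_gradient x (fst x + a *\<^sub>R z) \<bullet> l\<bar> powr q =
        a powr m * \<bar>m * (1 / (a * M)) ^ ?m * (1 / a) * (\<omega> \<bullet> l)\<bar> powr q"
      unfolding a_def half_space_kernel_gradient_stereographic(1)[OF x] using a
      by (simp add: M_def m_def \<omega>_def a_def powr_realpow)
    also have "\<bar>m * (1 / (a * M)) ^ ?m * (1 / a) * (\<omega> \<bullet> l)\<bar> = m * (a * M) powr (- m) * a powr (- 1) * \<bar>\<omega> \<bullet> l\<bar>"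
    proof -
      have aM: "a * M > 0" using a M by simp
      have "(1 / (a * M)) ^ ?m = (a * M) powr (- m)"
        by (simp only: m_def powr_minus_divide powr_realpow[OF aM] power_one_over)
      moreover have "1 / a = a powr (- 1)" using a by (simp add: powr_minus_divide)
      moreover have "m \<ge> 0" by (simp add: m_def)
      ultimately show ?thesis by (simp only: abs_mult abs_of_nonneg powr_ge_zero)
    qed
    also have "\<dots> powr q = m powr q * ((a * M) powr (- m)) powr q * (a powr (- 1)) powr q * \<bar>\<omega> \<bullet> l\<bar> powr q"
      by (simp only: powr_mult)
    also have "((a * M) powr (- m)) powr q = a powr (- m * q) * M powr (- m * q)"
      by (simp only: powr_powr powr_mult)
    also have "M powr (- m * q) = M powr (- s) * M powr (- m)"
      by (simp add: powr_add[symmetric] s_def algebra_simps)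
    also have "M powr (- s) = 2 powr (- s) * (2 / M) powr s"
      using M by (simp add: powr_divide powr_minus field_simps)
    also have "a powr m * (m powr q * (a powr (- m * q) * (2 powr (- s) * (2 / M) powr s * M powr (- m))) * (a powr (- 1)) powr q * \<bar>\<omega> \<bullet> l\<bar> powr q)
      = (m powr q * (a powr m * a powr (- m * q) * a powr (- 1 * q)) * 2 powr (- s)) * ((2 / M) powr s * \<bar>\<omega> \<bullet> l\<bar> powr q * M powr (- m))"
      by (simp only: powr_powr mult_ac)
    also have "a powr m * a powr (- m * q) * a powr (- 1 * q) = a powr (m - (m + 1) * q)"
      by (simp add: powr_add[symmetric] algebra_simps)
    also have "M powr (- m) = 1 / M ^ ?m"
      using M by (simp add: m_def powr_minus powr_realpow divide_inverse)
    finally have *: "a ^ ?m * \<bar>half_space_kernel_gradient x (fst x + a *\<^sub>R z) \<bullet> l\<bar> powr q =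
       C * ((2 / M) powr s * \<bar>\<omega> \<bullet> l\<bar> powr q * (1 / M ^ ?m))" by (simp only: C_def)
    have C0: "C \<ge> 0" by (simp add: C_def)
    show "ennreal (a ^ ?m) * f (fst x + a *\<^sub>R z) = ennreal C * (g (stereographic z) * ennreal (1 / (1 + (norm z)\<^sup>2) ^ ?m))"
      unfolding f_def g_def \<omega>_def[symmetric] w M_def[symmetric]
      using a M C0 by (simp only: ennreal_mult[symmetric] * zero_le_power less_imp_le powr_ge_zero mult_nonneg_nonneg
          zero_le_divide_1_iff)
  qed
  also have "\<dots> = ennreal C * (\<integral>\<^sup>+z. g (stereographic z) * ennreal (1 / (1 + (norm z)\<^sup>2) ^ ?m) \<partial>lborel)"
    by (subst nn_integral_cmult) auto
  finally have "ennreal c * (\<integral>\<^sup>+y. f y \<partial>lebesgue) = ennreal C * (\<integral>\<^sup>+\<omega>. g \<omega> \<partial>sphere_measure)"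
    unfolding st by (simp only: mult.left_commute)
  then show ?thesis unfolding f_def c_def C_def g_def a_def .
qed

lemma poisson_half_space_eq:
  fixes \<phi> :: "'b::euclidean_space \<Rightarrow> real"
  shows "poisson_half_space \<phi> z =
    half_space_const TYPE('b) * (\<integral>y. half_space_kernel z y * \<phi> y \<partial>lebesgue)"
proof -
  have "(2::real) ^ (DIM('b) - 1) = 2 powr (real DIM('b) - 1)"
    by (simp add: powr_realpow[symmetric] of_nat_diff Suc_leI)
  then show ?thesis
    by (simp add: poisson_half_space_def half_space_const_def half_space_kernel_def Let_def add.commute)
qed

text \<open>Nonzero constants are not integrable here, so the indicator of a ball serves as the test
  function.\<close>

lemma exists_Lp_norm_pos_lebesgue:
  "\<exists>\<psi> \<in> Lp_space p (lebesgue :: 'a::euclidean_space measure). Lp_norm p lebesgue \<psi> > 0"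
proof (rule bexI[of _ "indicator (ball 0 1)"])
  have i: "\<bar>indicator (ball (0::'a) 1) x :: real\<bar> powr p = indicator (ball 0 1) x" for x
    by (simp add: indicator_def)
  have "measure lebesgue (ball (0::'a) 1) > 0" by (simp add: content_ball)
  then show "Lp_norm p lebesgue (indicator (ball (0::'a) 1)) > 0"
    unfolding Lp_norm_def i by simp
  show "indicator (ball (0::'a) 1) \<in> Lp_space p lebesgue"
  proof -
    have "integrable lebesgue (indicat_real (ball (0::'a) 1))"
      using lmeasurable_ball by (simp only: lmeasurable_iff_integrable)
    moreover from this have "indicat_real (ball (0::'a) 1) \<in> borel_measurable lebesgue"
      by (rule borel_measurable_integrable)
    ultimately show ?thesis by (simp only: Lp_space_def i mem_Collect_eq)
  qed
qed

lemma sharp_gradient_estimate_poisson_half_space: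
  fixes x :: "'b::euclidean_space \<times> real"
  assumes p: "p > 1" "q > 1" "1 / p + 1 / q = 1" and s1: "real DIM('b) * (q - 1) < 1"
    and x: "snd x > 0"
  defines "n \<equiv> real DIM('b) + 1"
  shows "sharp_gradient_estimate poisson_half_space p lebesgue x
          ((n - 1) * Gamma (n / 2) /
           (2 powr ((q - 1) / q) * pi powr ((n * q - n + 1) / (2 * q)) *
              snd x powr ((n * (q - 1) + 1) / q)) *
           (Gamma ((q + 1) / 2) / Gamma ((q + n) / 2) *
            hypergeo_2F1 ((n - 1) * (1 - q) / 2) ((1 - (n - 1) * (q - 1)) / 2)
              ((q + n) / 2) 1) powr (1 / q))"
proof -
  define m where "m = real DIM('b)"
  have m: "m = n - 1" "m \<ge> 1" by (auto simp: m_def n_def Suc_leI)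
  define a where "a = snd x"
  have a: "a > 0" using x by (simp add: a_def)
  define s where "s = m * (q - 1)"
  have s: "0 < s" "s < 1" using s1 p m(2) by (auto simp: s_def m_def)
  define c where "c = half_space_const TYPE('b)"
  have c: "c > 0" unfolding c_def by (rule half_space_const_pos)
  define e where "e = (0 :: 'b, - 1 :: real)"
  have e: "norm e = 1" by (simp add: e_def norm_Pair)
  have dim: "DIM('b \<times> real) \<ge> 2" by (simp add: Suc_leI)
  have dim': "real DIM('b \<times> real) = n" by (simp add: n_def)
  have q0: "q > 0" using p by simp
  define F where "F = hypergeo_2F1 (- s / 2) ((1 - s) / 2) ((q + n) / 2) (1\<^sup>2)"
  define K where "K = Gamma (n / 2) * Gamma ((q + 1) / 2) / (sqrt pi * Gamma ((q + n) / 2))"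
  define C where "C = m powr q * a powr (m - (m + 1) * q) * 2 powr (- s)"
  note maxi = nn_integral_sphere_maximal_direction[OF e dim s q0 zero_le_one order_refl, unfolded dim', folded F_def K_def]
  have F: "F \<ge> 0" by (rule maxi(3))
  have K: "K > 0" unfolding K_def using q0 m by (auto intro!: divide_pos_pos mult_pos_pos Gamma_real_pos)
  have C: "C \<ge> 0" by (simp add: C_def)
  define G where "G y = c *\<^sub>R half_space_kernel_gradient x y" for y
  have gmeas: "half_space_kernel_gradient x \<in> borel_measurable lebesgue" by (intro measurable_completion) simp
  then have Gm: "G \<in> borel_measurable lebesgue" unfolding G_def by measurable
  have I: "(\<integral>\<^sup>+y. ennreal (\<bar>G y \<bullet> l\<bar> powr q) \<partial>lebesgue) =
    ennreal (c powr (q - 1) * C) * direction_integral s q 1 e l"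
    if l: "norm l = 1" for l
  proof -
    have "(\<integral>\<^sup>+y. ennreal (\<bar>G y \<bullet> l\<bar> powr q) \<partial>lebesgue) =
       (\<integral>\<^sup>+y. ennreal (c powr (q - 1)) * (ennreal c * ennreal (\<bar>half_space_kernel_gradient x y \<bullet> l\<bar> powr q)) \<partial>lebesgue)"
    proof (rule nn_integral_cong)
      fix y
      \<comment> \<open>One factor \<open>c\<close> is kept next to the integral, where the
        stereographic formula expects it.\<close>
      have "c powr q = c powr (q - 1) * c" using c powr_mult_base[of c "q - 1"] by (simp add: mult.commute)
      then have "\<bar>G y \<bullet> l\<bar> powr q = c powr (q - 1) * (c * \<bar>half_space_kernel_gradient x y \<bullet> l\<bar> powr q)"
        using c by (simp add: G_def abs_mult powr_mult)
      then show "ennreal (\<bar>G y \<bullet> l\<bar> powr q) = ennreal (c powr (q - 1)) * (ennreal c * ennreal (\<bar>half_space_kernel_gradient x y \<bullet> l\<bar> powr q))"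
        using c by (simp add: ennreal_mult)
    qed
    also have "\<dots> = ennreal (c powr (q - 1)) * (ennreal c * (\<integral>\<^sup>+y. ennreal (\<bar>half_space_kernel_gradient x y \<bullet> l\<bar> powr q) \<partial>lebesgue))"
      using gmeas by (simp add: nn_integral_cmult)
    also have "ennreal c * (\<integral>\<^sup>+y. ennreal (\<bar>half_space_kernel_gradient x y \<bullet> l\<bar> powr q) \<partial>lebesgue) =
      ennreal C * direction_integral s q 1 e l"
      unfolding c_def C_def s_def m_def a_def e_def
      by (rule nn_integral_half_space_kernel_gradient[OF x p(2) l])
    finally show ?thesis using C by (simp add: ennreal_mult mult.assoc)
  qed
  obtain l0 where l0: "norm l0 = 1"
    "direction_integral s q 1 e l0 = ennreal (K * F)"
    using maxi(2) by blast
  define B where "B y = (m * 6 ^ DIM('b) * (6 / a)) * half_space_kernel x y" for y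
  have gi: "integrable lebesgue (\<lambda>y. \<phi> y *\<^sub>R G y)"
    "GDERIV (poisson_half_space \<phi>) x :> (\<integral>y. \<phi> y *\<^sub>R G y \<partial>lebesgue)"
    if \<phi>: "\<phi> \<in> Lp_space p lebesgue" for \<phi>
  proof -
    have \<phi>m[measurable]: "\<phi> \<in> borel_measurable lebesgue" and \<phi>i: "integrable lebesgue (\<lambda>x. \<bar>\<phi> x\<bar> powr p)"
      using \<phi> by (auto simp: Lp_space_def)
    have Km: "half_space_kernel z \<in> borel_measurable lebesgue" for z :: "'b \<times> real"
      by (intro measurable_completion) simp
    have Kq: "integrable lebesgue (\<lambda>y. \<bar>half_space_kernel x y\<bar> powr q)"
      using p by (intro half_space_kernel_Lq x) simp
    have iK: "integrable lebesgue (\<lambda>y. half_space_kernel x y * \<phi> y)"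
      using Hoelder_inequality(1)[OF p \<phi>m Km \<phi>i Kq] by (simp add: mult.commute)
    have "integrable lebesgue (\<lambda>y. \<bar>\<phi> y\<bar> * half_space_kernel x y)"
      by (rule Hoelder_inequality(1)[OF p _ Km _ Kq]) (use \<phi>i in auto)
    then have "integrable lebesgue (\<lambda>y. (m * 6 ^ DIM('b) * (6 / a)) * (\<bar>\<phi> y\<bar> * half_space_kernel x y))"
      by (rule integrable_mult_right)
    then have iB: "integrable lebesgue (\<lambda>y. B y * \<bar>\<phi> y\<bar>)" by (simp add: B_def mult_ac)
    have d: "a / 2 > 0" using a by simp
    have der: "GDERIV (\<lambda>z. half_space_kernel z y) z :> half_space_kernel_gradient z y"
      if "z \<in> ball x (a / 2)" for z y
      using norm_half_space_kernel_gradient_le(1)[OF x] that by (intro GDERIV_half_space_kernel) (simp add: a_def)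
    have bd: "norm (half_space_kernel_gradient z y) \<le> B y" if "z \<in> ball x (a / 2)" for z y
      unfolding B_def m_def a_def using that
      by (intro norm_half_space_kernel_gradient_le(2)[OF x]) (simp add: a_def)
    note hg = has_gradient_integral[OF d der bd Km gmeas \<phi>m iK iB]
    show "integrable lebesgue (\<lambda>y. \<phi> y *\<^sub>R G y)"
      using integrable_scaleR_right[OF hg(1), of c] by (simp add: G_def mult.commute)
    have "(\<integral>y. \<phi> y *\<^sub>R G y \<partial>lebesgue) = c *\<^sub>R (\<integral>y. \<phi> y *\<^sub>R half_space_kernel_gradient x y \<partial>lebesgue)"
    proof -
      have "(\<integral>y. \<phi> y *\<^sub>R G y \<partial>lebesgue) = (\<integral>y. c *\<^sub>R (\<phi> y *\<^sub>R half_space_kernel_gradient x y) \<partial>lebesgue)"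
        by (simp add: G_def mult.commute)
      also have "\<dots> = c *\<^sub>R (\<integral>y. \<phi> y *\<^sub>R half_space_kernel_gradient x y \<partial>lebesgue)"
        by (rule integral_scaleR_right)
      finally show ?thesis .
    qed
    moreover have "poisson_half_space \<phi> = (\<lambda>z. c * (\<integral>y. half_space_kernel z y * \<phi> y \<partial>lebesgue))"
      by (simp add: poisson_half_space_eq c_def fun_eq_iff)
    ultimately show "GDERIV (poisson_half_space \<phi>) x :> (\<integral>y. \<phi> y *\<^sub>R G y \<partial>lebesgue)"
      using GDERIV_mult[OF GDERIV_const[of c x] hg(2)] by simp
  qed
  obtain \<psi> :: "'b \<Rightarrow> real" where \<psi>: "\<psi> \<in> Lp_space p lebesgue" "Lp_norm p lebesgue \<psi> > 0"
    using exists_Lp_norm_pos_lebesgue by blast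
  define J where "J = c powr (q - 1) * C * (K * F)"
  have "sharp_gradient_estimate poisson_half_space p lebesgue x (J powr (1 / q))"
  proof (rule sharp_gradient_estimateI[OF p Gm gi])
    show "(\<integral>\<^sup>+y. ennreal (\<bar>G y \<bullet> l\<bar> powr q) \<partial>lebesgue) \<le> ennreal J" if "norm l = 1" for l
      unfolding I[OF that] J_def using maxi(1)[OF that] C K F
      by (subst ennreal_mult) (auto intro!: mult_left_mono)
    show "norm l0 = 1" by (rule l0)
    show "(\<integral>\<^sup>+y. ennreal (\<bar>G y \<bullet> l0\<bar> powr q) \<partial>lebesgue) = ennreal J"
      unfolding I[OF l0(1)] l0(2) J_def using C K F by (subst ennreal_mult) auto
    show "0 \<le> J" using C K F by (simp add: J_def)
  qed (use \<psi> in auto)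
  also have "J powr (1 / q) = (n - 1) * Gamma (n / 2) /
           (2 powr ((q - 1) / q) * pi powr ((n * q - n + 1) / (2 * q)) * a powr ((n * (q - 1) + 1) / q)) *
           (Gamma ((q + 1) / 2) / Gamma ((q + n) / 2) * F) powr (1 / q)"
  proof -
    define g where "g = Gamma (n / 2)"
    have g: "g > 0" unfolding g_def using m by (intro Gamma_real_pos) auto
    have c_eq: "c = 2 powr (n - 2) * g / pi powr (n / 2)"
      by (simp add: c_def half_space_const_def g_def n_def)
    have "c powr (q - 1) = (2 powr (n - 2)) powr (q - 1) * g powr (q - 1) / (pi powr (n / 2)) powr (q - 1)"
      unfolding c_eq using g by (simp add: powr_mult powr_divide)
    also have "\<dots> = 2 powr ((n - 2) * (q - 1)) * g powr (q - 1) / pi powr (n / 2 * (q - 1))"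
      by (simp only: powr_powr)
    finally have c1: "c powr (q - 1) = 2 powr ((n - 2) * (q - 1)) * g powr (q - 1) / pi powr (n / 2 * (q - 1))" .
    have K_eq: "K = g * (Gamma ((q + 1) / 2) / Gamma ((q + n) / 2)) / pi powr (1 / 2)"
      by (simp add: K_def g_def powr_half_sqrt)
    \<comment> \<open>Powers are collected by base: those of 2 combine \<open>c powr (q - 1)\<close>
      with the \<open>2 powr (- s)\<close> of \<open>C\<close>, and the extra
      \<open>pi powr (1 / 2)\<close> comes from \<open>K\<close>.\<close>
    have "J = (m powr q) * (g powr (q - 1) * g) * (2 powr ((n - 2) * (q - 1)) * 2 powr (- s)) /
        (pi powr (n / 2 * (q - 1)) * pi powr (1 / 2)) * a powr (m - (m + 1) * q) *
        (Gamma ((q + 1) / 2) / Gamma ((q + n) / 2) * F)"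
      unfolding J_def c1 C_def K_eq by (simp add: mult_ac)
    also have "g powr (q - 1) * g = g powr q"
      using g powr_mult_base[of g "q - 1"] by (simp add: mult.commute)
    also have "2 powr ((n - 2) * (q - 1)) * 2 powr (- s) = (2::real) powr (- (q - 1))"
      by (simp add: powr_add[symmetric] s_def m(1) algebra_simps)
    also have "pi powr (n / 2 * (q - 1)) * pi powr (1 / 2) = pi powr ((n * q - n + 1) / 2)"
      by (simp add: powr_add[symmetric] field_simps)
    also have "a powr (m - (m + 1) * q) = a powr (- (n * (q - 1) + 1))"
      by (simp add: m(1) algebra_simps)
    finally have J_eq: "J = m powr q * g powr q * 2 powr (- (q - 1)) / pi powr ((n * q - n + 1) / 2) *
        a powr (- (n * (q - 1) + 1)) * (Gamma ((q + 1) / 2) / Gamma ((q + n) / 2) * F)" .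
    have root: "(b powr (- y)) powr (1 / q) = 1 / b powr (y / q)" for b y :: real
    proof -
      have "(b powr (- y)) powr (1 / q) = b powr (- (y / q))" by (simp add: powr_powr)
      then show ?thesis by (simp only: powr_minus_divide)
    qed
    have "J powr (1 / q) = (m powr q) powr (1 / q) * (g powr q) powr (1 / q) * (2 powr (- (q - 1))) powr (1 / q) /
        (pi powr ((n * q - n + 1) / 2)) powr (1 / q) * (a powr (- (n * (q - 1) + 1))) powr (1 / q) *
        (Gamma ((q + 1) / 2) / Gamma ((q + n) / 2) * F) powr (1 / q)"
      unfolding J_eq powr_mult[of _ "Gamma ((q + 1) / 2) / Gamma ((q + n) / 2) * F"]
      by (simp add: powr_mult powr_divide)
    also have "(m powr q) powr (1 / q) = m" using q0 m by (simp add: powr_powr)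
    also have "(g powr q) powr (1 / q) = g" using q0 g by (simp add: powr_powr)
    also have "(2 powr (- (q - 1))) powr (1 / q) = 1 / 2 powr ((q - 1) / q)"
      by (rule root)
    also have "(pi powr ((n * q - n + 1) / 2)) powr (1 / q) = pi powr ((n * q - n + 1) / (2 * q))"
      by (simp add: powr_powr)
    also have "(a powr (- (n * (q - 1) + 1))) powr (1 / q) = 1 / a powr ((n * (q - 1) + 1) / q)"
      by (rule root)
    finally show ?thesis by (simp add: m(1) g_def mult_ac)
  qed
  also have "F = hypergeo_2F1 ((n - 1) * (1 - q) / 2) ((1 - (n - 1) * (q - 1)) / 2) ((q + n) / 2) 1"
  proof -
    have "- s = (n - 1) * (1 - q)" "s = (n - 1) * (q - 1)" by (simp_all add: s_def m(1) algebra_simps)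
    then show ?thesis unfolding F_def by simp
  qed
  finally show ?thesis unfolding a_def .
qed

theorem theorem1p4:
  fixes n :: nat and p q :: real
  assumes "n \<ge> 3" and "p > real n" and "1 / p + 1 / q = 1"
    and "CARD('n::finite) = n" and "CARD('m::finite) = n - 1"
  shows
    "(\<forall>x \<in> ball (0 :: real ^ 'n) 1.
        sharp_gradient_estimate poisson_ball p sphere_measure x
          (2 * (real n - 1) *
           (Gamma (real n / 2) * Gamma ((q + 1) / 2) *
              (1 + (norm x)\<^sup>2) powr ((real n - 1) * (q - 1)) /
            (sqrt pi * Gamma ((q + real n) / 2) *
              (1 - (norm x)\<^sup>2) powr (real n * (q - 1) + 1))) powr (1 / q) *
           (hypergeo_2F1 ((real n - 1) * (1 - q) / 2) ((1 - (real n - 1) * (q - 1)) / 2)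
              ((q + real n) / 2) (4 * (norm x)\<^sup>2 / (1 + (norm x)\<^sup>2)\<^sup>2)) powr (1 / q)))
     \<and>
     (\<forall>x \<in> (half_space :: ((real ^ 'm) \<times> real) set).
        sharp_gradient_estimate poisson_half_space p lebesgue x
          ((real n - 1) * Gamma (real n / 2) /
           (2 powr ((q - 1) / q) * pi powr ((real n * q - real n + 1) / (2 * q)) *
              snd x powr ((real n * (q - 1) + 1) / q)) *
           (Gamma ((q + 1) / 2) / Gamma ((q + real n) / 2) *
            hypergeo_2F1 ((real n - 1) * (1 - q) / 2) ((1 - (real n - 1) * (q - 1)) / 2)
              ((q + real n) / 2) 1) powr (1 / q)))"
proof -
  have dimn: "DIM(real ^ 'n) = n" and dimm: "DIM(real ^ 'm) = n - 1"
    using assms(4,5) by simp_all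
  \<comment> \<open>\<open>real ^ 'm\<close> serves twice: as the boundary of the half-space and as
    the type \<open>'b\<close> in the dimension hypothesis for the ball.\<close>
  have dim: "DIM(real ^ 'n) = DIM(real ^ 'm) + 1" using dimn dimm assms(1) by simp
  have rm: "real (n - 1) = real n - 1" "real DIM(real ^ 'm) + 1 = real n"
    using assms(1) dimm by simp_all
  have p: "p > 1" "p - 1 > 0" using assms(1,2) by auto
  have "1 / q = (p - 1) / p" using assms(3) p by (simp add: field_simps)
  then have q_eq: "q = p / (p - 1)" by (metis inverse_divide inverse_eq_divide inverse_inverse_eq)
  then have q1: "q - 1 = 1 / (p - 1)" using p by (simp add: field_simps)
  then have q: "q > 1" using p by (smt (verit) divide_pos_pos)
  \<comment> \<open>The left side is \<open>(n - 1) / (p - 1)\<close>, which is below 1 because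
    \<open>p > n\<close>.\<close>
  have s: "(real n - 1) * (q - 1) < 1" unfolding q1 using assms(2) p by simp
  show ?thesis
  proof (intro conjI ballI, goal_cases)
    case (1 x)
    then have x: "norm x < 1" by simp
    show ?case
      using sharp_gradient_estimate_poisson_ball[OF dim p(1) q assms(3) _ x] s
      unfolding dimn rm(1) by blast
  next
    case (2 x)
    then have x: "snd x > 0" by (simp add: half_space_def)
    have s': "real DIM(real ^ 'm) * (q - 1) < 1" using s unfolding dimm rm(1) .
    show ?case
      using sharp_gradient_estimate_poisson_half_space[OF p(1) q assms(3) s' x]
      unfolding rm(2) .
  qed
qed

end
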